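(* The variety $X'$ (a second copy of the cotangent bundle of the variety of complete flags in $\mathbb C^n$) is a 3d mirror of the variety $X$ (the cotangent bundle of the variety of complete flags in $\mathbb C^n$), where the restriction matrices of the elliptic stable envelopes are $A_{I,J}=\mathbf{Stab}(I)|_{\widehat{\mathsf O}_J}$ for $X$ and $A'_{I,J}=\mathbf{Stab}'(I)|_{\widehat{\mathsf O}'_J}$ for $X'$.
   Context: 3d mirror (definition). Let $X,X'$ be symplectic varieties with Hamiltonian actions of tori $\mathsf T,\mathsf T'$ with finite fixed point sets, with restriction matrices of elliptic stable envelopes $A_{I,J}$ ($I,J\in X^{\mathsf T}$), $A'_{I,J}$ ($I,J\in(X')^{\mathsf T'}$); these depend on equivariant parameters (coordinates on $\mathsf T$, resp. $\mathsf T'$) and Kähler parameters (coordinates on $\mathsf K=\mathrm{Pic}(X)\otimes_{\mathbb Z}\mathbb C^\times$, resp. $\mathsf K'=\mathrm{Pic}(X')\otimes_{\mathbb Z}\mathbb C^\times$). $X'$ is a 3d mirror of $X$ if: (1) there is a bijection $X^{\mathsf T}\to(X')^{\mathsf T'}$, $I\mapsto I'$; (2) there is an isomorphism $\kappa:\mathsf T\to\mathsf K'$, $\mathsf K\to\mathsf T'$, identifying the equivariant and Kähler parameters of $X$ with, respectively, the Kähler and equivariant parameters of $X'$; (3) $A_{I,J}=\kappa^*(A'_{J',I'})$ for all $I,J\in X^{\mathsf T}$. Elliptic curve and theta function. Fix $q\in\mathbb C^*$, $|q|<1$, $E=\mathbb C^*/q^{\mathbb Z}$, and $$\vartheta(x)=(x^{1/2}-x^{-1/2})\,\phi(qx)\,\phi(q/x),\qquad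 \phi(x)=\prod_{s\ge 0}(1-q^s x).$$ (Functions involving $x^{1/2}$ are understood as functions of the logarithms of the variables, i.e. as sections of line bundles over products of copies of $E$.) Permutations. A permutation $I\in\mathfrak S_n$ is written $I=(I_1,\dots,I_n)$, $I_k=I(k)$. For $1\le k\le n$ write $\{i^{(k)}_1<\dots<i^{(k)}_k\}=\{I_1,\dots,I_k\}$. $\sigma_0=(n,n-1,\dots,1)$ is the longest permutation. Put $z_\sigma=(z_{\sigma(1)},\dots,z_{\sigma(n)})$, $1/z=(1/z_1,\dots,1/z_n)$, $\sigma^{-1}(I)=(\sigma^{-1}(I_1),\dots,\sigma^{-1}(I_n))$. Elliptic weight functions. Let $t=(t^{(k)}_a)_{1\le a\le k\le n-1}$, $t^{(n)}_i=z_i$, and $\mu=(\mu_1,\dots,\mu_n)$. Define $W_I(t,z,\hbar,\mu)=\mathrm{Sym}_{t^{(1)}}\cdots\mathrm{Sym}_{t^{(n-1)}}U_I(t,z,\hbar,\mu)$, where $\mathrm{Sym}_{t^{(k)}}$ is the sum over all permutations of $t^{(k)}_1,\dots,t^{(k)}_k$ and $$U_I=\prod_{k=1}^{n-1}\frac{\prod_{a=1}^{k}\prod_{c=1}^{k+1}\psi_{I,k,a,c}\big(t^{(k+1)}_c/t^{(k)}_a\big)}{\prod_{1\le a<b\le k}\vartheta\big(\hbar t^{(k)}_a/t^{(k)}_b\big)\,\vartheta\big(t^{(k)}_b/t^{(k)}_a\big)},$$ $$\psi_{I,k,a,c}(x)=\begin{cases}\vartheta(\hbar x), & i^{(k+1)}_c<i^{(k)}_a,\\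 \vartheta\big(x\,\hbar^{1-p_{I,k+1}(i^{(k)}_a)}\,\mu_{k+1}/\mu_{j(I,k,a)}\big), & i^{(k+1)}_c=i^{(k)}_a,\\ \vartheta(x), & i^{(k+1)}_c>i^{(k)}_a.\end{cases}$$ Here $j(I,k,a)$ is the index with $I_{j(I,k,a)}=i^{(k)}_a$, and $p_{I,j}(m)=1$ if $I_j<m$, $p_{I,j}(m)=0$ if $I_j\ge m$. For $\sigma\in\mathfrak S_n$ put $W_{\sigma,I}(t,z,\hbar,\mu)=W_{\sigma^{-1}(I)}(t,z_\sigma,\hbar,\mu)$. The variety $X$ and its extended elliptic cohomology. The torus $\mathsf T=(\mathbb C^* )^n\times\mathbb C^*_\hbar$ acts on $X$, where $(\mathbb C^* )^n$ acts through its action on $\mathbb C^n$ by $(x_1,\dots,x_n)\mapsto(x_1z_1^{-1},\dots,x_nz_n^{-1})$ and $\mathbb C_\hbar^*$ scales the cotangent fibers by $\hbar^{-1}$. Fixed points $X^{\mathsf T}$ are the coordinate flags $V_k(I)=\mathrm{Span}(e_{I_1},\dots,e_{I_k})$, $I\in\mathfrak S_n$. $\mathscr E_{\mathsf T}$ (coordinates $z_1,\dots,z_n,\hbar$, the equivariant parameters) is the $\mathsf T$-equivariant elliptic cohomology of a point and $\mathscr E_{\mathrm{Pic}(X)}=\mathrm{Pic}(X)\otimes_{\mathbb Z}E$ (coordinates $\mu_1,\dots,\mu_n$, the Kähler parameters). The extended elliptic cohomology $\mathsf E_{\mathsf T}(X)=\mathrm{Ell}_{\mathsf T}(X)\times\mathscr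 E_{\mathrm{Pic}(X)}$ is embedded by the elliptic Chern classes of the tautological bundles, $c_X:\mathsf E_{\mathsf T}(X)\hookrightarrow \mathsf S(X)\times\mathscr E_{\mathsf T}\times\mathscr E_{\mathrm{Pic}(X)}$, $\mathsf S(X)=\prod_{k=1}^{n-1}S^kE$, with $t^{(k)}_1,\dots,t^{(k)}_k$ (Chern roots of the rank $k$ tautological bundle) coordinates on the $k$-th factor. It is the union of components $\widehat{\mathsf O}_I\cong\mathscr E_{\mathsf T}\times\mathscr E_{\mathrm{Pic}(X)}$, where $\widehat{\mathsf O}_I$ is cut out by $t^{(k)}_l=z_{i^{(k)}_l}$, $1\le l\le k\le n-1$; restriction of a section to $\widehat{\mathsf O}_I$ is this substitution. Stable envelopes. $\mathbf{Stab}(I)=c_X^*W_{I}(t,z,\hbar,\mu)$ is the normalized (holomorphic) elliptic stable envelope for $X$ (chamber $\mathrm{id}$). For $X'$, with torus $\mathsf T'$, equivariant parameters $z',\hbar'$, Kähler parameters $\mu'$, Chern roots $t'$ and components $\widehat{\mathsf O}'_I$ defined in the same way, the elliptic stable envelope (chamber $\sigma_0$) is $\mathbf{Stab}'(I)=(-1)^{n(n-1)/2}\,c_{X'}^*W_{\sigma_0,I}(t',z',\hbar',1/\mu')$. *)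

theory Defs
  imports
    "HOL-Analysis.Analysis"
    "HOL-Combinatorics.Permutations"
    "HOL-Library.Function_Algebras"
begin

section \<open>The cotangent bundle of the flag variety and its torus action\<close>

text \<open>Coordinates are numbered from 1, and \<open>\<complex>\<^sup>n\<close> is the space of functions vanishing
  outside \<open>{1..n}\<close>; it is used both for vectors and for logarithms of torus coordinates.\<close>

definition cscale :: "complex \<Rightarrow> (nat \<Rightarrow> complex) \<Rightarrow> nat \<Rightarrow> complex" where
  "cscale c v = (\<lambda>i. c * v i)"

interpretation cfun: vector_space cscale
  by unfold_locales (auto simp: cscale_def fun_eq_iff algebra_simps)

definition Cn :: "nat \<Rightarrow> (nat \<Rightarrow> complex) set" where
  "Cn n = {v. \<forall>i. i \<notin> {1..n} \<longrightarrow> v i = 0}"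

definition basis_vec :: "nat \<Rightarrow> nat \<Rightarrow> complex" where
  "basis_vec i = (\<lambda>j. if j = i then 1 else 0)"

text \<open>A complete flag \<open>0 = V 0 \<subset> V 1 \<subset> \<dots> \<subset> V n = \<complex>\<^sup>n\<close>; the value \<open>V k = \<complex>\<^sup>n\<close> for \<open>k > n\<close> only
  serves to make the representation unique.\<close>

definition complete_flags :: "nat \<Rightarrow> (nat \<Rightarrow> (nat \<Rightarrow> complex) set) set" where
  "complete_flags n = {V.
     (\<forall>k. cfun.subspace (V k)) \<and> (\<forall>k\<le>n. cfun.dim (V k) = k) \<and>
     (\<forall>k<n. V k \<subseteq> V (Suc k)) \<and> (\<forall>k\<ge>n. V k = Cn n)}"

definition mat_app :: "nat \<Rightarrow> (nat \<Rightarrow> nat \<Rightarrow> complex) \<Rightarrow> (nat \<Rightarrow> complex) \<Rightarrow> nat \<Rightarrow> complex" where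
  "mat_app n \<phi> v = (\<lambda>i. \<Sum>j\<in>{1..n}. \<phi> i j * v j)"

type_synonym flag_covector = "(nat \<Rightarrow> (nat \<Rightarrow> complex) set) \<times> (nat \<Rightarrow> nat \<Rightarrow> complex)"

text \<open>The tangent space of the flag variety at \<open>V\<close> is \<open>End(\<complex>\<^sup>n)\<close> modulo the endomorphisms preserving
  \<open>V\<close>; by the trace form its dual is the space of \<open>\<phi>\<close> with \<open>\<phi> (V (k+1)) \<subseteq> V k\<close>.\<close>

definition cotangent_flags :: "nat \<Rightarrow> flag_covector set" where
  "cotangent_flags n = {(V, \<phi>). V \<in> complete_flags n \<and>
     (\<forall>i j. i \<notin> {1..n} \<or> j \<notin> {1..n} \<longrightarrow> \<phi> i j = 0) \<and>
     (\<forall>k<n. \<forall>v\<in>V (Suc k). mat_app n \<phi> v \<in> V k)}"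

text \<open>Points \<open>(z, c)\<close>, \<open>c = \<hbar>\<close>, of \<open>(\<complex>\<^sup>*)\<^sup>n \<times> \<complex>\<^sup>*\<close>, with \<open>z\<close> padded by \<open>1\<close>.\<close>

definition equivariant_torus :: "nat \<Rightarrow> ((nat \<Rightarrow> complex) \<times> complex) set" where
  "equivariant_torus n = {(z, c). (\<forall>i. z i \<noteq> 0) \<and> (\<forall>i. i \<notin> {1..n} \<longrightarrow> z i = 1) \<and> c \<noteq> 0}"

text \<open>\<open>\<complex>\<^sup>n\<close> is acted on by \<open>D = diag(1/z)\<close>, a covector \<open>\<phi>\<close> is sent to \<open>c\<^sup>-\<^sup>1 D \<phi> D\<^sup>-\<^sup>1\<close>.\<close>

fun flag_action :: "(nat \<Rightarrow> complex) \<times> complex \<Rightarrow> flag_covector \<Rightarrow> flag_covector" where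
  "flag_action (z, c) (V, \<phi>) =
     ((\<lambda>k. (\<lambda>v i. v i / z i) ` V k), (\<lambda>i j. \<phi> i j * z j / (c * z i)))"

definition coord_flag_point :: "nat \<Rightarrow> (nat \<Rightarrow> nat) \<Rightarrow> flag_covector" where
  "coord_flag_point n I =
     ((\<lambda>k. cfun.span (basis_vec ` I ` {1..min k n})), (\<lambda>i j. 0))"

definition perm_of_point :: "nat \<Rightarrow> flag_covector \<Rightarrow> nat \<Rightarrow> nat" where
  "perm_of_point n x = (THE I. I permutes {1..n} \<and> coord_flag_point n I = x)"

section \<open>Theta function and elliptic weight functions\<close>

text \<open>All variables of theta functions are logarithms: a parameter \<open>x\<close> of the torus is
  represented by \<open>u\<close> with \<open>x = exp u\<close>, and \<open>x\<^sup>1\<^sup>/\<^sup>2\<close> stands for \<open>exp (u/2)\<close>. Products and quotients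
  of parameters become sums and differences. In particular \<open>t\<close>, \<open>z\<close>, \<open>h\<close>, \<open>\<mu>\<close> below are the
  logarithms of the Chern roots, the equivariant parameters, \<open>\<hbar>\<close>, and the Kaehler parameters.\<close>

definition qphi :: "complex \<Rightarrow> complex \<Rightarrow> complex" where
  "qphi q x = prodinf (\<lambda>s. 1 - q ^ s * x)"

definition theta :: "complex \<Rightarrow> complex \<Rightarrow> complex" where
  "theta q u = (exp (u / 2) - exp (- u / 2)) * qphi q (q * exp u) * qphi q (q / exp u)"

text \<open>\<open>idx I k a\<close> is \<open>i\<^sup>(\<^sup>k\<^sup>)\<^sub>a\<close>, the \<open>a\<close>-th smallest element of \<open>{I\<^sub>1, \<dots>, I\<^sub>k}\<close>.\<close>

definition idx :: "(nat \<Rightarrow> nat) \<Rightarrow> nat \<Rightarrow> nat \<Rightarrow> nat" where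
  "idx I k a = sorted_list_of_set (I ` {1..k}) ! (a - 1)"

definition p_ind :: "(nat \<Rightarrow> nat) \<Rightarrow> nat \<Rightarrow> nat \<Rightarrow> complex" where
  "p_ind I j m = (if I j < m then 1 else 0)"

definition psi :: "complex \<Rightarrow> (nat \<Rightarrow> nat) \<Rightarrow> complex \<Rightarrow> (nat \<Rightarrow> complex) \<Rightarrow>
    nat \<Rightarrow> nat \<Rightarrow> nat \<Rightarrow> complex \<Rightarrow> complex" where
  "psi q I h \<mu> k a c x =
     (if idx I (k + 1) c < idx I k a then theta q (h + x)
      else if idx I (k + 1) c = idx I k a then
        theta q (x + (1 - p_ind I (k + 1) (idx I k a)) * h + \<mu> (k + 1) - \<mu> (inv I (idx I k a)))
      else theta q x)"

text \<open>Here \<open>t k a\<close> is \<open>t\<^sup>(\<^sup>k\<^sup>)\<^sub>a\<close> for all \<open>1 \<le> a \<le> k \<le> n\<close>, including \<open>k = n\<close>.\<close>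

definition weight_U :: "complex \<Rightarrow> nat \<Rightarrow> (nat \<Rightarrow> nat) \<Rightarrow>
    (nat \<Rightarrow> nat \<Rightarrow> complex) \<Rightarrow> complex \<Rightarrow> (nat \<Rightarrow> complex) \<Rightarrow> complex" where
  "weight_U q n I t h \<mu> =
     (\<Prod>k\<in>{1..n-1}.
        (\<Prod>a\<in>{1..k}. \<Prod>c\<in>{1..k+1}. psi q I h \<mu> k a c (t (k + 1) c - t k a)) /
        (\<Prod>a\<in>{1..k}. \<Prod>b\<in>{a+1..k}. theta q (h + t k a - t k b) * theta q (t k b - t k a)))"

definition Sym :: "nat \<Rightarrow> ((nat \<Rightarrow> nat \<Rightarrow> complex) \<Rightarrow> complex) \<Rightarrow> (nat \<Rightarrow> nat \<Rightarrow> complex) \<Rightarrow> complex" where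
  "Sym k f t = (\<Sum>s | s permutes {1..k}. f (t(k := t k \<circ> s)))"

text \<open>\<open>Sym_upto m f\<close> is \<open>Sym 1 (Sym 2 \<dots> (Sym m f))\<close>.\<close>

primrec Sym_upto :: "nat \<Rightarrow> ((nat \<Rightarrow> nat \<Rightarrow> complex) \<Rightarrow> complex) \<Rightarrow> (nat \<Rightarrow> nat \<Rightarrow> complex) \<Rightarrow> complex" where
  "Sym_upto 0 f = f"
| "Sym_upto (Suc m) f = Sym_upto m (Sym (Suc m) f)"

type_synonym weight_section =
  "(nat \<Rightarrow> nat \<Rightarrow> complex) \<Rightarrow> (nat \<Rightarrow> complex) \<Rightarrow> complex \<Rightarrow> (nat \<Rightarrow> complex) \<Rightarrow> complex"

definition weight_W :: "complex \<Rightarrow> nat \<Rightarrow> (nat \<Rightarrow> nat) \<Rightarrow> weight_section" where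
  "weight_W q n I t z h \<mu> = Sym_upto (n - 1) (\<lambda>s. weight_U q n I (s(n := z)) h \<mu>) t"

definition weight_W_chamber :: "complex \<Rightarrow> nat \<Rightarrow> (nat \<Rightarrow> nat) \<Rightarrow> (nat \<Rightarrow> nat) \<Rightarrow> weight_section" where
  "weight_W_chamber q n \<sigma> I t z h \<mu> = weight_W q n (inv \<sigma> \<circ> I) t (z \<circ> \<sigma>) h \<mu>"

definition longest_perm :: "nat \<Rightarrow> nat \<Rightarrow> nat" where
  "longest_perm n i = (if i \<in> {1..n} then n + 1 - i else i)"

section \<open>Restriction matrices\<close>

text \<open>Triples \<open>(z, h, \<mu>)\<close> of logarithms of equivariant and Kaehler parameters.\<close>

type_synonym params = "(nat \<Rightarrow> complex) \<times> complex \<times> (nat \<Rightarrow> complex)"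

definition log_params :: "nat \<Rightarrow> nat \<Rightarrow> params set" where
  "log_params m n = Cn m \<times> UNIV \<times> Cn n"

definition generic_params :: "complex \<Rightarrow> nat \<Rightarrow> params set" where
  "generic_params q n = {(z, h, \<mu>). (z, h, \<mu>) \<in> log_params n n \<and>
     (\<forall>i\<in>{1..n}. \<forall>j\<in>{1..n}. i \<noteq> j \<longrightarrow> theta q (z i - z j) \<noteq> 0 \<and> theta q (h + z i - z j) \<noteq> 0)}"

text \<open>Restriction to the component \<open>O\<^sub>J\<close> of the extended elliptic cohomology is the substitution
  \<open>t\<^sup>(\<^sup>k\<^sup>)\<^sub>l = z (i\<^sup>(\<^sup>k\<^sup>)\<^sub>l)\<close>. For a weight function every denominator of the resulting expression is a
  product of factors \<open>theta q (z i - z j)\<close> and \<open>theta q (h + z i - z j)\<close> with \<open>i \<noteq> j\<close>, while the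
  restricted section itself is holomorphic. The limit along the generic parameters, which is the
  plain substitution wherever the denominators do not vanish, gives its value at every parameter
  and avoids the convention \<open>x / 0 = 0\<close>.\<close>

definition restrict_component ::
  "complex \<Rightarrow> nat \<Rightarrow> weight_section \<Rightarrow> (nat \<Rightarrow> nat) \<Rightarrow> params \<Rightarrow> complex" where
  "restrict_component q n f J p =
     Lim (at p within generic_params q n) (\<lambda>(z, h, \<mu>). f (\<lambda>k l. z (idx J k l)) z h \<mu>)"

definition Stab :: "complex \<Rightarrow> nat \<Rightarrow> (nat \<Rightarrow> nat) \<Rightarrow> weight_section" where
  "Stab q n I = weight_W q n I"

definition Stab' :: "complex \<Rightarrow> nat \<Rightarrow> (nat \<Rightarrow> nat) \<Rightarrow> weight_section" where
  "Stab' q n I t z h \<mu> =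
     (-1) ^ (n * (n - 1) div 2) * weight_W_chamber q n (longest_perm n) I t z h (\<lambda>i. - \<mu> i)"

section \<open>3d mirrors\<close>

text \<open>The equivariant torus is \<open>(\<complex>\<^sup>*)\<^sup>m \<times> \<complex>\<^sup>*\<close> with coordinates \<open>z\<^sub>1, \<dots>, z\<^sub>m, \<hbar>\<close> where \<open>m = eq_rank\<close>, and
  \<open>\<mu>\<^sub>1, \<dots>, \<mu>\<^sub>l\<close> with \<open>l = kah_rank\<close> are the coordinates on the Kaehler torus. Both the \<open>z\<close> and the \<open>\<mu>\<close>
  are homogeneous coordinates: the diagonal of \<open>(\<complex>\<^sup>*)\<^sup>m\<close> acts trivially, and the Kaehler torus is
  \<open>(\<complex>\<^sup>*)\<^sup>l\<close> modulo its diagonal.\<close>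

record 'x stab_data =
  points :: "'x set"
  action :: "(nat \<Rightarrow> complex) \<times> complex \<Rightarrow> 'x \<Rightarrow> 'x"
  eq_rank :: nat
  kah_rank :: nat
  restr_matrix :: "'x \<Rightarrow> 'x \<Rightarrow> params \<Rightarrow> complex"

definition fixed_points :: "'x stab_data \<Rightarrow> 'x set" where
  "fixed_points X = {x \<in> points X. \<forall>g\<in>equivariant_torus (eq_rank X). action X g x = x}"

text \<open>An isomorphism of tori \<open>(\<complex>\<^sup>*)\<^sup>m \<rightarrow> (\<complex>\<^sup>*)\<^sup>n\<close> is given by an invertible integer matrix of exponents,
  acting linearly on logarithms. It descends to the quotients by the diagonals iff all row sums
  agree, and every isomorphism of these quotients arises in this way.\<close>

definition torus_iso :: "nat \<Rightarrow> nat \<Rightarrow> ((nat \<Rightarrow> complex) \<Rightarrow> nat \<Rightarrow> complex) \<Rightarrow> bool" where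
  "torus_iso m n \<kappa> \<longleftrightarrow> (\<exists>(M :: nat \<Rightarrow> nat \<Rightarrow> int) (N :: nat \<Rightarrow> nat \<Rightarrow> int) (d :: int).
     (\<forall>i\<in>{1..m}. \<forall>j\<in>{1..m}. (\<Sum>k\<in>{1..n}. N i k * M k j) = (if i = j then 1 else 0)) \<and>
     (\<forall>i\<in>{1..n}. \<forall>j\<in>{1..n}. (\<Sum>k\<in>{1..m}. M i k * N k j) = (if i = j then 1 else 0)) \<and>
     (\<forall>i\<in>{1..n}. (\<Sum>j\<in>{1..m}. M i j) = d) \<and>
     (\<forall>u. \<kappa> u = (\<lambda>i. if i \<in> {1..n} then \<Sum>j\<in>{1..m}. of_int (M i j) * u j else 0)))"

text \<open>\<open>\<kappa>A\<close> identifies the equivariant parameters \<open>z\<close> of \<open>X\<close> with the Kaehler parameters of \<open>X'\<close>, \<open>\<kappa>K\<close> the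
  Kaehler parameters of \<open>X\<close> with the equivariant parameters \<open>z'\<close> of \<open>X'\<close>, and \<open>\<epsilon>\<close> is the exponent of
  the isomorphism between the two remaining one-dimensional tori with coordinates \<open>\<hbar>\<close> and \<open>\<hbar>'\<close>.\<close>

definition is_3d_mirror_of :: "'y stab_data \<Rightarrow> 'x stab_data \<Rightarrow> bool" where
  "is_3d_mirror_of X' X \<longleftrightarrow>
     finite (fixed_points X) \<and> finite (fixed_points X') \<and>
     (\<exists>\<beta> \<kappa>A \<kappa>K (\<epsilon> :: complex).
        bij_betw \<beta> (fixed_points X) (fixed_points X') \<and>
        torus_iso (eq_rank X) (kah_rank X') \<kappa>A \<and>
        torus_iso (kah_rank X) (eq_rank X') \<kappa>K \<and>
        \<epsilon> \<in> {1, -1} \<and>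
        (\<forall>I\<in>fixed_points X. \<forall>J\<in>fixed_points X.
           \<forall>(z, h, \<mu>)\<in>log_params (eq_rank X) (kah_rank X).
             restr_matrix X I J (z, h, \<mu>) = restr_matrix X' (\<beta> J) (\<beta> I) (\<kappa>K \<mu>, \<epsilon> * h, \<kappa>A z)))"

text \<open>The two copies \<open>X\<close> and \<open>X'\<close> of the cotangent bundle of the flag variety.\<close>

definition flag_X :: "complex \<Rightarrow> nat \<Rightarrow> flag_covector stab_data" where
  "flag_X q n = \<lparr>points = cotangent_flags n, action = flag_action, eq_rank = n, kah_rank = n,
     restr_matrix = (\<lambda>x y. restrict_component q n (Stab q n (perm_of_point n x)) (perm_of_point n y))\<rparr>"

definition flag_X' :: "complex \<Rightarrow> nat \<Rightarrow> flag_covector stab_data" where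
  "flag_X' q n = \<lparr>points = cotangent_flags n, action = flag_action, eq_rank = n, kah_rank = n,
     restr_matrix = (\<lambda>x y. restrict_component q n (Stab' q n (perm_of_point n x)) (perm_of_point n y))\<rparr>"

end

theory Submission
  imports Defs "HOL-Complex_Analysis.Complex_Analysis"
begin

text \<open>Both restriction matrices are determined by one triangular column together with exchange
  relations under adjacent transpositions. Exchanging two equivariant parameters \<open>z\<^sub>m, z\<^sub>m\<^sub>+\<^sub>1\<close> in the weight
  function gives a linear relation which mixes the fixed points \<open>I\<close> and \<open>s\<^sub>m I\<close>; it is proved level by
  level and reduces to the three-term identity for theta functions. The analogous relation for the
  Kaehler parameters, which mixes \<open>J\<close> and \<open>J s\<^sub>k\<close>, follows from the first by induction on \<open>J\<close> starting at
  the longest permutation, because the two operators act on opposite sides. Mirror symmetry exchanges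
  the two relations and preserves the initial column, hence identifies the matrices at generic
  parameters. The values at special parameters are limits, and these agree because the limit of a
  continuous function along the generic parameters can be computed on a dense subset.\<close>

section \<open>The theta function\<close>

text \<open>In the weight functions \<open>z\<close> and \<open>\<mu>\<close> enter asymmetrically:
  the equivariant recursion can be read off level by level, whereas the Kaehler one is not visible
  in any single level. It can be transferred because the column of \<open>w0\<close> has a single
  nonzero entry and because a move on the right of \<open>w0 n\<close> is also a move on its left,
  \<open>w0 n \<circ> adj k = adj (n - k) \<circ> w0 n\<close>. Under the mirror map the pair
  \<open>I\<close>, \<open>J\<close> becomes \<open>w0 n \<circ> inv J\<close>,
  \<open>w0 n \<circ> inv I\<close>: inversion exchanges left and right multiplication,
  \<open>w0 n\<close> accounts for the opposite chamber, and \<open>- z\<close> for the inverted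
  Kaehler parameters. The sign \<open>(-1) ^ (n * (n - 1) div 2)\<close> has one source, the oddness
  of \<open>theta\<close>, used once for each pair of indices when the initial entries are compared.
  The recursions are solved by division, so they need nonvanishing theta factors also in the
  differences of \<open>\<mu>\<close> and in mixed differences. The parameters along which
  restriction is defined do not guarantee these; hence a smaller set of parameters, symmetric in
  \<open>z\<close> and \<open>\<mu>\<close>, which has to be shown dense.\<close>

locale nome =
  fixes q :: complex
  assumes q_nz: "q \<noteq> 0" and q_lt1: "norm q < 1"
begin

lemma convergent_qphi: "convergent_prod (\<lambda>s. 1 - q ^ s * x)"
proof (rule abs_convergent_prod_imp_convergent_prod)
  have "summable (\<lambda>s. norm (q ^ s * x))"
    using summable_geometric[of "norm q"] q_lt1
    by (simp add: norm_mult norm_power summable_mult2)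
  then show "abs_convergent_prod (\<lambda>s. 1 - q ^ s * x)"
    by (intro summable_imp_abs_convergent_prod) simp
qed

lemma qphi_shift: "qphi q x = (1 - x) * qphi q (q * x)"
proof -
  have "(\<lambda>s. 1 - q ^ s * x) has_prod ((\<Prod>k<1. 1 - q ^ k * x) * (\<Prod>k. 1 - q ^ (k + 1) * x))"
    by (rule has_prod_ignore_initial_segment'[OF convergent_qphi])
  from has_prod_unique[OF this] show ?thesis
    unfolding qphi_def by (simp add: mult_ac)
qed

lemma qphi_eq_0_iff: "qphi q x = 0 \<longleftrightarrow> (\<exists>s. q ^ s * x = 1)"
proof -
  have "qphi q x = 0 \<longleftrightarrow> 0 \<in> range (\<lambda>s. 1 - q ^ s * x)"
    unfolding qphi_def by (rule has_prod_eq_0_iff[OF convergent_prod_has_prod[OF convergent_qphi]])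
  also have "\<dots> \<longleftrightarrow> (\<exists>s. q ^ s * x = 1)"
    by (simp add: image_iff)
  finally show ?thesis .
qed

lemma qphi_holomorphic: "qphi q holomorphic_on UNIV"
proof (rule holomorphic_uniform_sequence)
  fix z :: complex
  let ?P = "\<lambda>N x. \<Prod>s<N. 1 - q ^ s * x"
  have "uniformly_convergent_on (cball z 1) ?P"
  proof (rule uniformly_convergent_on_prod')
    show "uniformly_convergent_on (cball z 1) (\<lambda>N x. \<Sum>s<N. norm (1 - q ^ s * x - 1))"
    proof (rule Weierstrass_m_test')
      fix s x assume "x \<in> cball z 1"
      then have "norm x \<le> norm z + 1"
        using norm_triangle_ineq[of z "x - z"] by (simp add: dist_norm norm_minus_commute)
      then show "norm (norm (1 - q ^ s * x - 1)) \<le> norm q ^ s * (norm z + 1)"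
        by (simp add: norm_mult norm_power mult_left_mono)
    next
      show "summable (\<lambda>s. norm q ^ s * (norm z + 1))"
        using summable_geometric[of "norm q"] q_lt1 by (simp add: summable_mult2)
    qed
  qed (auto intro!: continuous_intros)
  then obtain g where g: "uniform_limit (cball z 1) ?P g sequentially"
    by (auto simp: uniformly_convergent_on_def)
  also have "?this \<longleftrightarrow> uniform_limit (cball z 1) ?P (qphi q) sequentially"
  proof (intro uniform_limit_cong)
    fix x assume "x \<in> cball z 1"
    \<comment> \<open>The uniform limit is about products over \<open>{..<n}\<close>, the infinite
      product about partial products over \<open>{..n}\<close>; the shift by \<open>Suc\<close>
      makes them comparable.\<close>
    from tendsto_uniform_limitI[OF g this] have "(\<lambda>n. ?P (Suc n) x) \<longlonglongrightarrow> g x"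
      by (rule LIMSEQ_Suc)
    moreover have "(\<lambda>n. ?P (Suc n) x) \<longlonglongrightarrow> qphi q x"
      unfolding lessThan_Suc_atMost qphi_def by (rule convergent_prod_LIMSEQ[OF convergent_qphi])
    ultimately show "g x = qphi q x"
      by (rule tendsto_unique[OF sequentially_bot])
  qed auto
  finally show "\<exists>d>0. cball z d \<subseteq> UNIV \<and> uniform_limit (cball z d) ?P (qphi q) sequentially"
    by (intro exI[of _ 1]) auto
qed (auto intro!: holomorphic_intros)

lemma theta_holomorphic [holomorphic_intros]:
  assumes "f holomorphic_on A"
  shows "(\<lambda>u. theta q (f u)) holomorphic_on A"
proof -
  have qp: "(\<lambda>u. qphi q (g u)) holomorphic_on UNIV" if "g holomorphic_on UNIV" for g
    using holomorphic_on_compose_gen[OF that qphi_holomorphic] by (simp add: o_def)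
  have *: "(\<lambda>u. q * exp u) holomorphic_on UNIV" "(\<lambda>u. q / exp u) holomorphic_on UNIV"
      "(\<lambda>u. exp (u / 2) - exp (- u / 2)) holomorphic_on UNIV"
    by (auto intro!: holomorphic_intros)
  have "(\<lambda>u. (exp (u / 2) - exp (- u / 2)) * qphi q (q * exp u) * qphi q (q / exp u)) holomorphic_on UNIV"
    by (intro holomorphic_on_mult *(3) qp[OF *(1)] qp[OF *(2)])
  then have "theta q holomorphic_on UNIV"
    by (simp add: theta_def[abs_def])
  then show ?thesis
    using holomorphic_on_compose_gen[OF assms, of "theta q" UNIV] by (simp add: o_def)
qed

lemma theta_continuous [continuous_intros]:
  assumes "continuous_on A f"
  shows "continuous_on A (\<lambda>u. theta q (f u))"
proof -
  have "continuous_on UNIV (theta q)"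
    using theta_holomorphic[of "\<lambda>u. u" UNIV] by (simp add: holomorphic_on_imp_continuous_on)
  then show ?thesis
    using continuous_on_compose2 assms by blast
qed

lemma theta_minus: "theta q (- u) = - theta q u"
  by (simp add: theta_def exp_minus field_simps)

lemma theta_0 [simp]: "theta q 0 = 0"
  by (simp add: theta_def)

text \<open>Only the half powers feel the shift: \<open>exp (u / 2)\<close> and its inverse change
  sign, while everything that depends on \<open>exp u\<close> stays the same.\<close>

lemma theta_plus_2pi: "theta q (u + 2 * pi * \<i>) = - theta q u"
proof -
  have 1: "exp (u + 2 * pi * \<i>) = exp u"
    by (simp add: exp_add)
  have 2: "exp ((u + 2 * pi * \<i>) / 2) = - exp (u / 2)"
    by (simp add: add_divide_distrib exp_add)
  have 3: "exp (- (u + 2 * pi * \<i>) / 2) = - exp (- u / 2)"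
    using 2 by (simp only: exp_minus minus_divide_left[symmetric]) simp
  show ?thesis
    unfolding theta_def 1 2 3 by (simp add: algebra_simps)
qed

text \<open>The shift replaces \<open>X = exp u\<close> by \<open>q * X\<close>. The new half-power
  factor supplies the \<open>1 - q * X\<close> that \<open>qphi_shift\<close> splits off on one
  side, and the \<open>1 - 1 / X\<close> split off on the other side restores the old half-power
  factor. The exponentials left over form the multiplier.\<close>

lemma theta_plus_Ln: "theta q (u + Ln q) = - exp (- u - Ln q / 2) * theta q u"
proof -
  define X where "X = exp u"
  define P where "P = qphi q (q * X)"
  define Q where "Q = qphi q (q / X)"
  have X: "X \<noteq> 0" by (simp add: X_def)
  have e: "exp (u + Ln q) = q * X"
    using q_nz by (simp add: exp_add X_def)
  have P: "qphi q (q * X) = (1 - q * X) * qphi q (q * (q * X))"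
    by (rule qphi_shift)
  have Q: "qphi q (q / (q * X)) = (1 - 1 / X) * Q"
    using qphi_shift[of "1 / X"] q_nz by (simp add: Q_def)
  have h: "exp ((u + Ln q) / 2) = exp (- (u + Ln q) / 2) * (q * X)"
  proof -
    have "exp ((u + Ln q) / 2) = exp (- (u + Ln q) / 2 + (u + Ln q))"
      by (simp add: field_simps)
    then show ?thesis using e by (metis exp_add)
  qed
  have m: "1 - 1 / X = exp (- u / 2) * (exp (u / 2) - exp (- u / 2))"
    by (simp add: X_def algebra_simps flip: exp_add exp_minus inverse_eq_divide)
  have "theta q (u + Ln q) = exp (- (u + Ln q) / 2) * (q * X - 1) * qphi q (q * (q * X)) * qphi q (q / (q * X))"
    unfolding theta_def e h by (simp add: algebra_simps)
  also have "\<dots> = - exp (- (u + Ln q) / 2) * P * ((1 - 1 / X) * Q)"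
    unfolding P_def P Q by (simp add: algebra_simps)
  also have "\<dots> = - (exp (- (u + Ln q) / 2) * exp (- u / 2)) * theta q u"
    unfolding m theta_def by (simp add: P_def Q_def X_def)
  also have "exp (- (u + Ln q) / 2) * exp (- u / 2) = exp (- u - Ln q / 2)"
    unfolding exp_add[symmetric] by (rule arg_cong[where f = exp]) (simp add: field_simps)
  finally show ?thesis by simp
qed

text \<open>Each of the three factors of \<open>theta\<close> gives its own range of exponents: the
  half-power factor gives 0, the two infinite products give the negative and the positive
  ones.\<close>

lemma theta_eq_0_lattice:
  assumes "theta q u = 0"
  obtains k :: int where "exp u = q powi k"
proof -
  consider "exp (u / 2) = exp (- u / 2)" | s where "q ^ s * (q * exp u) = 1"
    | s where "q ^ s * (q / exp u) = 1"
    using assms by (auto simp: theta_def qphi_eq_0_iff)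
  then show ?thesis
  proof cases
    case 1
    have "exp u = exp (u / 2) * exp (u / 2)"
      by (simp flip: exp_add)
    also have "\<dots> = exp (u / 2) * exp (- u / 2)"
      using 1 by simp
    also have "\<dots> = 1"
      by (simp flip: exp_add)
    finally have "exp u = 1" .
    then show ?thesis using that[of 0] by simp
  next
    case (2 s)
    then have "exp u * q powi (int (Suc s)) = 1"
      by (simp only: power_int_of_nat) (simp add: mult_ac)
    then have "exp u = q powi (- int (Suc s))"
      using q_nz by (simp only: power_int_minus) (simp add: field_simps)
    then show ?thesis using that by blast
  next
    case (3 s)
    then have "exp u = q powi (int (Suc s))"
      by (simp only: power_int_of_nat) (simp add: field_simps)
    then show ?thesis using that by blast
  qed
qed

text \<open>Here \<open>exp u\<close> is -1, and no power of \<open>q\<close> with positive exponent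
  equals -1 because its norm is below 1. This one value shows that \<open>theta\<close> is not
  identically zero, which the identity theorem needs later.\<close>

lemma theta_pi_i_nonzero: "theta q (\<i> * pi) \<noteq> 0"
proof
  have e: "exp (\<i> * pi / 2) = \<i>"
    by (metis cis_conv_exp cis_pi_half mult.commute of_real_divide of_real_numeral times_divide_eq_left)
  have "q ^ Suc s * (-1) \<noteq> 1" for s
    using q_lt1 power_Suc_less_one[of "norm q" s]
    by (metis less_irrefl mult.right_neutral norm_ge_zero norm_minus_cancel norm_mult norm_one norm_power power_less_one_iff zero_less_Suc)
  then have "qphi q (- q) \<noteq> 0"
    by (auto simp: qphi_eq_0_iff mult_ac)
  moreover assume "theta q (\<i> * pi) = 0"
  ultimately show False
    by (simp add: theta_def e exp_minus)
qed

text \<open>Zeros of \<open>theta\<close> lie in the lattice spanned by \<open>Ln q\<close> and the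
  period of \<open>exp\<close>. The statement is about a predicate rather than a function because
  quasi-periodic functions change their values under the shifts, but not whether they
  vanish.\<close>

lemma theta_zero_lattice_iff:
  assumes "theta q u = 0"
    and "\<And>v. P (v + Ln q) \<longleftrightarrow> P v" "\<And>v. P (v + 2 * pi * \<i>) \<longleftrightarrow> P v"
  shows "P u \<longleftrightarrow> P 0"
proof -
  have multiple: "P (v + of_int k * w) \<longleftrightarrow> P v" if "\<And>v. P (v + w) \<longleftrightarrow> P v" for v w and k :: int
  proof (induction k rule: int_induct[where k = 0])
    case (step1 i)
    then show ?case using that[of "v + of_int i * w"] by (simp add: algebra_simps)
  next
    case (step2 i)
    then show ?case using that[of "v + of_int (i - 1) * w"] by (simp add: algebra_simps)
  qed auto
  obtain k where "exp u = q powi k"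
    using theta_eq_0_lattice[OF assms(1)] .
  also have "\<dots> = exp (of_int k * Ln q)"
    using q_nz exp_power_int[of "Ln q" k] by simp
  finally obtain m :: int where "u = of_int k * Ln q + (of_int m * pi * 2) * \<i>"
    unfolding exp_eq by (auto simp: mult_ac)
  then have "u = (0 + of_int k * Ln q) + of_int m * (2 * pi * \<i>)"
    by simp
  then show ?thesis
    by (simp only: multiple[OF assms(3)] multiple[OF assms(2)])
qed

text \<open>Both quasi-periods multiply \<open>theta\<close> by a nowhere vanishing entire function,
  so being a simple zero is invariant under the lattice. It remains to look at 0, where the
  derivative is the square of \<open>qphi q q\<close>.\<close>

lemma theta_simple_zero:
  assumes "theta q u = 0"
  shows "deriv (theta q) u \<noteq> 0"
proof -
  have diff: "(theta q has_field_derivative deriv (theta q) v) (at v)" for v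
    using theta_holomorphic[of "\<lambda>u. u" UNIV]
    by (simp add: DERIV_deriv_iff_field_differentiable holomorphic_on_def)
  define Z where "Z v \<longleftrightarrow> theta q v = 0 \<and> deriv (theta q) v \<noteq> 0" for v
  have shift: "Z (v + w) \<longleftrightarrow> Z v"
    if eq: "\<And>v. theta q (v + w) = c v * theta q v" and c: "c holomorphic_on UNIV" "\<And>v. c v \<noteq> 0"
    for v w c
  proof -
    have dc: "(c has_field_derivative deriv c v) (at v)"
      using c(1) by (simp add: DERIV_deriv_iff_field_differentiable holomorphic_on_def)
    have "((\<lambda>v. c v * theta q v) has_field_derivative deriv c v * theta q v + deriv (theta q) v * c v) (at v)"
      by (rule DERIV_mult[OF dc diff])
    moreover have "((\<lambda>v. theta q (v + w)) has_field_derivative deriv (theta q) (v + w)) (at v)"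
      using diff[of "v + w"] by (simp add: DERIV_shift)
    ultimately have "deriv (theta q) (v + w) = deriv c v * theta q v + deriv (theta q) v * c v"
      unfolding eq by (rule DERIV_unique[rotated])
    then show ?thesis
      using c(2) by (auto simp: Z_def eq)
  qed
  have Z1: "Z (v + Ln q) \<longleftrightarrow> Z v" for v
    by (rule shift[OF theta_plus_Ln]) (auto intro!: holomorphic_intros)
  have Z2: "Z (v + 2 * pi * \<i>) \<longleftrightarrow> Z v" for v
    by (rule shift[where c = "\<lambda>_. -1"]) (use theta_plus_2pi in auto)
  have "Z 0"
  proof -
    let ?R = "\<lambda>u. qphi q (q * exp u) * qphi q (q / exp u)"
    have qp: "(\<lambda>u. qphi q (g u)) holomorphic_on UNIV" if "g holomorphic_on UNIV" for g
      using holomorphic_on_compose_gen[OF that qphi_holomorphic] by (simp add: o_def)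
    have "?R holomorphic_on UNIV"
      by (intro holomorphic_on_mult qp holomorphic_on_divide holomorphic_on_const holomorphic_on_exp) simp
    then have R: "(?R has_field_derivative deriv ?R 0) (at 0)"
      by (simp add: DERIV_deriv_iff_field_differentiable holomorphic_on_def)
    have "((\<lambda>u. exp (u / 2) - exp (- u / 2)) has_field_derivative 1) (at (0::complex))"
      by (auto intro!: derivative_eq_intros)
    from DERIV_mult[OF this R] have "(theta q has_field_derivative ?R 0) (at 0)"
      unfolding theta_def by (simp add: mult.assoc)
    then have "deriv (theta q) 0 = ?R 0"
      by (rule DERIV_imp_deriv)
    moreover have "q ^ Suc s \<noteq> 1" for s
      using q_lt1 by (metis less_irrefl norm_ge_zero norm_one norm_power power_less_one_iff zero_less_Suc)
    then have "qphi q q \<noteq> 0"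
      by (auto simp: qphi_eq_0_iff mult_ac)
    ultimately show ?thesis
      by (simp add: Z_def)
  qed
  then have "Z u"
    using theta_zero_lattice_iff[of u Z, OF assms] Z1 Z2 by blast
  then show ?thesis by (simp add: Z_def)
qed

end

section \<open>Quotients of entire functions and doubly periodic entire functions\<close>

lemma field_differentiable_cong_ev:
  assumes "\<forall>\<^sub>F z in nhds a. f z = g z" "g field_differentiable at a"
  shows "f field_differentiable at a"
  using DERIV_cong_ev[OF refl assms(1) refl] assms(2) unfolding field_differentiable_def by blast

text \<open>All zeros of \<open>g\<close> are simple and are also zeros of \<open>f\<close>, so the
  singularities of the quotient are removable; the value there is the quotient of the
  derivatives.\<close>

lemma entire_quotient:
  fixes f g :: "complex \<Rightarrow> complex"
  assumes "f holomorphic_on UNIV" "g holomorphic_on UNIV"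
    and zero: "\<And>u. g u = 0 \<Longrightarrow> f u = 0 \<and> deriv g u \<noteq> 0"
  obtains h where "h holomorphic_on UNIV" "\<And>u. f u = h u * g u"
proof
  define h where "h u = (if g u = 0 then deriv f u / deriv g u else f u / g u)" for u
  show "f u = h u * g u" for u
    using zero[of u] by (auto simp: h_def)
  have ev_ne: "\<forall>\<^sub>F z in nhds a. k z \<noteq> 0" if "k holomorphic_on UNIV" "k a \<noteq> 0" for k :: "complex \<Rightarrow> complex" and a
    using open_Collect_neq[OF holomorphic_on_imp_continuous_on[OF that(1)] continuous_on_const[of UNIV 0]] that(2)
    by (auto simp: eventually_nhds)
  have "h field_differentiable at a" for a
  proof -
    \<comment> \<open>Difference quotients, completed by the derivative, are entire. When
      \<open>f\<close> and \<open>g\<close> both vanish at \<open>a\<close>, passing to them cancels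
      the common factor \<open>z - a\<close>.\<close>
    let ?q = "\<lambda>f z. if z = a then deriv f a else (f z - f a) / (z - a)"
    have hol: "?q f holomorphic_on UNIV" "?q g holomorphic_on UNIV"
      using assms pole_lemma by auto
    show ?thesis
    proof (cases "g a = 0")
      case True
      then have nz: "?q g a \<noteq> 0" using zero by simp
      have "h z = ?q f z / ?q g z" if "?q g z \<noteq> 0" for z
        using that True zero[of a] by (auto simp: h_def)
      with ev_ne[OF hol(2) nz] have "\<forall>\<^sub>F z in nhds a. h z = ?q f z / ?q g z"
        by (auto elim: eventually_mono)
      moreover have "(\<lambda>z. ?q f z / ?q g z) field_differentiable at a"
        using hol nz by (intro field_differentiable_divide) (auto simp: holomorphic_on_def)
      ultimately show ?thesis
        by (rule field_differentiable_cong_ev)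
    next
      case False
      from ev_ne[OF assms(2) this] have "\<forall>\<^sub>F z in nhds a. h z = f z / g z"
        by (auto elim: eventually_mono simp: h_def)
      moreover have "(\<lambda>z. f z / g z) field_differentiable at a"
        using assms False
        by (intro field_differentiable_divide) (auto simp: holomorphic_on_def)
      ultimately show ?thesis
        by (rule field_differentiable_cong_ev)
    qed
  qed
  then show "h holomorphic_on UNIV"
    by (simp add: holomorphic_on_def)
qed

text \<open>A nonzero real part makes \<tau> linearly independent over the reals from the imaginary
  period, so all values are taken on the compact parallelogram \<open>C\<close> and Liouville
  applies.\<close>

lemma doubly_periodic_entire_constant:
  fixes h :: "complex \<Rightarrow> complex"
  assumes hol: "h holomorphic_on UNIV"
    and periods: "\<And>u. h (u + 2 * pi * \<i>) = h u" "\<And>u. h (u + \<tau>) = h u"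
    and \<tau>: "Re \<tau> \<noteq> 0"
  shows "h u = h v"
proof -
  have multiple: "h (v + of_int k * w) = h v" if "\<And>v. h (v + w) = h v" for v w and k :: int
  proof (induction k rule: int_induct[where k = 0])
    case (step1 i)
    then show ?case using that[of "v + of_int i * w"] by (simp add: algebra_simps)
  next
    case (step2 i)
    then show ?case using that[of "v + of_int (i - 1) * w"] by (simp add: algebra_simps)
  qed auto
  define C where "C = (\<lambda>(s::real, t::real). of_real s * \<tau> + of_real t * (2 * pi * \<i>)) ` ({0..1} \<times> {0..1})"
  have "compact C"
    unfolding C_def case_prod_unfold
    by (intro compact_continuous_image continuous_intros compact_Times) auto
  moreover have "range h \<subseteq> h ` C"
  proof
    fix x assume "x \<in> range h"
    then obtain u where u: "x = h u" by blast
    define s where "s = Re u / Re \<tau>"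
    define t where "t = Im (u - of_real s * \<tau>) / (2 * pi)"
    have "u = of_real s * \<tau> + of_real t * (2 * pi * \<i>)"
      using \<tau> by (simp add: complex_eq_iff s_def t_def)
    then have "u = (of_real (frac s) * \<tau> + of_real (frac t) * (2 * pi * \<i>) + of_int \<lfloor>t\<rfloor> * (2 * pi * \<i>)) + of_int \<lfloor>s\<rfloor> * \<tau>"
      by (simp add: frac_def algebra_simps)
    then have "h u = h (of_real (frac s) * \<tau> + of_real (frac t) * (2 * pi * \<i>))"
      by (simp only: multiple[OF periods(1)] multiple[OF periods(2)])
    moreover have "of_real (frac s) * \<tau> + of_real (frac t) * (2 * pi * \<i>) \<in> C"
      unfolding C_def by (rule image_eqI[of _ _ "(frac s, frac t)"]) (auto simp: frac_lt_1 less_imp_le)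
    ultimately show "x \<in> h ` C"
      using u by blast
  qed
  ultimately have "bounded (range h)"
    using hol by (meson bounded_subset compact_continuous_image compact_imp_bounded
        holomorphic_on_imp_continuous_on holomorphic_on_subset subset_UNIV)
  then have "h constant_on UNIV"
    using Liouville_theorem hol by blast
  then show ?thesis
    by (auto simp: constant_on_def)
qed

context nome
begin

text \<open>If \<open>theta q (c * w + b)\<close> vanished on a nonempty open set, it would vanish
  everywhere, in particular at the \<open>w\<close> that solves
  \<open>c * w + b = \<i> * pi\<close>.\<close>

lemma theta_nonzero_dense:
  assumes "U \<noteq> {}" "open U" "c \<noteq> 0"
  shows "\<exists>w\<in>U. theta q (c * w + b) \<noteq> 0"
proof (rule ccontr)
  assume "\<not> ?thesis"
  moreover have "(\<lambda>w. theta q (c * w + b)) holomorphic_on UNIV"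
    by (intro holomorphic_intros)
  moreover obtain w0 where "w0 \<in> U" using assms by blast
  then have "w0 islimpt U"
    using assms by (simp add: interior_open interior_limit_point)
  ultimately have "theta q (c * ((\<i> * pi - b) / c) + b) = 0"
    using analytic_continuation[of "\<lambda>w. theta q (c * w + b)" UNIV U w0 "(\<i> * pi - b) / c"] \<open>w0 \<in> U\<close>
    by (auto simp: connected_UNIV)
  then show False
    using theta_pi_i_nonzero assms by simp
qed

text \<open>The Weierstrass three-term identity. As functions of \<open>x\<close>, the sum and
  \<open>?g\<close> have the same multipliers under both quasi-periods, and the sum vanishes at the
  zeros of \<open>?g\<close>. The quotient is therefore entire and doubly periodic, hence constant,
  and it vanishes at \<open>x = b\<close>. The argument needs \<open>theta q (2 * c)\<close> to be
  nonzero, so that the zeros of \<open>?g\<close> are simple, and \<open>theta q (b - c)\<close> and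
  \<open>theta q (b + c)\<close> for the evaluation at \<open>b\<close>; density removes these
  conditions.\<close>

lemma theta_three_term:
  "theta q (x + a) * theta q (x - a) * theta q (b + c) * theta q (b - c)
   + theta q (x + b) * theta q (x - b) * theta q (c + a) * theta q (c - a)
   + theta q (x + c) * theta q (x - c) * theta q (a + b) * theta q (a - b) = 0"
  (is "?F x a b c = 0")
proof -
  have neg: "theta q (- u - v) = - theta q (u + v)" "theta q (v - u) = - theta q (u - v)" for u v
    unfolding theta_minus[symmetric] by (simp_all add: algebra_simps)
  have generic: "?F x a b c = 0"
    if c: "theta q (2 * c) \<noteq> 0" and bc: "theta q (b - c) \<noteq> 0" "theta q (b + c) \<noteq> 0" for x b c
  proof -
    let ?g = "\<lambda>x. theta q (x + c) * theta q (x - c)"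
    have shift_pi: "theta q (u + 2 * pi * \<i> + v) = - theta q (u + v)"
      "theta q (u + 2 * pi * \<i> - v) = - theta q (u - v)" for u v
      unfolding theta_plus_2pi[symmetric] by (simp_all add: algebra_simps)
    have shift_Ln: "theta q (u + Ln q + v) * theta q (u + Ln q - v)
      = exp (- 2 * u - Ln q) * (theta q (u + v) * theta q (u - v))" for u v
    proof -
      have "theta q (u + Ln q + v) * theta q (u + Ln q - v) = theta q (u + v + Ln q) * theta q (u - v + Ln q)"
        by (simp add: algebra_simps)
      also have "\<dots> = (exp (- (u + v) - Ln q / 2) * exp (- (u - v) - Ln q / 2)) * (theta q (u + v) * theta q (u - v))"
        unfolding theta_plus_Ln by simp
      also have "exp (- (u + v) - Ln q / 2) * exp (- (u - v) - Ln q / 2) = exp (- 2 * u - Ln q)"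
        by (simp flip: exp_add)
      finally show ?thesis .
    qed
    have g_shift: "?g (u + 2 * pi * \<i>) = ?g u" "?g (u + Ln q) = exp (- 2 * u - Ln q) * ?g u" for u
      by (simp_all only: shift_pi shift_Ln mult_minus_left mult_minus_right minus_minus)
    have F_shift: "?F (u + 2 * pi * \<i>) a b c = ?F u a b c" "?F (u + Ln q) a b c = exp (- 2 * u - Ln q) * ?F u a b c" for u
      by (simp_all only: shift_pi shift_Ln mult_minus_left mult_minus_right minus_minus distrib_left mult.assoc)
    have F_zero_lattice: "?F (x + v) a b c = 0 \<longleftrightarrow> ?F x a b c = 0" if "theta q v = 0" for x v
      using theta_zero_lattice_iff[of v "\<lambda>v. ?F (x + v) a b c = 0", OF that] F_shift
      by (simp only: add.assoc[symmetric]) simp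
    have theta_zero_lattice: "theta q (x + v) = 0 \<longleftrightarrow> theta q x = 0" if "theta q v = 0" for x v
      using theta_zero_lattice_iff[of v "\<lambda>v. theta q (x + v) = 0", OF that] theta_plus_2pi theta_plus_Ln
      by (simp only: add.assoc[symmetric]) simp
    have Fc: "?F c a b c = 0"
      using neg(2)[of b c] by (simp add: add.commute)
    have Fmc: "?F (- c) a b c = 0"
      using neg(1)[of c a] neg(1)[of c b] neg(2)[of a c] neg(2)[of b c] by (simp add: add.commute)
    have dtheta: "((\<lambda>x. theta q (x + v)) has_field_derivative deriv (theta q) (u + v)) (at u)" for u v
    proof -
      have "(theta q has_field_derivative deriv (theta q) (u + v)) (at (u + v))"
        using theta_holomorphic[of "\<lambda>u. u" UNIV]
        by (simp add: DERIV_deriv_iff_field_differentiable holomorphic_on_def)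
      then show ?thesis by (simp add: DERIV_shift)
    qed
    obtain h where h: "h holomorphic_on UNIV" "\<And>x. ?F x a b c = h x * ?g x"
    proof (rule entire_quotient[of "\<lambda>x. ?F x a b c" ?g])
      fix u assume u: "?g u = 0"
      from DERIV_mult[OF dtheta[of c u] dtheta[of "- c" u]]
      have d: "deriv ?g u = deriv (theta q) (u + c) * theta q (u - c) + deriv (theta q) (u - c) * theta q (u + c)"
        using DERIV_imp_deriv by fastforce
      show "?F u a b c = 0 \<and> deriv ?g u \<noteq> 0"
      proof (cases "theta q (u - c) = 0")
        case True
        have "theta q (u + c) \<noteq> 0"
          using theta_zero_lattice[OF True, of "2 * c"] c by (simp add: algebra_simps)
        then show ?thesis
          using F_zero_lattice[OF True, of c] Fc theta_simple_zero[OF True] True by (simp add: d)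
      next
        case False
        with u have 0: "theta q (u + c) = 0" by simp
        then show ?thesis
          using F_zero_lattice[OF 0, of "- c"] Fmc theta_simple_zero[OF 0] False by (simp add: d)
      qed
    qed (auto intro!: holomorphic_intros)
    \<comment> \<open>Periodicity of \<open>h\<close> results from cancelling \<open>?g\<close>, so
      it is known at first only where \<open>?g\<close> does not vanish. The zeros of
      \<open>?g\<close> contain no nonempty open set, which is enough for entire functions.\<close>
    have dense: "h1 u = h2 u" if "h1 holomorphic_on UNIV" "h2 holomorphic_on UNIV" "\<And>x. ?g x \<noteq> 0 \<Longrightarrow> h1 x = h2 x" for h1 h2 u
    proof (rule ccontr)
      assume nz: "h1 u \<noteq> h2 u"
      let ?U = "{u. h1 u \<noteq> h2 u}" and ?V = "{u. h1 u \<noteq> h2 u \<and> theta q (u + c) \<noteq> 0}"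
      have op: "open ?U" "open ?V"
        using that(1,2)[THEN holomorphic_on_imp_continuous_on]
        by (auto intro!: open_Collect_conj open_Collect_neq theta_continuous continuous_intros)
      have ne: "?U \<noteq> {}" using nz by blast
      have "\<exists>v\<in>?U. theta q (1 * v + c) \<noteq> 0"
        by (rule theta_nonzero_dense[OF ne op(1)]) simp
      then have ne: "?V \<noteq> {}" by auto
      have "\<exists>w\<in>?V. theta q (1 * w + - c) \<noteq> 0"
        by (rule theta_nonzero_dense[OF ne op(2)]) simp
      then obtain w where "h1 w \<noteq> h2 w" "?g w \<noteq> 0" by auto
      then show False using that(3) by blast
    qed
    have h_shift: "(\<lambda>u. h (u + w)) holomorphic_on UNIV" for w
      by (rule holomorphic_on_compose_gen[OF _ h(1), of "\<lambda>u. u + w" UNIV, unfolded o_def])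
        (auto intro!: holomorphic_intros)
    have "h (u + 2 * pi * \<i>) = h u" for u
    proof (rule dense[of "\<lambda>u. h (u + 2 * pi * \<i>)" h])
      show "h (x + 2 * pi * \<i>) = h x" if "?g x \<noteq> 0" for x
        by (rule mult_right_cancel[OF that, THEN iffD1])
          (rule trans[OF h(2)[of "x + 2 * pi * \<i>", symmetric] F_shift(1)[of x], unfolded h(2)[of x], unfolded g_shift(1)[of x]])
    qed (rule h_shift h(1))+
    moreover have "h (u + Ln q) = h u" for u
    proof (rule dense[of "\<lambda>u. h (u + Ln q)" h])
      show "h (x + Ln q) = h x" if "?g x \<noteq> 0" for x
      proof -
        have cancel: "y = z" if "y * (e * g) = e * (z * g)" "e \<noteq> 0" "g \<noteq> 0" for y z e g :: complex
          using that by simp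
        have "h (x + Ln q) * (exp (- 2 * x - Ln q) * ?g x) = exp (- 2 * x - Ln q) * (h x * ?g x)"
          by (rule trans[OF h(2)[of "x + Ln q", symmetric] F_shift(2)[of x], unfolded h(2)[of x], unfolded g_shift(2)[of x]])
        then show ?thesis
          by (rule cancel[OF _ exp_not_eq_zero that])
      qed
    qed (rule h_shift h(1))+
    moreover have "Re (Ln q) \<noteq> 0"
      using q_nz q_lt1 by simp
    ultimately have "h x = h b"
      by (rule doubly_periodic_entire_constant[OF h(1)])
    moreover have "h b = 0"
    proof -
      have "?F b a b c = 0"
        using neg(2)[of a b] by (simp add: add.commute)
      then show ?thesis
        using h(2)[of b] bc by simp
    qed
    ultimately show ?thesis
      using h(2)[of x] by simp
  qed
  show ?thesis
  proof (rule ccontr)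
    assume nz: "?F x a b c \<noteq> 0"
    \<comment> \<open>A counterexample persists under small changes of \<open>c\<close> and then of
      \<open>b\<close>; both are moved until the conditions of \<open>generic\<close> hold.\<close>
    let ?U = "{w. ?F x a b w \<noteq> 0}"
    have ne: "?U \<noteq> {}" using nz by blast
    have op: "open ?U"
      by (auto intro!: open_Collect_neq theta_continuous continuous_intros)
    have "\<exists>w\<in>?U. theta q (2 * w + 0) \<noteq> 0"
      by (rule theta_nonzero_dense[OF ne op]) simp
    then obtain w where w: "?F x a b w \<noteq> 0" "theta q (2 * w + 0) \<noteq> 0" by blast
    let ?V = "{v. ?F x a v w \<noteq> 0}" and ?W = "{v. ?F x a v w \<noteq> 0 \<and> theta q (v - w) \<noteq> 0}"
    have ne: "?V \<noteq> {}" using w by blast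
    have op: "open ?V" "open ?W"
      by (auto intro!: open_Collect_conj open_Collect_neq theta_continuous continuous_intros)
    have "\<exists>v\<in>?V. theta q (1 * v + - w) \<noteq> 0"
      by (rule theta_nonzero_dense[OF ne op(1)]) simp
    then obtain v where v: "?F x a v w \<noteq> 0" "theta q (1 * v + - w) \<noteq> 0" by blast
    from v(2) have "theta q (v - w) \<noteq> 0" by simp
    with v(1) have ne: "?W \<noteq> {}" by blast
    have "\<exists>v\<in>?W. theta q (1 * v + w) \<noteq> 0"
      by (rule theta_nonzero_dense[OF ne op(2)]) simp
    then obtain v where v: "?F x a v w \<noteq> 0" "theta q (v - w) \<noteq> 0" "theta q (1 * v + w) \<noteq> 0" by blast
    from v(3) w(2) have "theta q (v + w) \<noteq> 0" "theta q (2 * w) \<noteq> 0" by simp_all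
    from v(1) generic[OF this(2) v(2) this(1), of x] show False by contradiction
  qed
qed

end

section \<open>Weight functions as sums over levels\<close>

lemma prod_reindex_cong:
  assumes "bij_betw f S T" "\<And>x. x \<in> S \<Longrightarrow> g (f x) = h x"
  shows "prod g T = prod h S"
  using prod.reindex_bij_betw[OF assms(1), of g] prod.cong[OF refl assms(2), of S] by simp

text \<open>This is \<open>psi\<close> with the ranks \<open>a\<close> and \<open>c\<close> replaced
  by the values \<open>v\<close> and \<open>w\<close> standing at these ranks. A transposition of
  two values then acts on the labels directly instead of through a re-sorting.\<close>

definition psi_val :: "complex \<Rightarrow> (nat \<Rightarrow> nat) \<Rightarrow> complex \<Rightarrow> (nat \<Rightarrow> complex) \<Rightarrow>
    nat \<Rightarrow> nat \<Rightarrow> nat \<Rightarrow> complex \<Rightarrow> complex" where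
  "psi_val q I h \<mu> k v w x =
     (if w < v then theta q (h + x)
      else if w = v then theta q (x + (1 - p_ind I (k + 1) v) * h + \<mu> (k + 1) - \<mu> (inv I v))
      else theta q x)"

definition level_weight :: "complex \<Rightarrow> (nat \<Rightarrow> nat) \<Rightarrow> complex \<Rightarrow> (nat \<Rightarrow> complex) \<Rightarrow>
    nat \<Rightarrow> (nat \<Rightarrow> complex) \<Rightarrow> (nat \<Rightarrow> complex) \<Rightarrow> complex" where
  "level_weight q I h \<mu> k X Y =
     (\<Prod>v\<in>I ` {1..k}. \<Prod>w\<in>I ` {1..k+1}. psi_val q I h \<mu> k v w (Y w - X v)) /
     (\<Prod>v\<in>I ` {1..k}. \<Prod>w\<in>{w \<in> I ` {1..k}. v < w}. theta q (h + X v - X w) * theta q (X w - X v))"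

text \<open>The inverse of \<open>idx I k\<close>: the rank of a value among the first
  \<open>k\<close> values of \<open>I\<close>.\<close>

definition slot :: "(nat \<Rightarrow> nat) \<Rightarrow> nat \<Rightarrow> nat \<Rightarrow> nat" where
  "slot I k = inv_into {1..k} (idx I k)"

text \<open>The Chern roots of level \<open>k\<close> are labelled by the values in \<open>{I\<^sub>1, \<dots>, I\<^sub>k}\<close>, not by their ranks.\<close>

primrec weight_sum :: "complex \<Rightarrow> (nat \<Rightarrow> nat) \<Rightarrow> complex \<Rightarrow> (nat \<Rightarrow> complex) \<Rightarrow>
    (nat \<Rightarrow> nat \<Rightarrow> complex) \<Rightarrow> nat \<Rightarrow> (nat \<Rightarrow> complex) \<Rightarrow> complex" where
  "weight_sum q I h \<mu> t 0 Y = 1"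
| "weight_sum q I h \<mu> t (Suc k) Y =
     (\<Sum>s | s permutes {1..k}. level_weight q I h \<mu> k (t k \<circ> s \<circ> slot I k) Y
        * weight_sum q I h \<mu> t k (t k \<circ> s \<circ> slot I k))"

lemma bij_betw_idx:
  assumes "inj I"
  shows "bij_betw (idx I k) {1..k} (I ` {1..k})"
proof -
  let ?xs = "sorted_list_of_set (I ` {1..k})"
  have "length ?xs = k"
    using assms by (simp add: card_image inj_on_subset)
  then have "bij_betw (nth ?xs) {..<k} (I ` {1..k})"
    using bij_betw_nth[of ?xs "{..<k}"] by simp
  moreover have "bij_betw (\<lambda>a. a - 1) {1..k} {..<k}"
    by (rule bij_betwI[where g = Suc]) auto
  ultimately show ?thesis
    using bij_betw_trans by (fastforce simp: idx_def[abs_def] o_def)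
qed

lemma bij_betw_slot: "inj I \<Longrightarrow> bij_betw (slot I k) (I ` {1..k}) {1..k}"
  unfolding slot_def by (intro bij_betw_inv_into bij_betw_idx)

lemma idx_in: "inj I \<Longrightarrow> a \<in> {1..k} \<Longrightarrow> idx I k a \<in> I ` {1..k}"
  using bij_betw_idx bij_betwE by blast

lemma slot_in: "inj I \<Longrightarrow> v \<in> I ` {1..k} \<Longrightarrow> slot I k v \<in> {1..k}"
  using bij_betw_slot bij_betwE by blast

lemma slot_idx: "inj I \<Longrightarrow> a \<in> {1..k} \<Longrightarrow> slot I k (idx I k a) = a"
  unfolding slot_def by (meson bij_betw_idx bij_betw_def inv_into_f_f)

lemma idx_slot: "inj I \<Longrightarrow> v \<in> I ` {1..k} \<Longrightarrow> idx I k (slot I k v) = v"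
  unfolding slot_def by (metis bij_betw_idx bij_betw_def f_inv_into_f)

lemma idx_less_iff:
  assumes "inj I" "a \<in> {1..k}" "b \<in> {1..k}"
  shows "idx I k a < idx I k b \<longleftrightarrow> a < b"
proof -
  let ?xs = "sorted_list_of_set (I ` {1..k})"
  have len: "length ?xs = k"
    using assms by (simp add: card_image inj_on_subset)
  have "sorted_wrt (<) ?xs"
    by simp
  then have less: "?xs ! i < ?xs ! j" if "i < j" "j < k" for i j
    using that len sorted_wrt_nth_less by metis
  show ?thesis
    using less[of "a - 1" "b - 1"] less[of "b - 1" "a - 1"] assms
    by (cases a b rule: linorder_cases) (auto simp: idx_def not_less_iff_gr_or_eq)
qed

lemma level_weight_cong:
  assumes "\<And>v. v \<in> I ` {1..k} \<Longrightarrow> X v = X' v" "\<And>v. v \<in> I ` {1..k+1} \<Longrightarrow> Y v = Y' v"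
  shows "level_weight q I h \<mu> k X Y = level_weight q I h \<mu> k X' Y'"
proof -
  have "psi_val q I h \<mu> k v w (Y w - X v) = psi_val q I h \<mu> k v w (Y' w - X' v)"
    if "v \<in> I ` {1..k}" "w \<in> I ` {1..k+1}" for v w
    using assms that by simp
  then show ?thesis
    unfolding level_weight_def using assms
    by (intro arg_cong2[where f = "(/)"] prod.cong refl) auto
qed

lemma weight_sum_cong:
  assumes "\<And>v. v \<in> I ` {1..k} \<Longrightarrow> Y v = Y' v"
  shows "weight_sum q I h \<mu> t k Y = weight_sum q I h \<mu> t k Y'"
  using assms
proof (cases k)
  case (Suc j)
  have "level_weight q I h \<mu> j X Y = level_weight q I h \<mu> j X Y'" for X
    by (rule level_weight_cong) (use assms Suc in auto)
  then show ?thesis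
    unfolding Suc weight_sum.simps by simp
qed simp

lemma Sym_upto_cong:
  assumes "\<And>t'. (\<And>k. k > m \<Longrightarrow> t' k = t k) \<Longrightarrow> f t' = g t'"
  shows "Sym_upto m f t = Sym_upto m g t"
  using assms
proof (induction m arbitrary: f g)
  case (Suc m)
  have "Sym (Suc m) f t' = Sym (Suc m) g t'" if "\<And>k. k > m \<Longrightarrow> t' k = t k" for t'
    unfolding Sym_def by (intro sum.cong refl Suc.prems) (use that in auto)
  then show ?case
    unfolding Sym_upto.simps by (rule Suc.IH)
qed simp

lemma Sym_sum: "Sym k (\<lambda>t. \<Sum>x\<in>A. f x t) = (\<lambda>t. \<Sum>x\<in>A. Sym k (f x) t)"
  unfolding Sym_def by (rule ext, rule sum.swap)

lemma Sym_upto_sum: "Sym_upto m (\<lambda>t. \<Sum>x\<in>A. f x t) t = (\<Sum>x\<in>A. Sym_upto m (f x) t)"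
proof (induction m arbitrary: f)
  case (Suc m)
  show ?case
    using Suc.IH[of "\<lambda>x. Sym (Suc m) (f x)"] by (simp add: Sym_sum)
qed simp

text \<open>An intermediate form with abstract level factors and roots still indexed by rank. It
  separates the unfolding of the nested symmetrizations from the relabelling by values.\<close>

primrec level_sum :: "(nat \<Rightarrow> (nat \<Rightarrow> complex) \<Rightarrow> (nat \<Rightarrow> complex) \<Rightarrow> complex) \<Rightarrow>
    (nat \<Rightarrow> nat \<Rightarrow> complex) \<Rightarrow> nat \<Rightarrow> (nat \<Rightarrow> complex) \<Rightarrow> complex" where
  "level_sum L t 0 y = 1"
| "level_sum L t (Suc k) y = (\<Sum>s | s permutes {1..k}. L k (t k \<circ> s) y * level_sum L t k (t k \<circ> s))"

text \<open>The factor of level \<open>k\<close> involves only the roots of levels \<open>k\<close>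
  and \<open>k + 1\<close>. Once the top level has been permuted, its roots play the role of
  \<open>y\<close> for the levels below, and \<open>c\<close> collects what has been split off. The
  recursion of \<open>level_sum\<close> also meets level 0, which the product omits; hence the
  assumption on \<open>L 0\<close>.\<close>

lemma Sym_upto_prod_levels:
  assumes "\<And>x y. L 0 x y = 1"
  shows "Sym_upto m (\<lambda>s. (\<Prod>k\<in>{1..m}. L k (s k) (if k = m then y else s (k + 1))) * c) t
    = level_sum L t (Suc m) y * c"
proof (induction m arbitrary: y c)
  case 0
  have "{s. s permutes ({}::nat set)} = {id}" by auto
  then show ?case by (simp add: assms)
next
  case (Suc m)
  let ?F = "\<lambda>s. (\<Prod>k\<in>{1..Suc m}. L k (s k) (if k = Suc m then y else s (k + 1))) * c"
  let ?G = "\<lambda>\<sigma> s. (\<Prod>k\<in>{1..m}. L k (s k) (if k = m then t (Suc m) \<circ> \<sigma> else s (k + 1)))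
      * (L (Suc m) (t (Suc m) \<circ> \<sigma>) y * c)"
  have "Sym_upto (Suc m) ?F t = Sym_upto m (Sym (Suc m) ?F) t"
    by simp
  also have "\<dots> = Sym_upto m (\<lambda>s. \<Sum>\<sigma> | \<sigma> permutes {1..Suc m}. ?G \<sigma> s) t"
  proof (rule Sym_upto_cong)
    fix t' assume t': "\<And>k. k > m \<Longrightarrow> t' k = t k"
    have "?F (t'(Suc m := t' (Suc m) \<circ> \<sigma>)) = ?G \<sigma> t'" for \<sigma>
    proof -
      let ?s = "t'(Suc m := t' (Suc m) \<circ> \<sigma>)"
      have "(\<Prod>k\<in>{1..m}. L k (?s k) (if k = Suc m then y else ?s (k + 1)))
         = (\<Prod>k\<in>{1..m}. L k (t' k) (if k = m then t (Suc m) \<circ> \<sigma> else t' (k + 1)))"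
        by (rule prod.cong) (auto simp: t')
      then show ?thesis
        by (simp add: t' mult_ac)
    qed
    then show "Sym (Suc m) ?F t' = (\<Sum>\<sigma> | \<sigma> permutes {1..Suc m}. ?G \<sigma> t')"
      unfolding Sym_def by (intro sum.cong refl)
  qed
  also have "\<dots> = (\<Sum>\<sigma> | \<sigma> permutes {1..Suc m}. Sym_upto m (?G \<sigma>) t)"
    by (rule Sym_upto_sum)
  also have "\<dots> = (\<Sum>\<sigma> | \<sigma> permutes {1..Suc m}.
      level_sum L t (Suc m) (t (Suc m) \<circ> \<sigma>) * (L (Suc m) (t (Suc m) \<circ> \<sigma>) y * c))"
    by (simp only: Suc.IH)
  also have "\<dots> = level_sum L t (Suc (Suc m)) y * c"
    by (simp only: level_sum.simps(2)[of L t "Suc m"] sum_distrib_right mult_ac sum_distrib_left)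
  finally show ?case .
qed

lemma level_weight_idx:
  assumes "inj I"
  shows "level_weight q I h \<mu> k (x \<circ> slot I k) (y \<circ> slot I (k + 1)) =
     (\<Prod>a\<in>{1..k}. \<Prod>c\<in>{1..k+1}. psi q I h \<mu> k a c (y c - x a)) /
     (\<Prod>a\<in>{1..k}. \<Prod>b\<in>{a+1..k}. theta q (h + x a - x b) * theta q (x b - x a))"
proof -
  have num: "(\<Prod>v\<in>I ` {1..k}. \<Prod>w\<in>I ` {1..k+1}. psi_val q I h \<mu> k v w (y (slot I (k + 1) w) - x (slot I k v)))
    = (\<Prod>a\<in>{1..k}. \<Prod>c\<in>{1..k+1}. psi q I h \<mu> k a c (y c - x a))"
  proof (rule prod_reindex_cong[OF bij_betw_idx[OF assms]])
    show "(\<Prod>w\<in>I ` {1..k+1}. psi_val q I h \<mu> k (idx I k a) w (y (slot I (k + 1) w) - x (slot I k (idx I k a))))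
      = (\<Prod>c\<in>{1..k+1}. psi q I h \<mu> k a c (y c - x a))" if "a \<in> {1..k}" for a
    proof (rule prod_reindex_cong[OF bij_betw_idx[OF assms]])
      show "psi_val q I h \<mu> k (idx I k a) (idx I (k+1) c) (y (slot I (k + 1) (idx I (k+1) c)) - x (slot I k (idx I k a)))
        = psi q I h \<mu> k a c (y c - x a)" if "c \<in> {1..k+1}" for c
        using that \<open>a \<in> {1..k}\<close> by (simp add: slot_idx[OF assms] psi_val_def psi_def)
    qed
  qed
  have den: "(\<Prod>v\<in>I ` {1..k}. \<Prod>w\<in>{w \<in> I ` {1..k}. v < w}.
      theta q (h + x (slot I k v) - x (slot I k w)) * theta q (x (slot I k w) - x (slot I k v)))
    = (\<Prod>a\<in>{1..k}. \<Prod>b\<in>{a+1..k}. theta q (h + x a - x b) * theta q (x b - x a))"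
  proof (rule prod_reindex_cong[OF bij_betw_idx[OF assms]])
    fix a assume a: "a \<in> {1..k}"
    have "bij_betw (idx I k) {a+1..k} {w \<in> I ` {1..k}. idx I k a < w}"
    proof (rule bij_betw_imageI)
      show "inj_on (idx I k) {a+1..k}"
        using bij_betw_idx[OF assms, of k] a by (auto simp: bij_betw_def intro: inj_on_subset)
      show "idx I k ` {a+1..k} = {w \<in> I ` {1..k}. idx I k a < w}"
      proof (intro equalityI subsetI)
        fix w assume "w \<in> {w \<in> I ` {1..k}. idx I k a < w}"
        then have w: "w \<in> I ` {1..k}" "idx I k a < idx I k (slot I k w)"
          using idx_slot[OF assms] by auto
        then have "a < slot I k w"
          using idx_less_iff[OF assms a slot_in[OF assms w(1)]] by blast
        then show "w \<in> idx I k ` {a+1..k}"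
          using slot_in[OF assms w(1)] idx_slot[OF assms w(1)] by (intro image_eqI[of _ _ "slot I k w"]) auto
      next
        fix w assume "w \<in> idx I k ` {a+1..k}"
        then obtain b where b: "b \<in> {1..k}" "a < b" "w = idx I k b" by auto
        then show "w \<in> {w \<in> I ` {1..k}. idx I k a < w}"
          using idx_in[OF assms b(1)] idx_less_iff[OF assms a b(1)] by simp
      qed
    qed
    then show "(\<Prod>w\<in>{w \<in> I ` {1..k}. idx I k a < w}.
       theta q (h + x (slot I k (idx I k a)) - x (slot I k w)) * theta q (x (slot I k w) - x (slot I k (idx I k a))))
      = (\<Prod>b\<in>{a+1..k}. theta q (h + x a - x b) * theta q (x b - x a))"
      by (rule prod_reindex_cong) (use a in \<open>simp add: slot_idx[OF assms]\<close>)
  qed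
  show ?thesis
    unfolding level_weight_def o_def num den ..
qed

lemma level_sum_eq_weight_sum:
  assumes "inj I"
  shows "level_sum (\<lambda>k x y. level_weight q I h \<mu> k (x \<circ> slot I k) (y \<circ> slot I (k + 1))) t m y
    = weight_sum q I h \<mu> t m (y \<circ> slot I m)"
proof (induction m arbitrary: y)
  case (Suc m)
  then show ?case
    by (simp only: level_sum.simps weight_sum.simps o_assoc flip: Suc_eq_plus1)
qed simp

text \<open>At level \<open>n\<close> every value occurs, so rank and value coincide and the top
  variables are just \<open>z\<close>.\<close>

lemma weight_W_eq_weight_sum:
  assumes I: "I permutes {1..n}" and n: "n \<ge> 1"
  shows "weight_W q n I t z h \<mu> = weight_sum q I h \<mu> t n z"
proof -
  have inj: "inj I" using I permutes_inj by blast
  define L where "L = (\<lambda>k x y. level_weight q I h \<mu> k (x \<circ> slot I k) (y \<circ> slot I (k + 1)))"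
  have U: "weight_U q n I (s(n := z)) h \<mu>
    = (\<Prod>k\<in>{1..n-1}. L k (s k) (if k = n - 1 then z else s (k + 1))) * 1" for s
    unfolding weight_U_def L_def level_weight_idx[OF inj] mult_1_right
    by (rule prod.cong) (use n in auto)
  have "weight_W q n I t z h \<mu> = level_sum L t (Suc (n - 1)) z * 1"
    unfolding weight_W_def U by (rule Sym_upto_prod_levels) (simp add: L_def level_weight_def)
  also have "\<dots> = weight_sum q I h \<mu> t n (z \<circ> slot I n)"
    using n unfolding L_def level_sum_eq_weight_sum[OF inj] by simp
  also have "\<dots> = weight_sum q I h \<mu> t n z"
  proof (rule weight_sum_cong)
    fix v assume "v \<in> I ` {1..n}"
    moreover have "I ` {1..n} = {1..n}"
      using I by (rule permutes_image)
    moreover have "idx I n a = a" if "a \<in> {1..n}" for a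
      using that \<open>I ` {1..n} = {1..n}\<close> by (simp add: idx_def sorted_list_of_set_range atLeastLessThanSuc_atLeastAtMost[symmetric] del: upt_Suc)
    ultimately show "(z \<circ> slot I n) v = z v"
      by (metis o_apply slot_idx[OF inj])
  qed
  finally show ?thesis .
qed

section \<open>Exchange relation in the equivariant parameters\<close>

context nome
begin

abbreviation (input) \<theta> :: "complex \<Rightarrow> complex" where "\<theta> \<equiv> theta q"

text \<open>The three-term identity parametrised by the four arguments of its first product. An
  application then only requires linear arithmetic on the remaining eight arguments.\<close>

lemma theta_three_args:
  assumes "E = (A + B + C + D) / 2" "F = (A + B - C - D) / 2" "G = (A - B + C - D) / 2" "H = (- A + B + C - D) / 2"
    and "K = (A + B + C - D) / 2" "L = (A + B - C + D) / 2" "M = (A - B + C + D) / 2" "N = (A - B - C - D) / 2"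
  shows "\<theta> A * \<theta> B * \<theta> C * \<theta> D + \<theta> E * \<theta> F * \<theta> G * \<theta> H + \<theta> K * \<theta> L * \<theta> M * \<theta> N = 0"
proof -
  let ?x = "(A + B) / 2" and ?a = "(A - B) / 2" and ?b = "(C + D) / 2" and ?c = "(C - D) / 2"
  have "?x + ?a = A" "?x - ?a = B" "?b + ?c = C" "?b - ?c = D" "?x + ?b = E" "?x - ?b = F" "?c + ?a = G"
    "?c - ?a = H" "?x + ?c = K" "?x - ?c = L" "?a + ?b = M" "?a - ?b = N"
    unfolding assms by (simp_all add: field_simps)
  then show ?thesis
    using theta_three_term[of ?x ?a ?b ?c] by (simp only:)
qed

end

text \<open>The polynomial core of \<open>exchange_two_roots\<close>: \<open>I1\<close> to
  \<open>I7\<close> are instances of the three-term identity, and the two conclusions compare the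
  coefficients of \<open>P\<close> and of \<open>hn * Q\<close> there.\<close>

lemma exchange_algebra:
  fixes a b c d dx dy H hx hx' hy hy' hn nh \<nu> nx nx' ny ny' p pp r s u uu v vv w ww :: complex
  assumes nz: "dy \<noteq> 0" "nx' \<noteq> 0" "hx \<noteq> 0"
    and I1: "hy * dx * u * uu + dy * hx' * v * vv = H * s * p * pp"
    and I2: "c * dy * nx' = a * \<nu> * s - b * ny * dx"
    and I3: "d * dy * nx' = a * dx * ny' - b * \<nu> * r"
    and I4: "\<nu> * \<nu> * hx * hx' = nx * nx' * H * H - hn * nh * dx * dx"
    and I5: "ny * ny' * hx * hx' = nx * nx' * hy * hy' - hn * nh * s * r"
    and I6: "H * s * w * ww = hx * dy * u * uu + dx * hy' * v * vv"
    and I7: "dx * hy * w * ww = H * v * vv * r + hx * dy * p * pp"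
  shows "\<nu> * hy * a * u * uu * H * nx - \<nu> * \<nu> * hy * hx' * w * ww * c
     = H * H * ny * nx * b * p * pp + dy * hn * nh * dx * p * pp * c - H * ny * \<nu> * hx' * v * vv * d" (is ?P)
    and "\<nu> * hy * a * u * uu * dx = H * ny * b * p * pp * dx + dy * c * p * pp * H * nx' - dy * a * v * vv * \<nu> * hx'" (is ?Q)
proof -
  have "\<nu> * a * (hy * dx * u * uu + dy * hx' * v * vv) = H * p * pp * (c * dy * nx' + b * ny * dx)"
    unfolding I1 I2 by (simp add: algebra_simps)
  then show ?Q by (simp add: algebra_simps)
  \<comment> \<open>The extra factor \<open>hx\<close> allows \<open>I6\<close> and
    \<open>I7\<close> to eliminate \<open>u * uu\<close> and \<open>p * pp\<close>; after that
    \<open>I4\<close> and \<open>I5\<close> make everything cancel.\<close>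
  have "hx * (hy * H * u * uu * dy * nx * nx' + H * hx' * v * vv * dx * ny * ny'
      - dy * dx * p * pp * s * hn * nh - \<nu> * \<nu> * hy * hx' * w * ww * s)
    = hy * H * nx * nx' * (hx * dy * u * uu) + H * v * vv * dx * (ny * ny' * hx * hx')
      - dx * s * hn * nh * (hx * dy * p * pp) - (\<nu> * \<nu> * hx * hx') * hy * w * ww * s"
    by (simp add: algebra_simps)
  also have "hx * dy * u * uu = H * s * w * ww - dx * hy' * v * vv"
    using I6 by simp
  also have "hx * dy * p * pp = dx * hy * w * ww - H * v * vv * r"
    using I7 by simp
  also have "hy * H * nx * nx' * (H * s * w * ww - dx * hy' * v * vv) + H * v * vv * dx * (ny * ny' * hx * hx')
      - dx * s * hn * nh * (dx * hy * w * ww - H * v * vv * r) - (\<nu> * \<nu> * hx * hx') * hy * w * ww * s = 0"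
    unfolding I4 I5 by (simp add: algebra_simps)
  finally have A: "hy * H * u * uu * dy * nx * nx' + H * hx' * v * vv * dx * ny * ny'
      = dy * dx * p * pp * s * hn * nh + \<nu> * \<nu> * hy * hx' * w * ww * s"
    using nz by (simp add: diff_eq_eq)
  have "\<nu> * \<nu> * hx' * (dx * hy * w * ww - H * v * vv * r) = dy * p * pp * (\<nu> * \<nu> * hx * hx')"
    unfolding I7 by (simp add: algebra_simps)
  then have B: "\<nu> * \<nu> * hx' * (dx * hy * w * ww - H * v * vv * r) = dy * p * pp * (nx * nx' * H * H - hn * nh * dx * dx)"
    unfolding I4 .
  have "dy * nx' * (\<nu> * hy * a * u * uu * H * nx - \<nu> * \<nu> * hy * hx' * w * ww * c
     - (H * H * ny * nx * b * p * pp + dy * hn * nh * dx * p * pp * c - H * ny * \<nu> * hx' * v * vv * d))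
    = \<nu> * hy * a * u * uu * H * nx * dy * nx' - H * H * ny * nx * b * p * pp * dy * nx'
      - \<nu> * \<nu> * hy * hx' * w * ww * (c * dy * nx') - dy * hn * nh * dx * p * pp * (c * dy * nx')
      + H * ny * \<nu> * hx' * v * vv * (d * dy * nx')"
    by (simp add: algebra_simps)
  also have "\<dots> = a * \<nu> * (hy * H * u * uu * dy * nx * nx' + H * hx' * v * vv * dx * ny * ny'
      - dy * dx * p * pp * s * hn * nh - \<nu> * \<nu> * hy * hx' * w * ww * s)
    + b * ny * (\<nu> * \<nu> * hx' * (dx * hy * w * ww - H * v * vv * r) - dy * p * pp * (nx * nx' * H * H - hn * nh * dx * dx))"
    unfolding I2 I3 by (simp add: algebra_simps)
  also have "\<dots> = 0"
    unfolding B A by simp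
  finally show ?P
    using nz by simp
qed

context nome
begin

text \<open>\<open>N\<close> is the part of a level weight in which both labels belong to the pair:
  four numerators and the one increasing pair of denominators. \<open>P\<close>, \<open>Q\<close>
  stand for the sums over lower levels for the two fixed points, \<open>P'\<close>,
  \<open>Q'\<close> for the same sums with the lower roots exchanged. The hypotheses on
  \<open>P'\<close> and \<open>Q'\<close> are the exchange relation one level below, the conclusion
  is that relation for the present level.\<close>

lemma exchange_two_roots:
  fixes x1 x2 y1 y2 h l m1 m2 P P' Q Q' :: complex
  defines "N \<equiv> \<lambda>x1 x2 y1 y2 m1 m2. \<theta> (y1 - x1 + l - m1) * \<theta> (y2 - x1) * \<theta> (h + y1 - x2) * \<theta> (y2 - x2 + l - m2)
      / (\<theta> (h + x1 - x2) * \<theta> (x2 - x1))"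
  assumes nz: "\<theta> (m2 - m1) \<noteq> 0" "\<theta> (y1 - y2) \<noteq> 0" "\<theta> (x1 - x2) \<noteq> 0" "\<theta> (h + x1 - x2) \<noteq> 0"
      "\<theta> (h + x2 - x1) \<noteq> 0" "\<theta> (m2 - m1 + x1 - x2) \<noteq> 0"
    and P': "\<theta> (m2 - m1) * \<theta> (h + (x1 - x2)) * P' = \<theta> h * \<theta> (m2 - m1 - (x1 - x2)) * P + \<theta> (x1 - x2) * \<theta> (h + (m2 - m1)) * Q"
    and Q': "\<theta> (m1 - m2) * \<theta> (h + (x1 - x2)) * Q' = \<theta> h * \<theta> (m1 - m2 - (x1 - x2)) * Q + \<theta> (x1 - x2) * \<theta> (h + (m1 - m2)) * P"
  shows "\<theta> (m2 - m1) * \<theta> (h + (y1 - y2)) * (N x1 x2 y2 y1 m1 m2 * P + N x2 x1 y2 y1 m1 m2 * P')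
    = \<theta> h * \<theta> (m2 - m1 - (y1 - y2)) * (N x1 x2 y1 y2 m1 m2 * P + N x2 x1 y1 y2 m1 m2 * P')
    + \<theta> (y1 - y2) * \<theta> (h + (m2 - m1)) * (N x1 x2 y1 y2 m2 m1 * Q + N x2 x1 y1 y2 m2 m1 * Q')"
proof -
  define dx where "dx = \<theta> (x1 - x2)"
  define dy where "dy = \<theta> (y1 - y2)"
  define \<nu> where "\<nu> = \<theta> (m2 - m1)"
  define H where "H = \<theta> h"
  define hx where "hx = \<theta> (h + (x1 - x2))"
  define hx' where "hx' = \<theta> (h - (x1 - x2))"
  define hy where "hy = \<theta> (h + (y1 - y2))"
  define hy' where "hy' = \<theta> (h - (y1 - y2))"
  define hn where "hn = \<theta> (h + (m2 - m1))"
  define nh where "nh = \<theta> ((m2 - m1) - h)"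
  define nx where "nx = \<theta> ((m2 - m1) - (x1 - x2))"
  define nx' where "nx' = \<theta> ((m2 - m1) + (x1 - x2))"
  define ny where "ny = \<theta> ((m2 - m1) - (y1 - y2))"
  define ny' where "ny' = \<theta> ((m2 - m1) + (y1 - y2))"
  define s where "s = \<theta> ((x1 - x2) + (y1 - y2))"
  define r where "r = \<theta> ((x1 - x2) - (y1 - y2))"
  define p where "p = \<theta> (y2 - x2)"
  define pp where "pp = \<theta> (h + y1 - x1)"
  define u where "u = \<theta> (y1 - x2)"
  define uu where "uu = \<theta> (h + y2 - x1)"
  define v where "v = \<theta> (y2 - x1)"
  define vv where "vv = \<theta> (h + y1 - x2)"
  define w where "w = \<theta> (y1 - x1)"
  define ww where "ww = \<theta> (h + y2 - x2)"
  define a1 where "a1 = \<theta> (y2 - x2 + l - m1)"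
  define a2 where "a2 = \<theta> (y1 - x1 + l - m2)"
  define b1 where "b1 = \<theta> (y1 - x2 + l - m1)"
  define b2 where "b2 = \<theta> (y2 - x1 + l - m2)"
  define c1 where "c1 = \<theta> (y2 - x1 + l - m1)"
  define c2 where "c2 = \<theta> (y1 - x2 + l - m2)"
  define d1 where "d1 = \<theta> (y1 - x1 + l - m1)"
  define d2 where "d2 = \<theta> (y2 - x2 + l - m2)"
  note defs = dx_def dy_def \<nu>_def H_def hx_def hx'_def hy_def hy'_def hn_def nh_def nx_def nx'_def ny_def ny'_def s_def r_def
    p_def pp_def u_def uu_def v_def vv_def w_def ww_def a1_def a2_def b1_def b2_def c1_def c2_def d1_def d2_def
  have "\<theta> (h + (y1 - y2)) * \<theta> (x1 - x2) * \<theta> (y1 - x2) * \<theta> (h + y2 - x1)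
      + \<theta> (h + y1 - x2) * \<theta> (- (y2 - x1)) * \<theta> (y1 - y2) * \<theta> (- (h - (x1 - x2)))
      + \<theta> ((x1 - x2) + (y1 - y2)) * \<theta> h * \<theta> (h + y1 - x1) * \<theta> (- (y2 - x2)) = 0"
    by (rule theta_three_args) (simp_all add: field_simps)
  then have I1: "hy * dx * u * uu + dy * hx' * v * vv = H * s * p * pp"
    unfolding theta_minus defs[symmetric] by algebra
  have "\<theta> (y2 - x2 + l - m1) * \<theta> (y1 - x1 + l - m2) * \<theta> (m2 - m1) * \<theta> ((x1 - x2) + (y1 - y2))
      + \<theta> (y1 - x2 + l - m1) * \<theta> (y2 - x1 + l - m2) * \<theta> ((m2 - m1) - (y1 - y2)) * \<theta> (- (x1 - x2))
      + \<theta> (y2 - x1 + l - m1) * \<theta> (y1 - x2 + l - m2) * \<theta> ((m2 - m1) + (x1 - x2)) * \<theta> (- (y1 - y2)) = 0"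
    by (rule theta_three_args) (simp_all add: field_simps)
  then have I2: "(c1 * c2) * dy * nx' = (a1 * a2) * \<nu> * s - (b1 * b2) * ny * dx"
    unfolding theta_minus defs[symmetric] by algebra
  have "\<theta> (y1 - x1 + l - m1) * \<theta> (y2 - x2 + l - m2) * \<theta> ((m2 - m1) + (x1 - x2)) * \<theta> (y1 - y2)
      + \<theta> (y1 - x2 + l - m1) * \<theta> (y2 - x1 + l - m2) * \<theta> (m2 - m1) * \<theta> ((x1 - x2) - (y1 - y2))
      + \<theta> (y2 - x2 + l - m1) * \<theta> (y1 - x1 + l - m2) * \<theta> ((m2 - m1) + (y1 - y2)) * \<theta> (- (x1 - x2)) = 0"
    by (rule theta_three_args) (simp_all add: field_simps)
  then have I3: "(d1 * d2) * dy * nx' = (a1 * a2) * dx * ny' - (b1 * b2) * \<nu> * r"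
    unfolding theta_minus defs[symmetric] by algebra
  have "\<theta> (m2 - m1) * \<theta> (m2 - m1) * \<theta> (h + (x1 - x2)) * \<theta> (h - (x1 - x2))
      + \<theta> (h + (m2 - m1)) * \<theta> ((m2 - m1) - h) * \<theta> (x1 - x2) * \<theta> (x1 - x2)
      + \<theta> ((m2 - m1) + (x1 - x2)) * \<theta> ((m2 - m1) - (x1 - x2)) * \<theta> h * \<theta> (- h) = 0"
    by (rule theta_three_args) (simp_all add: field_simps)
  then have I4: "\<nu> * \<nu> * hx * hx' = nx * nx' * H * H - hn * nh * dx * dx"
    unfolding theta_minus defs[symmetric] by algebra
  have "\<theta> ((m2 - m1) + (y1 - y2)) * \<theta> ((m2 - m1) - (y1 - y2)) * \<theta> (h + (x1 - x2)) * \<theta> (h - (x1 - x2))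
      + \<theta> (h + (m2 - m1)) * \<theta> ((m2 - m1) - h) * \<theta> ((x1 - x2) + (y1 - y2)) * \<theta> ((x1 - x2) - (y1 - y2))
      + \<theta> ((m2 - m1) + (x1 - x2)) * \<theta> ((m2 - m1) - (x1 - x2)) * \<theta> (h + (y1 - y2)) * \<theta> (- (h - (y1 - y2))) = 0"
    by (rule theta_three_args) (simp_all add: field_simps)
  then have I5: "ny * ny' * hx * hx' = nx * nx' * hy * hy' - hn * nh * s * r"
    unfolding theta_minus defs[symmetric] by algebra
  have "\<theta> h * \<theta> ((x1 - x2) + (y1 - y2)) * \<theta> (y1 - x1) * \<theta> (h + y2 - x2)
      + \<theta> (h + y1 - x2) * \<theta> (- (y2 - x1)) * \<theta> (- (x1 - x2)) * \<theta> (- (h - (y1 - y2)))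
      + \<theta> (y1 - y2) * \<theta> (h + (x1 - x2)) * \<theta> (h + y2 - x1) * \<theta> (- (y1 - x2)) = 0"
    by (rule theta_three_args) (simp_all add: field_simps)
  then have I6: "H * s * w * ww = hx * dy * u * uu + dx * hy' * v * vv"
    unfolding theta_minus defs[symmetric] by algebra
  have "\<theta> (x1 - x2) * \<theta> (h + (y1 - y2)) * \<theta> (y1 - x1) * \<theta> (h + y2 - x2)
      + \<theta> (h + y1 - x2) * \<theta> (- (y2 - x1)) * \<theta> (- h) * \<theta> (- ((x1 - x2) - (y1 - y2)))
      + \<theta> (y1 - y2) * \<theta> (h + (x1 - x2)) * \<theta> (y2 - x2) * \<theta> (- (h + y1 - x1)) = 0"
    by (rule theta_three_args) (simp_all add: field_simps)
  then have I7: "dx * hy * w * ww = H * v * vv * r + hx * dy * p * pp"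
    unfolding theta_minus defs[symmetric] by algebra
  have flip: "\<theta> (x2 - x1) = - dx" "\<theta> (m1 - m2) = - \<nu>" "\<theta> (m1 - m2 - (x1 - x2)) = - nx'" "\<theta> (h + (m1 - m2)) = - nh"
    "\<theta> (h + x1 - x2) = hx" "\<theta> (h + x2 - x1) = hx'"
    unfolding defs theta_minus[symmetric] by (simp_all add: algebra_simps)
  have nz': "\<nu> \<noteq> 0" "dy \<noteq> 0" "dx \<noteq> 0" "hx \<noteq> 0" "hx' \<noteq> 0" "nx' \<noteq> 0"
    using nz unfolding flip defs by (simp_all add: algebra_simps)
  have P'': "\<nu> * hx * P' = H * nx * P + dx * hn * Q"
    using P' unfolding defs[symmetric] .
  have Q'': "\<nu> * hx * Q' = H * nx' * Q + dx * nh * P"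
    using Q' unfolding flip unfolding defs[symmetric] by algebra
  \<comment> \<open>\<open>K\<close> clears the denominators of \<open>N\<close> for both orders of
    the roots and, at the same time, supplies the factor \<open>\<nu> * hx\<close> with which
    \<open>P'\<close> and \<open>Q'\<close> are known.\<close>
  define K where "K = \<nu> * hx * hx' * dx"
  have K: "K \<noteq> 0" using nz' by (simp add: K_def)
  have combine: "K * (- n1 / (hx * dx) * A + n2 / (hx' * dx) * B) = n2 * (\<nu> * hx * B) - n1 * \<nu> * hx' * A" for n1 n2 A B
    using nz' by (simp add: K_def field_simps)
  have N: "N x1 x2 y2 y1 m1 m2 = - (c1 * c2 * w * ww) / (hx * dx)" "N x2 x1 y2 y1 m1 m2 = (a1 * a2 * u * uu) / (hx' * dx)"
    "N x1 x2 y1 y2 m1 m2 = - (d1 * d2 * v * vv) / (hx * dx)" "N x2 x1 y1 y2 m1 m2 = (b1 * b2 * p * pp) / (hx' * dx)"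
    "N x1 x2 y1 y2 m2 m1 = - (a1 * a2 * v * vv) / (hx * dx)" "N x2 x1 y1 y2 m2 m1 = (c1 * c2 * p * pp) / (hx' * dx)"
    unfolding N_def flip unfolding defs[symmetric] by (simp_all add: mult_ac)
  let ?T = "N x1 x2 y2 y1 m1 m2 * P + N x2 x1 y2 y1 m1 m2 * P'"
    and ?T' = "N x1 x2 y1 y2 m1 m2 * P + N x2 x1 y1 y2 m1 m2 * P'"
    and ?T'' = "N x1 x2 y1 y2 m2 m1 * Q + N x2 x1 y1 y2 m2 m1 * Q'"
  have T: "K * ?T
      = a1 * a2 * u * uu * (H * nx * P + dx * hn * Q) - c1 * c2 * w * ww * \<nu> * hx' * P"
    "K * ?T'
      = b1 * b2 * p * pp * (H * nx * P + dx * hn * Q) - d1 * d2 * v * vv * \<nu> * hx' * P"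
    "K * ?T''
      = c1 * c2 * p * pp * (H * nx' * Q + dx * nh * P) - a1 * a2 * v * vv * \<nu> * hx' * Q"
    unfolding N combine P'' Q'' by (rule refl)+
  note ex = exchange_algebra[OF nz'(2,6,4) I1 I2 I3 I4 I5 I6 I7]
  have "K * (\<nu> * hy * ?T
      - (H * ny * ?T'
        + dy * hn * ?T''))
    = \<nu> * hy * (K * ?T)
      - H * ny * (K * ?T')
      - dy * hn * (K * ?T'')"
    by (simp only: right_diff_distrib distrib_left mult_ac diff_diff_eq)
  also have "\<dots> = P * ((\<nu> * hy * (a1 * a2) * u * uu * H * nx - \<nu> * \<nu> * hy * hx' * w * ww * (c1 * c2))
       - (H * H * ny * nx * (b1 * b2) * p * pp + dy * hn * nh * dx * p * pp * (c1 * c2) - H * ny * \<nu> * hx' * v * vv * (d1 * d2)))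
     + hn * Q * (\<nu> * hy * (a1 * a2) * u * uu * dx
       - (H * ny * (b1 * b2) * p * pp * dx + dy * (c1 * c2) * p * pp * H * nx' - dy * (a1 * a2) * v * vv * \<nu> * hx'))"
    unfolding T by (simp add: algebra_simps)
  also have "\<dots> = 0"
    unfolding ex by simp
  finally have "\<nu> * hy * ?T
      - (H * ny * ?T'
        + dy * hn * ?T'') = 0"
    using K by simp
  then show ?thesis
    unfolding defs[symmetric] by simp
qed

text \<open>For the level at which the second label of the pair enters, each relation is one
  instance of the three-term identity. In the first formula the lower level carries the smaller
  label, in the second the larger one.\<close>

lemma exchange_one_root:
  shows "\<theta> l * \<theta> (h + (y1 - y2)) * (\<theta> (h + l + y2 - x) * \<theta> (y1 - x))
      = \<theta> h * \<theta> (l - (y1 - y2)) * (\<theta> (h + l + y1 - x) * \<theta> (y2 - x))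
      + \<theta> (y1 - y2) * \<theta> (h + l) * (\<theta> (h + y1 - x) * \<theta> (l + y2 - x))" (is ?one)
    and "\<theta> l * \<theta> (h + (y1 - y2)) * (\<theta> (h + y2 - x) * \<theta> (l + y1 - x))
      = \<theta> (y1 - y2) * \<theta> (l - h) * (\<theta> (h + l + y1 - x) * \<theta> (y2 - x))
      + \<theta> h * \<theta> (l + (y1 - y2)) * (\<theta> (h + y1 - x) * \<theta> (l + y2 - x))" (is ?two)
proof -
  have "\<theta> l * \<theta> (h + (y1 - y2)) * \<theta> (h + l + y2 - x) * \<theta> (y1 - x)
      + \<theta> (h + l + y1 - x) * \<theta> (- (y2 - x)) * \<theta> (l - (y1 - y2)) * \<theta> h
      + \<theta> (h + l) * \<theta> (y1 - y2) * \<theta> (l + y2 - x) * \<theta> (- (h + y1 - x)) = 0"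
    by (rule theta_three_args) (simp_all add: field_simps)
  then show ?one
    unfolding theta_minus by algebra
  have "\<theta> l * \<theta> (h + (y1 - y2)) * \<theta> (h + y2 - x) * \<theta> (l + y1 - x)
      + \<theta> (h + l + y1 - x) * \<theta> (- (y2 - x)) * \<theta> (- (y1 - y2)) * \<theta> (- (l - h))
      + \<theta> h * \<theta> (l + (y1 - y2)) * \<theta> (l + y2 - x) * \<theta> (- (h + y1 - x)) = 0"
    by (rule theta_three_args) (simp_all add: field_simps)
  then show ?two
    unfolding theta_minus by algebra
qed

end

section \<open>Adjacent transpositions of values and the factors of a level that they
  preserve\<close>

abbreviation adj :: "nat \<Rightarrow> nat \<Rightarrow> nat" where
  "adj m \<equiv> Transposition.transpose m (Suc m)"

lemma adj_less_iff: "\<not> (v \<in> {m, Suc m} \<and> w \<in> {m, Suc m}) \<Longrightarrow> adj m v < adj m w \<longleftrightarrow> v < w"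
  by (auto simp: Transposition.transpose_def)

lemma adj_in_pair_iff: "adj m v \<in> {m, Suc m} \<longleftrightarrow> v \<in> {m, Suc m}"
  by (auto simp: Transposition.transpose_def)

lemma adj_fixed: "v \<notin> {m, Suc m} \<Longrightarrow> adj m v = v"
  by (auto simp: Transposition.transpose_def)

lemma inv_adj_comp:
  assumes "bij I"
  shows "inv (adj m \<circ> I) v = inv I (adj m v)"
  using o_inv_distrib[OF _ assms, of "adj m"] by simp

text \<open>Unless both labels belong to the pair, the transposition does not change their order.
  The indicator \<open>p_ind\<close> matters only for \<open>w = v\<close>, and then
  \<open>v\<close> lies outside the pair.\<close>

lemma psi_val_adj:
  assumes "bij I" "\<not> (v \<in> {m, Suc m} \<and> w \<in> {m, Suc m})"
  shows "psi_val q (adj m \<circ> I) h \<mu> k (adj m v) (adj m w) x = psi_val q I h \<mu> k v w x"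
proof -
  have p: "p_ind (adj m \<circ> I) (k + 1) (adj m v) = p_ind I (k + 1) v" if "v \<notin> {m, Suc m}"
    using adj_less_iff[of "I (k + 1)" m v] that by (simp add: p_ind_def)
  have less: "adj m w < adj m v \<longleftrightarrow> w < v"
    using assms by (intro adj_less_iff) blast
  have eq: "adj m w = adj m v \<longleftrightarrow> w = v"
    by (metis transpose_involutory)
  have i: "inv (adj m \<circ> I) (adj m v) = inv I v"
    by (simp only: inv_adj_comp[OF assms(1)] transpose_involutory)
  show ?thesis
    unfolding psi_val_def less eq i using p assms(2) by (cases "w = v") (simp_all only: if_False if_True simp_thms)
qed

text \<open>If \<open>v\<close> is in the pair then \<open>w\<close> is not, and such a
  \<open>w\<close> compares in the same way with \<open>m\<close> and with
  \<open>Suc m\<close>.\<close>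

lemma psi_val_adj_left:
  assumes "\<not> (v \<in> {m, Suc m} \<and> w \<in> {m, Suc m})"
  shows "psi_val q I h \<mu> k (adj m v) w x = psi_val q I h \<mu> k v w x"
  using assms by (cases "v \<in> {m, Suc m}") (auto simp: psi_val_def)

lemma psi_val_adj_right:
  assumes "\<not> (v \<in> {m, Suc m} \<and> w \<in> {m, Suc m})"
  shows "psi_val q I h \<mu> k v (adj m w) x = psi_val q I h \<mu> k v w x"
  using assms by (cases "w \<in> {m, Suc m}") (auto simp: psi_val_def)

definition level_pairs :: "(nat \<Rightarrow> nat) \<Rightarrow> nat \<Rightarrow> (nat \<times> nat) set" where
  "level_pairs I k = (I ` {1..k}) \<times> (I ` {1..k+1})"

definition increasing_pairs :: "(nat \<Rightarrow> nat) \<Rightarrow> nat \<Rightarrow> (nat \<times> nat) set" where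
  "increasing_pairs I k = {(v, w). v \<in> I ` {1..k} \<and> w \<in> I ` {1..k} \<and> v < w}"

text \<open>The factors of \<open>level_weight\<close> whose pair of labels lies in
  \<open>P\<close>. With \<open>P\<close> the two-by-two block on \<open>m\<close> and
  \<open>Suc m\<close>, the factors off the block are merely permuted by the transposition, so an
  exchange relation is a statement about the block alone.\<close>

definition partial_weight :: "complex \<Rightarrow> (nat \<Rightarrow> nat) \<Rightarrow> complex \<Rightarrow> (nat \<Rightarrow> complex) \<Rightarrow>
    nat \<Rightarrow> (nat \<times> nat) set \<Rightarrow> (nat \<Rightarrow> complex) \<Rightarrow> (nat \<Rightarrow> complex) \<Rightarrow> complex" where
  "partial_weight q I h \<mu> k P X Y =
     (\<Prod>(v, w)\<in>level_pairs I k \<inter> P. psi_val q I h \<mu> k v w (Y w - X v)) /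
     (\<Prod>(v, w)\<in>increasing_pairs I k \<inter> P. theta q (h + X v - X w) * theta q (X w - X v))"

lemma level_weight_split:
  "level_weight q I h \<mu> k X Y = partial_weight q I h \<mu> k P X Y * partial_weight q I h \<mu> k (- P) X Y"
proof -
  have fin: "finite (level_pairs I k)" "finite (increasing_pairs I k)"
    by (auto simp: level_pairs_def increasing_pairs_def
        intro: finite_subset[of _ "(I ` {1..k}) \<times> (I ` {1..k})"])
  have "increasing_pairs I k = Sigma (I ` {1..k}) (\<lambda>v. {w \<in> I ` {1..k}. v < w})"
    by (auto simp: increasing_pairs_def)
  then have "level_weight q I h \<mu> k X Y
    = (\<Prod>(v, w)\<in>level_pairs I k. psi_val q I h \<mu> k v w (Y w - X v)) /
      (\<Prod>(v, w)\<in>increasing_pairs I k. theta q (h + X v - X w) * theta q (X w - X v))"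
    unfolding level_weight_def level_pairs_def by (simp add: prod.Sigma prod.cartesian_product)
  then show ?thesis
    unfolding partial_weight_def prod.Int_Diff[OF fin(1), of _ P] prod.Int_Diff[OF fin(2), of _ P]
    by (simp add: Diff_eq)
qed

lemma prod_pairs_cong:
  assumes "bij_betw f S T" "\<And>v w. (v, w) \<in> S \<Longrightarrow> g (f (v, w)) = h (v, w)"
  shows "prod g T = prod h S"
  using assms by (intro prod_reindex_cong[OF assms(1)]) auto

lemma adj_in_image_comp_iff: "adj m v \<in> (adj m \<circ> I) ` A \<longleftrightarrow> v \<in> I ` A"
  by (metis image_comp inj_image_mem_iff inj_transpose)

lemma pair_in_adj_comp:
  "m \<in> (adj m \<circ> I) ` A \<longleftrightarrow> Suc m \<in> I ` A" "Suc m \<in> (adj m \<circ> I) ` A \<longleftrightarrow> m \<in> I ` A"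
  using adj_in_image_comp_iff[of m "Suc m" I A] adj_in_image_comp_iff[of m m I A]
  by (simp_all only: transpose_apply_first transpose_apply_second)

lemma adj_in_image_iff:
  assumes "m \<in> I ` A" "Suc m \<in> I ` A"
  shows "adj m v \<in> I ` A \<longleftrightarrow> v \<in> I ` A"
  using assms by (cases "v \<in> {m, Suc m}") auto

lemma next_value_notin:
  fixes I :: "nat \<Rightarrow> nat"
  shows "bij I \<Longrightarrow> I (k + 1) \<notin> I ` {1..k}"
  by (simp add: inj_image_mem_iff bij_is_inj)

lemma bij_betw_map_prod_involutions:
  assumes "\<And>v. f (f v) = v" "\<And>v. g (g v) = v"
    and "\<And>v w. (f v, g w) \<in> P \<longleftrightarrow> (v, w) \<in> P"
    and "\<And>v w. (v, w) \<notin> P \<Longrightarrow> (f v, g w) \<in> T \<longleftrightarrow> (v, w) \<in> S"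
  shows "bij_betw (map_prod f g) (S \<inter> - P) (T \<inter> - P)"
proof (rule bij_betwI[where g = "map_prod f g"])
  show "map_prod f g \<in> S \<inter> - P \<rightarrow> T \<inter> - P"
    using assms(3,4) by auto
  have "(f v, g w) \<in> S \<inter> - P" if "(v, w) \<in> T \<inter> - P" for v w
    using that assms(4)[of "f v" "g w"] assms(1,2) assms(3)[of v w] by auto
  then show "map_prod f g \<in> T \<inter> - P \<rightarrow> S \<inter> - P"
    by auto
qed (use assms(1,2) in auto)

context
  fixes m :: nat and s :: "nat \<Rightarrow> nat" and P :: "(nat \<times> nat) set"
  defines "s \<equiv> adj m" and "P \<equiv> {m, Suc m} \<times> {m, Suc m}"
begin

lemma s_s: "s (s v) = v"
  by (simp add: s_def)

lemma s_in_comp: "s v \<in> (s \<circ> I) ` A \<longleftrightarrow> v \<in> I ` A"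
  unfolding s_def by (rule adj_in_image_comp_iff)

lemma s_in: "m \<in> I ` A \<Longrightarrow> Suc m \<in> I ` A \<Longrightarrow> s v \<in> I ` A \<longleftrightarrow> v \<in> I ` A"
  unfolding s_def by (rule adj_in_image_iff)

lemma s_less: "(v, w) \<notin> P \<Longrightarrow> s v < s w \<longleftrightarrow> v < w"
  unfolding s_def P_def by (rule adj_less_iff) blast

lemma in_P: "(s v, w) \<in> P \<longleftrightarrow> (v, w) \<in> P" "(v, s w) \<in> P \<longleftrightarrow> (v, w) \<in> P"
  unfolding P_def s_def mem_Times_iff fst_conv snd_conv adj_in_pair_iff by (rule refl)+

lemma partial_weight_adj:
  assumes "bij I"
  shows "partial_weight q (s \<circ> I) h \<mu> k (- P) (X \<circ> s) (Y \<circ> s) = partial_weight q I h \<mu> k (- P) X Y"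
proof -
  have num: "bij_betw (map_prod s s) (level_pairs I k \<inter> - P) (level_pairs (s \<circ> I) k \<inter> - P)"
    by (rule bij_betw_map_prod_involutions[OF s_s s_s])
      (simp_all only: in_P level_pairs_def mem_Times_iff fst_conv snd_conv s_in_comp)
  have den: "bij_betw (map_prod s s) (increasing_pairs I k \<inter> - P) (increasing_pairs (s \<circ> I) k \<inter> - P)"
  proof (rule bij_betw_map_prod_involutions[OF s_s s_s])
    show "(s v, s w) \<in> increasing_pairs (s \<circ> I) k \<longleftrightarrow> (v, w) \<in> increasing_pairs I k" if "(v, w) \<notin> P" for v w
      by (simp only: increasing_pairs_def mem_Collect_eq prod.case s_in_comp s_less[OF that])
  qed (simp only: in_P)
  show ?thesis
    unfolding partial_weight_def
  proof (intro arg_cong2[where f = "(/)"] prod_pairs_cong[OF num] prod_pairs_cong[OF den])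
    fix v w assume "(v, w) \<in> level_pairs I k \<inter> - P"
    then have "\<not> (v \<in> {m, Suc m} \<and> w \<in> {m, Suc m})"
      by (auto simp: P_def)
    from psi_val_adj[OF assms this]
    show "(case map_prod s s (v, w) of (v, w) \<Rightarrow> psi_val q (s \<circ> I) h \<mu> k v w ((Y \<circ> s) w - (X \<circ> s) v))
       = (case (v, w) of (v, w) \<Rightarrow> psi_val q I h \<mu> k v w (Y w - X v))"
      by (simp only: map_prod_simp prod.case o_apply s_s) (simp only: s_def)
  qed (simp only: map_prod_simp prod.case o_apply s_s)
qed

text \<open>When both labels occur, exchanging the two lower roots permutes the factors off the
  block: the numerators through their first label, the denominators through both.\<close>

lemma partial_weight_adj_left:
  assumes E: "m \<in> I ` {1..k}" "Suc m \<in> I ` {1..k}"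
  shows "partial_weight q I h \<mu> k (- P) (X \<circ> s) Y = partial_weight q I h \<mu> k (- P) X Y"
proof -
  have num: "bij_betw (map_prod s id) (level_pairs I k \<inter> - P) (level_pairs I k \<inter> - P)"
    by (rule bij_betw_map_prod_involutions[OF s_s])
      (simp_all only: in_P id_apply level_pairs_def mem_Times_iff fst_conv snd_conv s_in[OF E])
  have den: "bij_betw (map_prod s s) (increasing_pairs I k \<inter> - P) (increasing_pairs I k \<inter> - P)"
  proof (rule bij_betw_map_prod_involutions[OF s_s s_s])
    show "(s v, s w) \<in> increasing_pairs I k \<longleftrightarrow> (v, w) \<in> increasing_pairs I k" if "(v, w) \<notin> P" for v w
      by (simp only: increasing_pairs_def mem_Collect_eq prod.case s_in[OF E] s_less[OF that])
  qed (simp only: in_P)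
  have "(\<Prod>(v, w)\<in>increasing_pairs I k \<inter> - P. theta q (h + (X \<circ> s) v - (X \<circ> s) w) * theta q ((X \<circ> s) w - (X \<circ> s) v))
     = (\<Prod>(v, w)\<in>increasing_pairs I k \<inter> - P. theta q (h + X v - X w) * theta q (X w - X v))"
    by (rule prod_pairs_cong[OF den]) (simp only: map_prod_simp prod.case o_apply s_s)
  moreover have "(\<Prod>(v, w)\<in>level_pairs I k \<inter> - P. psi_val q I h \<mu> k v w (Y w - (X \<circ> s) v))
     = (\<Prod>(v, w)\<in>level_pairs I k \<inter> - P. psi_val q I h \<mu> k v w (Y w - X v))"
  proof (rule prod_pairs_cong[OF num])
    fix v w assume "(v, w) \<in> level_pairs I k \<inter> - P"
    then have "\<not> (v \<in> {m, Suc m} \<and> w \<in> {m, Suc m})"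
      by (auto simp: P_def)
    from psi_val_adj_left[OF this]
    show "(case map_prod s id (v, w) of (v, w) \<Rightarrow> psi_val q I h \<mu> k v w (Y w - (X \<circ> s) v))
       = (case (v, w) of (v, w) \<Rightarrow> psi_val q I h \<mu> k v w (Y w - X v))"
      by (simp only: map_prod_simp prod.case o_apply s_s id_apply) (simp only: s_def)
  qed
  ultimately show ?thesis
    unfolding partial_weight_def by (simp only:)
qed

lemma partial_weight_adj_right:
  assumes E: "m \<in> I ` {1..k+1}" "Suc m \<in> I ` {1..k+1}"
  shows "partial_weight q I h \<mu> k (- P) X (Y \<circ> s) = partial_weight q I h \<mu> k (- P) X Y"
proof -
  have num: "bij_betw (map_prod id s) (level_pairs I k \<inter> - P) (level_pairs I k \<inter> - P)"
    by (rule bij_betw_map_prod_involutions[OF _ s_s])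
      (simp_all only: in_P id_apply level_pairs_def mem_Times_iff fst_conv snd_conv s_in[OF E])
  have "(\<Prod>(v, w)\<in>level_pairs I k \<inter> - P. psi_val q I h \<mu> k v w ((Y \<circ> s) w - X v))
     = (\<Prod>(v, w)\<in>level_pairs I k \<inter> - P. psi_val q I h \<mu> k v w (Y w - X v))"
  proof (rule prod_pairs_cong[OF num])
    fix v w assume "(v, w) \<in> level_pairs I k \<inter> - P"
    then have "\<not> (v \<in> {m, Suc m} \<and> w \<in> {m, Suc m})"
      by (auto simp: P_def)
    from psi_val_adj_right[OF this]
    show "(case map_prod id s (v, w) of (v, w) \<Rightarrow> psi_val q I h \<mu> k v w ((Y \<circ> s) w - X v))
       = (case (v, w) of (v, w) \<Rightarrow> psi_val q I h \<mu> k v w (Y w - X v))"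
      by (simp only: map_prod_simp prod.case o_apply s_s id_apply) (simp only: s_def)
  qed
  then show ?thesis
    unfolding partial_weight_def by (simp only:)
qed

text \<open>On a set that does not contain both \<open>m\<close> and \<open>Suc m\<close> the
  transposition is increasing, so it preserves ranks.\<close>

lemma slot_adj:
  assumes I: "inj I" and not_both: "\<not> (m \<in> I ` {1..k} \<and> Suc m \<in> I ` {1..k})" and v: "v \<in> I ` {1..k}"
  shows "slot (s \<circ> I) k (s v) = slot I k v"
proof -
  let ?xs = "sorted_list_of_set (I ` {1..k})"
  have inj: "inj (s \<circ> I)"
    using I unfolding s_def by (intro inj_compose) simp_all
  have mono: "s x < s y" if "x \<in> I ` {1..k}" "y \<in> I ` {1..k}" "x < y" for x y
  proof -
    have "\<not> (x = m \<and> y = Suc m)"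
      using that not_both by blast
    then have "(x, y) \<notin> P"
      using \<open>x < y\<close> by (auto simp: P_def)
    then show ?thesis using s_less that by blast
  qed
  have "sorted_wrt (\<lambda>x y. s x < s y) ?xs"
    by (rule sorted_wrt_mono_rel[of _ "(<)"]) (use mono in auto)
  then have sorted: "sorted_wrt (<) (map s ?xs)"
    by (simp add: sorted_wrt_map)
  then have "sorted_list_of_set (set (map s ?xs)) = map s ?xs"
    using strict_sorted_iff sorted_list_of_set.idem_if_sorted_distinct by blast
  then have "sorted_list_of_set ((s \<circ> I) ` {1..k}) = map s ?xs"
    by (simp add: image_comp)
  moreover have "length ?xs = k"
    using I by (simp add: card_image inj_on_subset)
  ultimately have idx: "idx (s \<circ> I) k a = s (idx I k a)" if "a \<in> {1..k}" for a
    using that by (auto simp: idx_def)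
  have "idx (s \<circ> I) k (slot I k v) = s v"
    using idx[OF slot_in[OF I v]] idx_slot[OF I v] by simp
  then show ?thesis
    using slot_idx[OF inj slot_in[OF I v]] by simp
qed

text \<open>With at most one of the two labels on level \<open>k + 1\<close>, the block can only
  contain a diagonal pair. If it does, \<open>I (k + 1)\<close> is outside the pair of values, so
  the indicator in that diagonal factor does not change either.\<close>

lemma level_weight_adj:
  assumes I: "bij I" and not_both: "\<not> (m \<in> I ` {1..k+1} \<and> Suc m \<in> I ` {1..k+1})"
  shows "level_weight q (s \<circ> I) h \<mu> k (X \<circ> s) (Y \<circ> s) = level_weight q I h \<mu> k X Y"
proof -
  have no_increasing: "increasing_pairs J k \<inter> P = {}" if "\<not> (m \<in> J ` {1..k} \<and> Suc m \<in> J ` {1..k})" for J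
  proof -
    have False if "v \<in> J ` {1..k}" "w \<in> J ` {1..k}" "v < w" "v \<in> {m, Suc m}" "w \<in> {m, Suc m}" for v w
    proof -
      from that have "v = m" "w = Suc m" by auto
      with that \<open>\<not> (m \<in> J ` {1..k} \<and> Suc m \<in> J ` {1..k})\<close> show False by blast
    qed
    then show ?thesis
      unfolding increasing_pairs_def P_def by blast
  qed
  have sub: "I ` {1..k} \<subseteq> I ` {1..k+1}" by auto
  have not_both_k: "\<not> (m \<in> I ` {1..k} \<and> Suc m \<in> I ` {1..k})"
    using not_both sub by blast
  then have "\<not> (m \<in> (s \<circ> I) ` {1..k} \<and> Suc m \<in> (s \<circ> I) ` {1..k})"
    unfolding s_def pair_in_adj_comp by blast
  note none = no_increasing[OF not_both_k] no_increasing[OF this]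
  have bij: "bij_betw (map_prod s s) (level_pairs I k \<inter> - (- P)) (level_pairs (s \<circ> I) k \<inter> - (- P))"
    by (rule bij_betw_map_prod_involutions[OF s_s s_s])
      (simp_all only: Compl_iff in_P level_pairs_def mem_Times_iff fst_conv snd_conv s_in_comp)
  have "partial_weight q (s \<circ> I) h \<mu> k P (X \<circ> s) (Y \<circ> s) = partial_weight q I h \<mu> k P X Y"
    unfolding partial_weight_def none prod.empty div_by_1
  proof (rule prod_pairs_cong[OF bij[unfolded double_complement]])
    fix v w assume "(v, w) \<in> level_pairs I k \<inter> P"
    then have v: "v \<in> I ` {1..k}" "v \<in> {m, Suc m}" and w: "w \<in> I ` {1..k+1}" "w \<in> {m, Suc m}"
      unfolding level_pairs_def P_def by blast+
    have uniq: "x = y" if "x \<in> I ` {1..k+1}" "y \<in> I ` {1..k+1}" "x \<in> {m, Suc m}" "y \<in> {m, Suc m}" for x y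
      using that(3,4) that(1,2) not_both by (elim insertE emptyE) simp_all
    have v': "v \<in> I ` {1..k+1}"
      using v(1) sub by (rule rev_subsetD)
    have "w = v"
      by (rule uniq[OF w(1) v' w(2) v(2)])
    have "I (k + 1) \<noteq> v"
      using v(1) next_value_notin[OF I, of k] by metis
    moreover have "I (k + 1) \<in> I ` {1..k+1}" by auto
    ultimately have "I (k + 1) \<notin> {m, Suc m}"
      using uniq[OF _ v' _ v(2)] by blast
    then have "adj m (I (k + 1)) < adj m v \<longleftrightarrow> I (k + 1) < v"
      by (intro adj_less_iff) blast
    then have "p_ind (s \<circ> I) (k + 1) (s v) = p_ind I (k + 1) v"
      by (simp only: p_ind_def s_def o_apply)
    moreover have "inv (s \<circ> I) (s v) = inv I v"
      unfolding s_def inv_adj_comp[OF I] by (simp only: transpose_involutory)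
    ultimately show "(case map_prod s s (v, w) of (v, w) \<Rightarrow> psi_val q (s \<circ> I) h \<mu> k v w ((Y \<circ> s) w - (X \<circ> s) v))
       = (case (v, w) of (v, w) \<Rightarrow> psi_val q I h \<mu> k v w (Y w - X v))"
      by (simp only: map_prod_simp prod.case o_apply s_s psi_val_def \<open>w = v\<close> less_irrefl if_False simp_thms if_True)
  qed
  then show ?thesis
    unfolding level_weight_split[of _ _ _ _ _ _ _ P] partial_weight_adj[OF I] by (simp only:)
qed

text \<open>As long as both labels have not yet appeared, passing from \<open>I\<close> to
  \<open>s \<circ> I\<close> only renames labels: slots, and therefore the roots assigned to them,
  stay the same.\<close>

lemma weight_sum_adj:
  assumes I: "bij I" and not_both: "\<not> (m \<in> I ` {1..k} \<and> Suc m \<in> I ` {1..k})"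
  shows "weight_sum q (s \<circ> I) h \<mu> t k (Y \<circ> s) = weight_sum q I h \<mu> t k Y"
  using not_both
proof (induction k arbitrary: Y)
  case (Suc k)
  have inj: "inj I" using I by (rule bij_is_inj)
  have nb: "\<not> (m \<in> I ` {1..k} \<and> Suc m \<in> I ` {1..k})"
    using Suc.prems by auto
  have eq: "(t k \<circ> \<sigma> \<circ> slot (s \<circ> I) k) v = (t k \<circ> \<sigma> \<circ> slot I k \<circ> s) v" if "v \<in> (s \<circ> I) ` {1..k}" for \<sigma> v
  proof -
    obtain u where u: "u \<in> I ` {1..k}" "v = s u"
      using \<open>v \<in> (s \<circ> I) ` {1..k}\<close> by (metis imageE image_comp)
    then show ?thesis
      by (simp only: o_apply slot_adj[OF inj nb u(1)] s_s)
  qed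
  have "level_weight q (s \<circ> I) h \<mu> k (t k \<circ> \<sigma> \<circ> slot (s \<circ> I) k) (Y \<circ> s)
      = level_weight q I h \<mu> k (t k \<circ> \<sigma> \<circ> slot I k) Y" for \<sigma>
    by (rule trans[OF level_weight_cong[OF eq refl] level_weight_adj[OF I]]) (use Suc.prems in simp_all)
  moreover have "weight_sum q (s \<circ> I) h \<mu> t k (t k \<circ> \<sigma> \<circ> slot (s \<circ> I) k)
      = weight_sum q I h \<mu> t k (t k \<circ> \<sigma> \<circ> slot I k)" for \<sigma>
    by (rule trans[OF weight_sum_cong[OF eq] Suc.IH[OF nb]])
  ultimately show ?case
    by (simp only: weight_sum.simps)
qed simp

end

section \<open>The exchange relation for a single level and for the whole sum\<close>

context nome
begin

lemma inv_eq_iff: "bij I \<Longrightarrow> inv I v = k \<longleftrightarrow> I k = v"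
  by (auto simp: bij_is_inj bij_is_surj surj_f_inv_f)

text \<open>The hypotheses say that \<open>I (k + 1)\<close> is the second label of the pair to
  appear. The two cases, according to which label it is, correspond to the two formulas of
  \<open>exchange_one_root\<close>.\<close>

lemma one_root_exchange:
  fixes I :: "nat \<Rightarrow> nat" and X Y \<mu> :: "nat \<Rightarrow> complex" and m :: nat
  defines "\<nu> \<equiv> \<mu> (inv I (Suc m)) - \<mu> (inv I m)" and "d \<equiv> Y m - Y (Suc m)"
  assumes I: "bij I"
    and both: "m \<in> I ` {1..k+1}" "Suc m \<in> I ` {1..k+1}"
    and one: "\<not> (m \<in> I ` {1..k} \<and> Suc m \<in> I ` {1..k})"
  shows "\<theta> \<nu> * \<theta> (h + d) * level_weight q I h \<mu> k X (Y \<circ> adj m)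
    = \<theta> h * \<theta> (\<nu> - d) * level_weight q I h \<mu> k X Y
    + \<theta> d * \<theta> (h + \<nu>) * level_weight q (adj m \<circ> I) h \<mu> k (X \<circ> adj m) Y"
proof -
  let ?s = "adj m" and ?P = "{m, Suc m} \<times> {m, Suc m}"
  let ?C = "partial_weight q I h \<mu> k ?P" and ?C' = "partial_weight q (?s \<circ> I) h \<mu> k ?P"
  have "Y \<circ> adj m \<circ> adj m = Y"
    by (simp add: fun_eq_iff)
  then have rest: "partial_weight q I h \<mu> k (- ?P) X (Y \<circ> adj m) = partial_weight q I h \<mu> k (- ?P) X Y"
    "partial_weight q (?s \<circ> I) h \<mu> k (- ?P) (X \<circ> ?s) Y = partial_weight q I h \<mu> k (- ?P) X Y"
    using partial_weight_adj[OF I, of q m h \<mu> k X "Y \<circ> adj m"] partial_weight_adj_right[OF both, of q h \<mu> X Y] by simp_all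
  have ins: "I ` {1..k+1} = insert (I (k + 1)) (I ` {1..k})"
    by (auto simp: atLeastAtMostSuc_conv)
  \<comment> \<open>With a single label \<open>e\<close> of the pair on the lower level, the block
    consists of two numerators and has no denominator.\<close>
  have core: "partial_weight q J h \<mu> k ?P X Y
      = psi_val q J h \<mu> k e m (Y m - X e) * psi_val q J h \<mu> k e (Suc m) (Y (Suc m) - X e)"
    if "J ` {1..k} \<inter> {m, Suc m} = {e}" "m \<in> J ` {1..k+1}" "Suc m \<in> J ` {1..k+1}" for J X Y e
  proof -
    have "level_pairs J k \<inter> ?P = {(e, m), (e, Suc m)}"
      using that unfolding level_pairs_def by blast
    moreover have "increasing_pairs J k \<inter> ?P = {}"
    proof (rule equals0I)
      fix x assume "x \<in> increasing_pairs J k \<inter> ?P"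
      then obtain v w where "v \<in> J ` {1..k} \<inter> {m, Suc m}" "w \<in> J ` {1..k} \<inter> {m, Suc m}" "v < w"
        unfolding increasing_pairs_def by blast
      then show False
        unfolding that(1) by simp
    qed
    ultimately show ?thesis
      unfolding partial_weight_def by simp
  qed
  have both_s: "m \<in> (?s \<circ> I) ` {1..k+1}" "Suc m \<in> (?s \<circ> I) ` {1..k+1}"
    using both unfolding pair_in_adj_comp by blast+
  consider "I (k + 1) = Suc m" "m \<in> I ` {1..k}" "Suc m \<notin> I ` {1..k}"
    | "I (k + 1) = m" "m \<notin> I ` {1..k}" "Suc m \<in> I ` {1..k}"
  proof (cases "m \<in> I ` {1..k}")
    case True
    with one both(2) have "Suc m \<notin> I ` {1..k}" "I (k + 1) = Suc m"
      unfolding ins by simp_all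
    with True show ?thesis
      by (intro that(1))
  next
    case False
    with both(1) have "I (k + 1) = m"
      unfolding ins by simp
    moreover from this both(2) have "Suc m \<in> I ` {1..k}"
      unfolding ins by simp
    ultimately show ?thesis
      using False by (intro that(2))
  qed
  then have "\<theta> \<nu> * \<theta> (h + d) * ?C X (Y \<circ> ?s)
    = \<theta> h * \<theta> (\<nu> - d) * ?C X Y
    + \<theta> d * \<theta> (h + \<nu>) * ?C' (X \<circ> ?s) Y"
  proof cases
    case 1
    have "I ` {1..k} \<inter> {m, Suc m} = {m}" "(?s \<circ> I) ` {1..k} \<inter> {m, Suc m} = {Suc m}"
      unfolding Int_insert_right pair_in_adj_comp using 1(2,3) by (simp_all only: if_True if_False Int_empty_right)
    note cores = core[OF this(1) both] core[OF this(2) both_s]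
    have "inv I (Suc m) = k + 1"
      using 1(1) inv_eq_iff[OF I] by blast
    then have nu: "\<nu> = \<mu> (k + 1) - \<mu> (inv I m)"
      by (simp only: \<nu>_def)
    have "\<theta> \<nu> * \<theta> (h + d) * (\<theta> (h + \<nu> + Y (Suc m) - X m) * \<theta> (Y m - X m))
      = \<theta> h * \<theta> (\<nu> - d) * (\<theta> (h + \<nu> + Y m - X m) * \<theta> (Y (Suc m) - X m))
      + \<theta> d * \<theta> (h + \<nu>) * (\<theta> (h + Y m - X m) * \<theta> (\<nu> + Y (Suc m) - X m))"
      unfolding d_def by (rule exchange_one_root(1))
    moreover have "psi_val q I h \<mu> k m m x = \<theta> (h + \<nu> + x)" "psi_val q I h \<mu> k m (Suc m) x = \<theta> x"
      "psi_val q (?s \<circ> I) h \<mu> k (Suc m) m x = \<theta> (h + x)" "psi_val q (?s \<circ> I) h \<mu> k (Suc m) (Suc m) x = \<theta> (\<nu> + x)" for x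
      using 1(1) by (simp_all add: psi_val_def p_ind_def nu inv_adj_comp[OF I] algebra_simps)
    ultimately show ?thesis
      by (simp only: cores o_apply transpose_apply_first transpose_apply_second add_diff_eq)
  next
    case 2
    have "I ` {1..k} \<inter> {m, Suc m} = {Suc m}" "(?s \<circ> I) ` {1..k} \<inter> {m, Suc m} = {m}"
      unfolding Int_insert_right pair_in_adj_comp using 2(2,3) by (simp_all only: if_True if_False Int_empty_right)
    note cores = core[OF this(1) both] core[OF this(2) both_s]
    have "inv I m = k + 1"
      using 2(1) inv_eq_iff[OF I] by blast
    then have nu: "\<nu> = \<mu> (inv I (Suc m)) - \<mu> (k + 1)"
      by (simp only: \<nu>_def)
    \<comment> \<open>Here \<open>\<mu> (k + 1)\<close> belongs to the label \<open>m\<close>, so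
      the shift \<open>l\<close> of \<open>exchange_one_root\<close> is the negative of \<nu>;
      oddness of \<open>theta\<close> then restores the required form.\<close>
    have "\<theta> (- \<nu>) * \<theta> (h + d) * (\<theta> (h + Y (Suc m) - X (Suc m)) * \<theta> (- \<nu> + Y m - X (Suc m)))
      = \<theta> d * \<theta> (- \<nu> - h) * (\<theta> (h + - \<nu> + Y m - X (Suc m)) * \<theta> (Y (Suc m) - X (Suc m)))
      + \<theta> h * \<theta> (- \<nu> + d) * (\<theta> (h + Y m - X (Suc m)) * \<theta> (- \<nu> + Y (Suc m) - X (Suc m)))"
      unfolding d_def by (rule exchange_one_root(2))
    moreover have "\<theta> (- \<nu>) = - \<theta> \<nu>" "\<theta> (- \<nu> - h) = - \<theta> (h + \<nu>)" "\<theta> (- \<nu> + d) = - \<theta> (\<nu> - d)"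
      unfolding theta_minus[symmetric] by (simp_all add: algebra_simps)
    ultimately have "\<theta> \<nu> * \<theta> (h + d) * (\<theta> (h + Y (Suc m) - X (Suc m)) * \<theta> (- \<nu> + Y m - X (Suc m)))
      = \<theta> h * \<theta> (\<nu> - d) * (\<theta> (h + Y m - X (Suc m)) * \<theta> (- \<nu> + Y (Suc m) - X (Suc m)))
      + \<theta> d * \<theta> (h + \<nu>) * (\<theta> (h + - \<nu> + Y m - X (Suc m)) * \<theta> (Y (Suc m) - X (Suc m)))"
      by algebra
    moreover have "psi_val q I h \<mu> k (Suc m) m x = \<theta> (h + x)" "psi_val q I h \<mu> k (Suc m) (Suc m) x = \<theta> (- \<nu> + x)"
      "psi_val q (?s \<circ> I) h \<mu> k m m x = \<theta> (h + - \<nu> + x)" "psi_val q (?s \<circ> I) h \<mu> k m (Suc m) x = \<theta> x" for x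
      using 2(1) by (simp_all add: psi_val_def p_ind_def nu inv_adj_comp[OF I] algebra_simps)
    ultimately show ?thesis
      by (simp only: cores o_apply transpose_apply_first transpose_apply_second add_diff_eq)
  qed
  from arg_cong[OF this, of "\<lambda>z. z * partial_weight q I h \<mu> k (- ?P) X Y"] show ?thesis
    unfolding level_weight_split[of _ _ _ _ _ _ _ ?P] rest by (simp only: distrib_right mult.assoc)
qed

text \<open>All six level weights share the same off-block factor \<open>R\<close>, so the claim is
  \<open>exchange_two_roots\<close> for the blocks, multiplied by \<open>R\<close>.\<close>

lemma two_root_exchange:
  fixes I :: "nat \<Rightarrow> nat" and X Y \<mu> :: "nat \<Rightarrow> complex" and m :: nat
  defines "\<nu> \<equiv> \<mu> (inv I (Suc m)) - \<mu> (inv I m)" and "d \<equiv> Y m - Y (Suc m)" and "e \<equiv> X m - X (Suc m)"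
  assumes I: "bij I"
    and both: "m \<in> I ` {1..k}" "Suc m \<in> I ` {1..k}"
    and nz: "\<theta> \<nu> \<noteq> 0" "\<theta> d \<noteq> 0" "\<theta> e \<noteq> 0" "\<theta> (h + e) \<noteq> 0" "\<theta> (h - e) \<noteq> 0" "\<theta> (\<nu> + e) \<noteq> 0"
    and P': "\<theta> \<nu> * \<theta> (h + e) * P' = \<theta> h * \<theta> (\<nu> - e) * P + \<theta> e * \<theta> (h + \<nu>) * Q"
    and Q': "\<theta> (- \<nu>) * \<theta> (h + e) * Q' = \<theta> h * \<theta> (- \<nu> - e) * Q + \<theta> e * \<theta> (h + - \<nu>) * P"
  shows "\<theta> \<nu> * \<theta> (h + d) * (level_weight q I h \<mu> k X (Y \<circ> adj m) * P + level_weight q I h \<mu> k (X \<circ> adj m) (Y \<circ> adj m) * P')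
    = \<theta> h * \<theta> (\<nu> - d) * (level_weight q I h \<mu> k X Y * P + level_weight q I h \<mu> k (X \<circ> adj m) Y * P')
    + \<theta> d * \<theta> (h + \<nu>) * (level_weight q (adj m \<circ> I) h \<mu> k X Y * Q + level_weight q (adj m \<circ> I) h \<mu> k (X \<circ> adj m) Y * Q')"
proof -
  let ?s = "adj m" and ?P = "{m, Suc m} \<times> {m, Suc m}"
  let ?C = "partial_weight q I h \<mu> k ?P" and ?C' = "partial_weight q (?s \<circ> I) h \<mu> k ?P"
  have ss: "Z \<circ> adj m \<circ> adj m = Z" for Z :: "nat \<Rightarrow> complex"
    by (simp add: fun_eq_iff)
  have both': "m \<in> I ` {1..k+1}" "Suc m \<in> I ` {1..k+1}"
    using both by auto
  have both_s: "m \<in> (?s \<circ> I) ` {1..k}" "Suc m \<in> (?s \<circ> I) ` {1..k}"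
    using both unfolding pair_in_adj_comp by blast+
  define R where "R = partial_weight q I h \<mu> k (- ?P) X Y"
  note left = partial_weight_adj_left[OF both] and right = partial_weight_adj_right[OF both']
  have rest: "partial_weight q I h \<mu> k (- ?P) X Y = R" "partial_weight q I h \<mu> k (- ?P) X (Y \<circ> ?s) = R"
    "partial_weight q I h \<mu> k (- ?P) (X \<circ> ?s) Y = R" "partial_weight q I h \<mu> k (- ?P) (X \<circ> ?s) (Y \<circ> ?s) = R"
    unfolding left right R_def by (rule refl)+
  have rest_s: "partial_weight q (?s \<circ> I) h \<mu> k (- ?P) X Y = R" "partial_weight q (?s \<circ> I) h \<mu> k (- ?P) (X \<circ> ?s) Y = R"
    using partial_weight_adj[OF I, of q m h \<mu> k "X \<circ> ?s" "Y \<circ> ?s"] partial_weight_adj[OF I, of q m h \<mu> k X "Y \<circ> ?s"]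
    unfolding ss left right R_def by simp_all
  \<comment> \<open>The part of the diagonal arguments that is common to both labels and to both
    \<open>I\<close> and \<open>adj m \<circ> I\<close>. It is common because
    \<open>I (k + 1)\<close> lies outside the pair and thus compares equally with \<open>m\<close>
    and \<open>Suc m\<close>.\<close>
  define l where "l = (1 - p_ind I (k + 1) m) * h + \<mu> (k + 1)"
  have "I (k + 1) \<noteq> m" "I (k + 1) \<noteq> Suc m"
    using both next_value_notin[OF I, of k] by metis+
  then have p: "p_ind I (k + 1) (Suc m) = p_ind I (k + 1) m" "p_ind (?s \<circ> I) (k + 1) v = p_ind I (k + 1) v" for v
    by (auto simp: p_ind_def)
  define N where "N x1 x2 y1 y2 m1 m2 = \<theta> (y1 - x1 + l - m1) * \<theta> (y2 - x1) * \<theta> (h + y1 - x2) * \<theta> (y2 - x2 + l - m2)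
      / (\<theta> (h + x1 - x2) * \<theta> (x2 - x1))" for x1 x2 y1 y2 m1 m2
  have core: "partial_weight q J h \<mu> k ?P X Y = N (X m) (X (Suc m)) (Y m) (Y (Suc m)) (\<mu> (inv J m)) (\<mu> (inv J (Suc m)))"
    if "m \<in> J ` {1..k}" "Suc m \<in> J ` {1..k}" "p_ind J (k + 1) m = p_ind I (k + 1) m" "p_ind J (k + 1) (Suc m) = p_ind I (k + 1) m" for J X Y
  proof -
    have "m \<in> J ` {1..k+1}" "Suc m \<in> J ` {1..k+1}"
      using that by auto
    then have "level_pairs J k \<inter> ?P = {(m, m), (m, Suc m), (Suc m, m), (Suc m, Suc m)}"
      using that unfolding level_pairs_def by blast
    moreover have "increasing_pairs J k \<inter> ?P = {(m, Suc m)}"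
      using that unfolding increasing_pairs_def by auto
    ultimately show ?thesis
      unfolding partial_weight_def using that
      by (simp add: psi_val_def N_def l_def algebra_simps)
  qed
  have cores: "?C X Y = N (X m) (X (Suc m)) (Y m) (Y (Suc m)) (\<mu> (inv I m)) (\<mu> (inv I (Suc m)))"
    "?C' X Y = N (X m) (X (Suc m)) (Y m) (Y (Suc m)) (\<mu> (inv I (Suc m))) (\<mu> (inv I m))" for X Y
    using core[OF both refl p(1)] core[OF both_s p(2)] p by (simp_all add: inv_adj_comp[OF I])
  have "\<theta> \<nu> * \<theta> (h + d) * (?C X (Y \<circ> ?s) * P + ?C (X \<circ> ?s) (Y \<circ> ?s) * P')
    = \<theta> h * \<theta> (\<nu> - d) * (?C X Y * P + ?C (X \<circ> ?s) Y * P')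
    + \<theta> d * \<theta> (h + \<nu>) * (?C' X Y * Q + ?C' (X \<circ> ?s) Y * Q')"
    unfolding cores o_apply transpose_apply_first transpose_apply_second unfolding N_def \<nu>_def d_def
  proof (rule exchange_two_roots)
    show "\<theta> (\<mu> (inv I (Suc m)) - \<mu> (inv I m)) * \<theta> (h + (X m - X (Suc m))) * P'
      = \<theta> h * \<theta> (\<mu> (inv I (Suc m)) - \<mu> (inv I m) - (X m - X (Suc m))) * P
      + \<theta> (X m - X (Suc m)) * \<theta> (h + (\<mu> (inv I (Suc m)) - \<mu> (inv I m))) * Q"
      using P' unfolding \<nu>_def e_def .
    show "\<theta> (\<mu> (inv I m) - \<mu> (inv I (Suc m))) * \<theta> (h + (X m - X (Suc m))) * Q'
      = \<theta> h * \<theta> (\<mu> (inv I m) - \<mu> (inv I (Suc m)) - (X m - X (Suc m))) * Q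
      + \<theta> (X m - X (Suc m)) * \<theta> (h + (\<mu> (inv I m) - \<mu> (inv I (Suc m)))) * P"
      using Q' unfolding \<nu>_def e_def minus_diff_eq .
  qed (use nz in \<open>simp_all add: \<nu>_def d_def e_def algebra_simps\<close>)
  from arg_cong[OF this, of "\<lambda>z. z * R"] show ?thesis
    unfolding level_weight_split[of _ _ _ _ _ _ _ ?P] rest rest_s by (simp only: distrib_right distrib_left mult_ac)
qed

text \<open>If only one label has appeared on level \<open>k\<close>, the sums over permutations
  match term by term. Otherwise each permutation is combined with the one that exchanges the two
  labelled roots, and such a pair of terms is an instance of \<open>two_root_exchange\<close>, with
  the induction hypothesis for \<open>I\<close> and for \<open>adj m \<circ> I\<close> as input. The
  second use explains why the genericity condition is needed for both signs of the root
  difference.\<close>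

theorem weight_sum_exchange:
  fixes I :: "nat \<Rightarrow> nat" and Y \<mu> :: "nat \<Rightarrow> complex" and m :: nat
  defines "\<nu> \<equiv> \<mu> (inv I (Suc m)) - \<mu> (inv I m)" and "d \<equiv> Y m - Y (Suc m)"
  assumes I: "bij I"
    and both: "m \<in> I ` {1..k}" "Suc m \<in> I ` {1..k}"
    and nz: "\<theta> \<nu> \<noteq> 0" "\<theta> d \<noteq> 0"
    and generic: "\<And>j a b. j < k \<Longrightarrow> a \<in> {1..j} \<Longrightarrow> b \<in> {1..j} \<Longrightarrow> a \<noteq> b \<Longrightarrow>
      \<theta> (t j a - t j b) \<noteq> 0 \<and> \<theta> (h + (t j a - t j b)) \<noteq> 0 \<and> \<theta> (\<nu> + (t j a - t j b)) \<noteq> 0"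
  shows "\<theta> \<nu> * \<theta> (h + d) * weight_sum q I h \<mu> t k (Y \<circ> adj m)
    = \<theta> h * \<theta> (\<nu> - d) * weight_sum q I h \<mu> t k Y + \<theta> d * \<theta> (h + \<nu>) * weight_sum q (adj m \<circ> I) h \<mu> t k Y"
  using I both nz generic unfolding \<nu>_def d_def
proof (induction k arbitrary: I Y)
  case (Suc k)
  let ?s = "adj m"
  let ?W = "weight_sum q I h \<mu> t k" and ?W' = "weight_sum q (?s \<circ> I) h \<mu> t k"
    and ?L = "level_weight q I h \<mu> k" and ?L' = "level_weight q (?s \<circ> I) h \<mu> k"
  let ?\<nu> = "\<mu> (inv I (Suc m)) - \<mu> (inv I m)" and ?d = "Y m - Y (Suc m)"
  define X where "X \<sigma> = t k \<circ> \<sigma> \<circ> slot I k" for \<sigma>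
  note I = Suc.prems(1)
  have inj: "inj I" using I by (rule bij_is_inj)
  have sI: "bij (?s \<circ> I)"
    using I by (intro bij_comp) simp_all
  show ?case
  proof (cases "m \<in> I ` {1..k} \<and> Suc m \<in> I ` {1..k}")
    case False
    have eq: "(t k \<circ> \<sigma> \<circ> slot (?s \<circ> I) k) v = (X \<sigma> \<circ> ?s) v" if "v \<in> (?s \<circ> I) ` {1..k}" for \<sigma> v
    proof -
      obtain u where u: "u \<in> I ` {1..k}" "v = ?s u"
        using \<open>v \<in> (?s \<circ> I) ` {1..k}\<close> by (metis imageE image_comp)
      then show ?thesis
        by (simp only: X_def o_apply slot_adj[OF inj False u(1)] transpose_involutory)
    qed
    have lw: "?L' (t k \<circ> \<sigma> \<circ> slot (?s \<circ> I) k) Y = ?L' (X \<sigma> \<circ> ?s) Y" for \<sigma>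
      by (rule level_weight_cong[OF eq refl])
    have ws: "?W' (t k \<circ> \<sigma> \<circ> slot (?s \<circ> I) k) = ?W (X \<sigma>)" for \<sigma>
      by (rule trans[OF weight_sum_cong[OF eq] weight_sum_adj[OF I False]])
    have both: "m \<in> I ` {1..k+1}" "Suc m \<in> I ` {1..k+1}"
      using Suc.prems(2,3) by simp_all
    have "\<theta> ?\<nu> * \<theta> (h + ?d) * (?L (X \<sigma>) (Y \<circ> ?s) * ?W (X \<sigma>))
      = \<theta> h * \<theta> (?\<nu> - ?d) * (?L (X \<sigma>) Y * ?W (X \<sigma>))
      + \<theta> ?d * \<theta> (h + ?\<nu>) * (?L' (X \<sigma> \<circ> ?s) Y * ?W (X \<sigma>))" for \<sigma>
      using arg_cong[OF one_root_exchange[OF I both False, where \<mu> = \<mu> and Y = Y and h = h and X = "X \<sigma>"], of "\<lambda>z. z * ?W (X \<sigma>)"]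
      by (simp only: distrib_right mult.assoc)
    then show ?thesis
      unfolding weight_sum.simps lw ws unfolding X_def[symmetric]
      by (simp only: sum_distrib_left sum.distrib[symmetric])
  next
    case True
    define \<tau> where "\<tau> = Transposition.transpose (slot I k m) (slot I k (Suc m))"
    have slots: "slot I k m \<in> {1..k}" "slot I k (Suc m) \<in> {1..k}"
      using True slot_in[OF inj] by blast+
    have \<tau>: "\<tau> permutes {1..k}"
      unfolding \<tau>_def by (rule permutes_swap_id[OF slots])
    have X\<tau>: "X (\<sigma> \<circ> \<tau>) v = (X \<sigma> \<circ> ?s) v" if "v \<in> I ` {1..k}" for \<sigma> v
    proof -
      have "\<tau> (slot I k v) = slot I k (?s v)"
      proof (cases "v \<in> {m, Suc m}")
        case True
        then show ?thesis by (auto simp: \<tau>_def)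
      next
        case False
        then have "slot I k v \<noteq> slot I k m" "slot I k v \<noteq> slot I k (Suc m)"
          using bij_betw_slot[OF inj, of k] that True by (auto simp: bij_betw_def inj_on_eq_iff)
        with False show ?thesis by (simp add: \<tau>_def adj_fixed)
      qed
      then show ?thesis by (simp add: X_def)
    qed
    have img: "(?s \<circ> I) ` {1..k} = I ` {1..k}"
    proof (rule set_eqI)
      fix v
      have "v \<in> (?s \<circ> I) ` {1..k} \<longleftrightarrow> ?s v \<in> I ` {1..k}"
        using adj_in_image_comp_iff[of m "?s v" I "{1..k}"] by (simp only: transpose_involutory)
      then show "v \<in> (?s \<circ> I) ` {1..k} \<longleftrightarrow> v \<in> I ` {1..k}"
        using adj_in_image_iff[of m I "{1..k}" v] True by blast
    qed
    have slot_s: "slot (?s \<circ> I) k = slot I k"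
      unfolding slot_def idx_def[abs_def] img ..
    \<comment> \<open>Adding the sum to its reindexing by \<open>\<tau>\<close> avoids a choice of
      representatives for the pairs of permutations, at the price of a factor 2.\<close>
    have pair: "2 * weight_sum q J h \<mu> t (Suc k) Z
      = (\<Sum>\<sigma> | \<sigma> permutes {1..k}. level_weight q J h \<mu> k (X \<sigma>) Z * weight_sum q J h \<mu> t k (X \<sigma>)
          + level_weight q J h \<mu> k (X \<sigma> \<circ> ?s) Z * weight_sum q J h \<mu> t k (X \<sigma> \<circ> ?s))"
      if "slot J k = slot I k" "J ` {1..k} = I ` {1..k}" for J Z
    proof -
      let ?f = "\<lambda>\<sigma>. level_weight q J h \<mu> k (X \<sigma>) Z * weight_sum q J h \<mu> t k (X \<sigma>)"
      have X\<tau>': "X (\<sigma> \<circ> \<tau>) v = (X \<sigma> \<circ> ?s) v" if "v \<in> J ` {1..k}" for \<sigma> v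
        using X\<tau> that \<open>J ` {1..k} = I ` {1..k}\<close> by blast
      have "weight_sum q J h \<mu> t (Suc k) Z = sum ?f {\<sigma>. \<sigma> permutes {1..k}}"
        unfolding weight_sum.simps that X_def ..
      moreover have "sum ?f {\<sigma>. \<sigma> permutes {1..k}} = (\<Sum>\<sigma> | \<sigma> permutes {1..k}. ?f (\<sigma> \<circ> \<tau>))"
        by (rule sum_permutations_compose_right[OF \<tau>])
      moreover have "?f (\<sigma> \<circ> \<tau>) = level_weight q J h \<mu> k (X \<sigma> \<circ> ?s) Z * weight_sum q J h \<mu> t k (X \<sigma> \<circ> ?s)" for \<sigma>
        by (rule arg_cong2[OF level_weight_cong[OF X\<tau>' refl] weight_sum_cong[OF X\<tau>']])
      ultimately show ?thesis
        by (simp only: mult_2 sum.distrib)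
    qed
    note pairs = pair[OF refl refl] pair[OF slot_s img]
    have \<nu>_s: "\<mu> (inv (?s \<circ> I) (Suc m)) - \<mu> (inv (?s \<circ> I) m) = - ?\<nu>"
      unfolding inv_adj_comp[OF I] by simp
    have ssI: "?s \<circ> (?s \<circ> I) = I"
      by (simp add: fun_eq_iff)
    have step: "\<theta> ?\<nu> * \<theta> (h + ?d) * (?L (X \<sigma>) (Y \<circ> ?s) * ?W (X \<sigma>)
        + ?L (X \<sigma> \<circ> ?s) (Y \<circ> ?s) * ?W (X \<sigma> \<circ> ?s))
      = \<theta> h * \<theta> (?\<nu> - ?d) * (?L (X \<sigma>) Y * ?W (X \<sigma>)
        + ?L (X \<sigma> \<circ> ?s) Y * ?W (X \<sigma> \<circ> ?s))
      + \<theta> ?d * \<theta> (h + ?\<nu>) * (?L' (X \<sigma>) Y * ?W' (X \<sigma>)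
        + ?L' (X \<sigma> \<circ> ?s) Y * ?W' (X \<sigma> \<circ> ?s))"
      if \<sigma>: "\<sigma> permutes {1..k}" for \<sigma>
    proof -
      let ?a = "\<sigma> (slot I k m)" and ?b = "\<sigma> (slot I k (Suc m))"
      have ab: "?a \<in> {1..k}" "?b \<in> {1..k}"
        using slots permutes_in_image[OF \<sigma>] by blast+
      have "slot I k m \<noteq> slot I k (Suc m)"
        using bij_betw_slot[OF inj, of k] True by (auto simp: bij_betw_def inj_on_eq_iff)
      then have neq: "?a \<noteq> ?b" "?b \<noteq> ?a"
        using inj_eq[OF permutes_inj[OF \<sigma>]] by simp_all
      let ?e = "X \<sigma> m - X \<sigma> (Suc m)"
      have e: "?e = t k ?a - t k ?b" "- ?e = t k ?b - t k ?a"
        by (simp_all add: X_def)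
      note gen = Suc.prems(6)[OF lessI ab neq(1)] Suc.prems(6)[OF lessI ab(2,1) neq(2)]
      have nz: "\<theta> ?e \<noteq> 0" "\<theta> (h + ?e) \<noteq> 0" "\<theta> (h - ?e) \<noteq> 0" "\<theta> (?\<nu> + ?e) \<noteq> 0"
        using gen unfolding e(1)[symmetric] e(2)[symmetric] by (simp_all add: algebra_simps)
      have gen_k: "\<theta> (t j a - t j b) \<noteq> 0 \<and> \<theta> (h + (t j a - t j b)) \<noteq> 0 \<and> \<theta> (?\<nu> + (t j a - t j b)) \<noteq> 0"
        if "j < k" "a \<in> {1..j}" "b \<in> {1..j}" "a \<noteq> b" for j a b
        using Suc.prems(6)[of j a b] that by simp
      have IH: "\<theta> ?\<nu> * \<theta> (h + ?e) * ?W (X \<sigma> \<circ> ?s)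
        = \<theta> h * \<theta> (?\<nu> - ?e) * ?W (X \<sigma>) + \<theta> ?e * \<theta> (h + ?\<nu>) * ?W' (X \<sigma>)"
        by (rule Suc.IH[OF I conjunct1[OF True] conjunct2[OF True] Suc.prems(4) nz(1) gen_k])
      \<comment> \<open>The induction hypothesis for \<open>?s \<circ> I\<close>: its Kaehler
        difference is the negative of \<open>?\<nu>\<close>, and a second transposition leads back
        to \<open>I\<close>.\<close>
      have IH': "\<theta> (- ?\<nu>) * \<theta> (h + ?e) * ?W' (X \<sigma> \<circ> ?s)
        = \<theta> h * \<theta> (- ?\<nu> - ?e) * ?W' (X \<sigma>) + \<theta> ?e * \<theta> (h + - ?\<nu>) * ?W (X \<sigma>)"
      proof (rule Suc.IH[OF sI, of "X \<sigma>", unfolded \<nu>_s ssI])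
        show "m \<in> (?s \<circ> I) ` {1..k}" "Suc m \<in> (?s \<circ> I) ` {1..k}"
          unfolding pair_in_adj_comp using True by blast+
        show "\<theta> (- ?\<nu>) \<noteq> 0"
          using Suc.prems(4) unfolding theta_minus by simp
        fix j a b assume *: "j < k" "a \<in> {1..j}" "b \<in> {1..j}" "a \<noteq> b"
        have "- ?\<nu> + (t j a - t j b) = - (?\<nu> + (t j b - t j a))" by simp
        then have "\<theta> (- ?\<nu> + (t j a - t j b)) \<noteq> 0"
          using gen_k[of j b a] * theta_minus by (metis neg_equal_0_iff_equal)
        then show "\<theta> (t j a - t j b) \<noteq> 0 \<and> \<theta> (h + (t j a - t j b)) \<noteq> 0 \<and> \<theta> (- ?\<nu> + (t j a - t j b)) \<noteq> 0"
          using gen_k[of j a b] * by blast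
      qed (rule nz)
      show ?thesis
        by (rule two_root_exchange[OF I conjunct1[OF True] conjunct2[OF True] Suc.prems(4,5) nz IH IH'])
    qed
    have "\<theta> ?\<nu> * \<theta> (h + ?d) * (2 * weight_sum q I h \<mu> t (Suc k) (Y \<circ> ?s))
      = \<theta> h * \<theta> (?\<nu> - ?d) * (2 * weight_sum q I h \<mu> t (Suc k) Y)
      + \<theta> ?d * \<theta> (h + ?\<nu>) * (2 * weight_sum q (?s \<circ> I) h \<mu> t (Suc k) Y)"
      unfolding pairs sum_distrib_left sum.distrib[symmetric]
      by (rule sum.cong[OF refl]) (rule step, simp)
    moreover have "a * x = b * y + c * z" if "a * (2 * x) = b * (2 * y) + c * (2 * z)" for a b c x y z :: complex
      using that by algebra
    ultimately show ?thesis by blast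
  qed
qed simp

end

section \<open>The restriction matrix and its mirror\<close>

text \<open>Each level is already summed over all orders of its roots, so a permutation of them is
  absorbed by reindexing.\<close>

lemma weight_sum_permuted_roots:
  assumes I: "inj I"
    and "\<And>k. k < n \<Longrightarrow> \<exists>\<tau>. \<tau> permutes {1..k} \<and> (\<forall>a\<in>{1..k}. t' k a = t k (\<tau> a))"
  shows "weight_sum q I h \<mu> t' n Y = weight_sum q I h \<mu> t n Y"
  using assms(2)
proof (induction n arbitrary: Y)
  case (Suc k)
  obtain \<tau> where \<tau>: "\<tau> permutes {1..k}" "\<And>a. a \<in> {1..k} \<Longrightarrow> t' k a = t k (\<tau> a)"
    using Suc.prems[of k] by blast
  have IH: "weight_sum q I h \<mu> t' k Z = weight_sum q I h \<mu> t k Z" for Z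
    by (rule Suc.IH) (rule Suc.prems, rule less_SucI)
  let ?f = "\<lambda>\<sigma>. level_weight q I h \<mu> k (t k \<circ> \<sigma> \<circ> slot I k) Y * weight_sum q I h \<mu> t k (t k \<circ> \<sigma> \<circ> slot I k)"
  have "level_weight q I h \<mu> k (t' k \<circ> \<sigma> \<circ> slot I k) Y * weight_sum q I h \<mu> t' k (t' k \<circ> \<sigma> \<circ> slot I k) = ?f (\<tau> \<circ> \<sigma>)"
    if "\<sigma> permutes {1..k}" for \<sigma>
  proof -
    have eq: "(t' k \<circ> \<sigma> \<circ> slot I k) v = (t k \<circ> (\<tau> \<circ> \<sigma>) \<circ> slot I k) v" if "v \<in> I ` {1..k}" for v
      using \<tau>(2)[of "\<sigma> (slot I k v)"] slot_in[OF I that] permutes_in_image[OF \<open>\<sigma> permutes {1..k}\<close>] by simp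
    show ?thesis
      unfolding IH by (rule arg_cong2[OF level_weight_cong[OF eq refl] weight_sum_cong[OF eq]])
  qed
  then have "weight_sum q I h \<mu> t' (Suc k) Y = (\<Sum>\<sigma> | \<sigma> permutes {1..k}. ?f (\<tau> \<circ> \<sigma>))"
    unfolding weight_sum.simps by (intro sum.cong[OF refl]) blast
  also have "\<dots> = weight_sum q I h \<mu> t (Suc k) Y"
    unfolding weight_sum.simps by (rule setum_permutations_compose_left[OF \<tau>(1), symmetric])
  finally show ?case .
qed simp

lemma weight_sum_relabelled_roots:
  assumes I: "inj I" and J: "inj J" and \<sigma>: "bij \<sigma>"
  shows "weight_sum q I h \<mu> (\<lambda>k l. z (inv \<sigma> (idx (\<sigma> \<circ> J) k l))) n Y = weight_sum q I h \<mu> (\<lambda>k l. z (idx J k l)) n Y"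
proof (rule weight_sum_permuted_roots[OF I])
  fix k
  have \<sigma>J: "inj (\<sigma> \<circ> J)"
    using J \<sigma> by (simp add: inj_compose bij_is_inj)
  have in_J: "inv \<sigma> (idx (\<sigma> \<circ> J) k a) \<in> J ` {1..k}" if "a \<in> {1..k}" for a
    using idx_in[OF \<sigma>J that] by (auto simp: bij_is_inj[OF \<sigma>])
  have in_\<sigma>J: "\<sigma> (idx J k a) \<in> (\<sigma> \<circ> J) ` {1..k}" if "a \<in> {1..k}" for a
    using idx_in[OF J that] by auto
  define \<tau> where "\<tau> a = (if a \<in> {1..k} then slot J k (inv \<sigma> (idx (\<sigma> \<circ> J) k a)) else a)" for a
  have "bij_betw (\<lambda>a. slot J k (inv \<sigma> (idx (\<sigma> \<circ> J) k a))) {1..k} {1..k}"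
  proof (rule bij_betwI[where g = "\<lambda>a. slot (\<sigma> \<circ> J) k (\<sigma> (idx J k a))"])
    show "(\<lambda>a. slot J k (inv \<sigma> (idx (\<sigma> \<circ> J) k a))) \<in> {1..k} \<rightarrow> {1..k}"
      using in_J slot_in[OF J] by blast
    show "(\<lambda>a. slot (\<sigma> \<circ> J) k (\<sigma> (idx J k a))) \<in> {1..k} \<rightarrow> {1..k}"
      using in_\<sigma>J slot_in[OF \<sigma>J] by blast
    show "slot (\<sigma> \<circ> J) k (\<sigma> (idx J k (slot J k (inv \<sigma> (idx (\<sigma> \<circ> J) k a))))) = a" if "a \<in> {1..k}" for a
      unfolding idx_slot[OF J in_J[OF that]] surj_f_inv_f[OF bij_is_surj[OF \<sigma>]] by (rule slot_idx[OF \<sigma>J that])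
    show "slot J k (inv \<sigma> (idx (\<sigma> \<circ> J) k (slot (\<sigma> \<circ> J) k (\<sigma> (idx J k a))))) = a" if "a \<in> {1..k}" for a
      unfolding idx_slot[OF \<sigma>J in_\<sigma>J[OF that]] inv_f_f[OF bij_is_inj[OF \<sigma>]] by (rule slot_idx[OF J that])
  qed
  then have "bij_betw \<tau> {1..k} {1..k}"
    by (subst bij_betw_cong[where g = "\<lambda>a. slot J k (inv \<sigma> (idx (\<sigma> \<circ> J) k a))"]) (simp_all add: \<tau>_def)
  then have "\<tau> permutes {1..k}"
    by (rule bij_imp_permutes) (simp only: \<tau>_def if_False)
  moreover have "z (inv \<sigma> (idx (\<sigma> \<circ> J) k a)) = z (idx J k (\<tau> a))" if "a \<in> {1..k}" for a
    using idx_slot[OF J in_J[OF that]] that by (simp only: \<tau>_def if_True)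
  ultimately show "\<exists>\<tau>. \<tau> permutes {1..k} \<and> (\<forall>a\<in>{1..k}. z (inv \<sigma> (idx (\<sigma> \<circ> J) k a)) = z (idx J k (\<tau> a)))"
    by blast
qed

text \<open>The plain substitution behind an entry of the restriction matrix. Because of the
  quotients it represents the restricted section only where the denominators do not vanish.\<close>

definition restr_entry :: "complex \<Rightarrow> nat \<Rightarrow> (nat \<Rightarrow> nat) \<Rightarrow> (nat \<Rightarrow> nat) \<Rightarrow>
    (nat \<Rightarrow> complex) \<Rightarrow> complex \<Rightarrow> (nat \<Rightarrow> complex) \<Rightarrow> complex" where
  "restr_entry q n I J z h \<mu> = weight_sum q I h \<mu> (\<lambda>k l. z (idx J k l)) n z"

text \<open>Nonvanishing of the denominators together with all factors by which the recursions
  divide. The list is symmetric under exchanging \<open>z\<close> and \<open>\<mu>\<close>, as the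
  mirror map requires.\<close>

definition doubly_generic :: "complex \<Rightarrow> nat \<Rightarrow> (nat \<Rightarrow> complex) \<Rightarrow> complex \<Rightarrow> (nat \<Rightarrow> complex) \<Rightarrow> bool" where
  "doubly_generic q n z h \<mu> \<longleftrightarrow> (\<forall>i\<in>{1..n}. \<forall>j\<in>{1..n}. i \<noteq> j \<longrightarrow>
     theta q (z i - z j) \<noteq> 0 \<and> theta q (h + (z i - z j)) \<noteq> 0 \<and>
     theta q (\<mu> i - \<mu> j) \<noteq> 0 \<and> theta q (h + (\<mu> i - \<mu> j)) \<noteq> 0 \<and>
     (\<forall>k\<in>{1..n}. \<forall>l\<in>{1..n}. k \<noteq> l \<longrightarrow> theta q (\<mu> i - \<mu> j + (z k - z l)) \<noteq> 0))"

lemma doubly_genericD: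
  assumes "doubly_generic q n z h \<mu>" "i \<in> {1..n}" "j \<in> {1..n}" "i \<noteq> j"
  shows "theta q (z i - z j) \<noteq> 0" "theta q (h + (z i - z j)) \<noteq> 0"
    "theta q (\<mu> i - \<mu> j) \<noteq> 0" "theta q (h + (\<mu> i - \<mu> j)) \<noteq> 0"
    "k \<in> {1..n} \<Longrightarrow> l \<in> {1..n} \<Longrightarrow> k \<noteq> l \<Longrightarrow> theta q (\<mu> i - \<mu> j + (z k - z l)) \<noteq> 0"
  using assms unfolding doubly_generic_def by blast+

lemma doubly_generic_permuted:
  assumes g: "doubly_generic q n z h \<mu>" and \<sigma>: "\<sigma> permutes {1..n}" and \<tau>: "\<tau> permutes {1..n}"
  shows "doubly_generic q n (z \<circ> \<sigma>) h (\<mu> \<circ> \<tau>)"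
proof -
  have in_range: "\<sigma> i \<in> {1..n}" "\<tau> i \<in> {1..n}" if "i \<in> {1..n}" for i
    using permutes_in_image[OF \<sigma>] permutes_in_image[OF \<tau>] that by simp_all
  have neq: "\<sigma> i \<noteq> \<sigma> j" "\<tau> i \<noteq> \<tau> j" if "i \<noteq> j" for i j
    using inj_eq[OF permutes_inj[OF \<sigma>]] inj_eq[OF permutes_inj[OF \<tau>]] that by simp_all
  show ?thesis
    unfolding doubly_generic_def o_apply
  proof (intro ballI impI conjI)
    fix i j assume ij: "i \<in> {1..n}" "j \<in> {1..n}" "i \<noteq> j"
    note D\<sigma> = doubly_genericD[OF g in_range(1)[OF ij(1)] in_range(1)[OF ij(2)] neq(1)[OF ij(3)]]
      and D\<tau> = doubly_genericD[OF g in_range(2)[OF ij(1)] in_range(2)[OF ij(2)] neq(2)[OF ij(3)]]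
    show "theta q (z (\<sigma> i) - z (\<sigma> j)) \<noteq> 0" "theta q (h + (z (\<sigma> i) - z (\<sigma> j))) \<noteq> 0"
      by (rule D\<sigma>(1) D\<sigma>(2))+
    show "theta q (\<mu> (\<tau> i) - \<mu> (\<tau> j)) \<noteq> 0" "theta q (h + (\<mu> (\<tau> i) - \<mu> (\<tau> j))) \<noteq> 0"
      by (rule D\<tau>(3) D\<tau>(4))+
    show "theta q (\<mu> (\<tau> i) - \<mu> (\<tau> j) + (z (\<sigma> k) - z (\<sigma> l))) \<noteq> 0" if "k \<in> {1..n}" "l \<in> {1..n}" "k \<noteq> l" for k l
      by (rule D\<tau>(5)[OF in_range(1)[OF that(1)] in_range(1)[OF that(2)] neq(1)[OF that(3)]])
  qed
qed

lemma adj_permutes: "1 \<le> m \<Longrightarrow> m < n \<Longrightarrow> adj m permutes {1..n}"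
  by (rule permutes_swap_id) auto

context nome
begin

lemma doubly_generic_swapped:
  assumes "doubly_generic q n z h \<mu>"
  shows "doubly_generic q n \<mu> h (\<lambda>i. - z i)"
  unfolding doubly_generic_def
proof (intro ballI impI conjI)
  fix i j assume ij: "i \<in> {1..n}" "j \<in> {1..n}" "i \<noteq> j"
  note g = doubly_genericD[OF assms ij] doubly_genericD[OF assms ij(2,1) ij(3)[symmetric]]
  have eq: "- z i - - z j = z j - z i" by simp
  show "theta q (\<mu> i - \<mu> j) \<noteq> 0" "theta q (h + (\<mu> i - \<mu> j)) \<noteq> 0"
    "theta q (- z i - - z j) \<noteq> 0" "theta q (h + (- z i - - z j)) \<noteq> 0"
    unfolding eq by (rule g)+
  fix k l assume "k \<in> {1..n}" "l \<in> {1..n}" "k \<noteq> l"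
  then have "theta q (\<mu> k - \<mu> l + (z j - z i)) \<noteq> 0"
    using doubly_genericD(5)[OF assms, of k l j i] ij by blast
  then show "theta q (- z i - - z j + (\<mu> k - \<mu> l)) \<noteq> 0"
    by (simp add: algebra_simps)
qed

text \<open>Transposing \<open>J\<close> together with \<open>z\<close> leaves the roots of the
  lower levels in place and exchanges only the top variables, which is the situation of
  \<open>weight_sum_exchange\<close>.\<close>

theorem restr_entry_exchange:
  assumes I: "I permutes {1..n}" and J: "J permutes {1..n}" and m: "1 \<le> m" "m < n"
    and g: "doubly_generic q n z h \<mu>"
  defines "\<nu> \<equiv> \<mu> (inv I (Suc m)) - \<mu> (inv I m)" and "d \<equiv> z m - z (Suc m)"
  shows "\<theta> \<nu> * \<theta> (h + d) * restr_entry q n I (adj m \<circ> J) (z \<circ> adj m) h \<mu>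
    = \<theta> h * \<theta> (\<nu> - d) * restr_entry q n I J z h \<mu> + \<theta> d * \<theta> (h + \<nu>) * restr_entry q n (adj m \<circ> I) J z h \<mu>"
proof -
  let ?s = "adj m" and ?t = "\<lambda>k l. z (idx J k l)"
  have mn: "m \<in> {1..n}" "Suc m \<in> {1..n}" "m \<noteq> Suc m"
    using m by auto
  have injJ: "inj J" and injI: "inj I"
    using I J by (simp_all add: permutes_inj)
  have inv_in: "inv I v \<in> {1..n}" if "v \<in> {1..n}" for v
    using permutes_in_image[OF permutes_inv[OF I]] that by blast
  have inv_neq: "inv I (Suc m) \<noteq> inv I m"
    using inj_eq[OF permutes_inj[OF permutes_inv[OF I]]] by auto
  have sub: "J ` {1..k} \<subseteq> {1..n}" if "k \<le> n" for k
    using permutes_image[OF J] that by (metis atLeastatMost_subset_iff image_mono le_refl)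
  have "restr_entry q n I (?s \<circ> J) (z \<circ> ?s) h \<mu> = weight_sum q I h \<mu> ?t n (z \<circ> ?s)"
    using weight_sum_relabelled_roots[OF injI injJ, of ?s] by (simp add: restr_entry_def)
  moreover have "\<theta> \<nu> * \<theta> (h + d) * weight_sum q I h \<mu> ?t n (z \<circ> ?s)
    = \<theta> h * \<theta> (\<nu> - d) * weight_sum q I h \<mu> ?t n z + \<theta> d * \<theta> (h + \<nu>) * weight_sum q (?s \<circ> I) h \<mu> ?t n z"
    unfolding \<nu>_def d_def
  proof (rule weight_sum_exchange)
    show "bij I" using I by (rule permutes_bij)
    show "m \<in> I ` {1..n}" "Suc m \<in> I ` {1..n}"
      using mn unfolding permutes_image[OF I] by simp_all
    note inv_pair = inv_in[OF mn(2)] inv_in[OF mn(1)] inv_neq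
    show "\<theta> (\<mu> (inv I (Suc m)) - \<mu> (inv I m)) \<noteq> 0" "\<theta> (z m - z (Suc m)) \<noteq> 0"
      by (rule doubly_genericD(3)[OF g inv_pair] doubly_genericD(1)[OF g mn])+
    fix j a b assume *: "j < n" "a \<in> {1..j}" "b \<in> {1..j}" "a \<noteq> b"
    have ab: "idx J j a \<in> {1..n}" "idx J j b \<in> {1..n}"
      using idx_in[OF injJ *(2)] idx_in[OF injJ *(3)] sub[of j] *(1) by (meson less_imp_le subsetD)+
    have neq: "idx J j a \<noteq> idx J j b"
      using *(4) slot_idx[OF injJ *(2)] slot_idx[OF injJ *(3)] by metis
    show "\<theta> (?t j a - ?t j b) \<noteq> 0 \<and> \<theta> (h + (?t j a - ?t j b)) \<noteq> 0 \<and>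
        \<theta> (\<mu> (inv I (Suc m)) - \<mu> (inv I m) + (?t j a - ?t j b)) \<noteq> 0"
      by (intro conjI doubly_genericD(1)[OF g ab neq] doubly_genericD(2)[OF g ab neq] doubly_genericD(5)[OF g inv_pair ab neq])
  qed
  ultimately show ?thesis
    unfolding restr_entry_def by (simp only:)
qed

end

section \<open>Triangularity of the restriction matrix and its diagonal\<close>

lemma level_root_labelling:
  assumes I: "inj I" and J: "inj J" and \<sigma>: "\<sigma> permutes {1..k}"
  shows "bij_betw (idx J k \<circ> \<sigma> \<circ> slot I k) (I ` {1..k}) (J ` {1..k})"
  using bij_betw_trans[OF bij_betw_slot[OF I] bij_betw_trans[OF permutes_imp_bij[OF \<sigma>] bij_betw_idx[OF J]]]
  by (simp only: comp_assoc)

text \<open>The root at \<open>a\<close> is also the upper root at some \<open>c\<close> with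
  \<open>g c = f a\<close>. If \<open>c\<close> exceeded \<open>a\<close>, the numerator for these
  labels would be \<open>theta\<close> at 0. So \<open>c \<le> a\<close>, and
  \<open>f a = g c \<le> c \<le> a\<close>.\<close>

lemma (in nome) level_weight_nonzero_imp_below:
  assumes nz: "level_weight q I h \<mu> k (z \<circ> f) (z \<circ> g) \<noteq> 0"
    and f: "bij_betw f (I ` {1..k}) (J ` {1..k})"
    and g: "bij_betw g (I ` {1..Suc k}) (J ` {1..Suc k})" and below: "\<And>c. c \<in> I ` {1..Suc k} \<Longrightarrow> g c \<le> c"
    and a: "a \<in> I ` {1..k}"
  shows "f a \<le> a"
proof (rule ccontr)
  assume less: "\<not> f a \<le> a"
  have "f a \<in> J ` {1..k}"
    using bij_betwE[OF f] a by blast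
  then have "f a \<in> J ` {1..Suc k}" by auto
  then obtain c where c: "c \<in> I ` {1..Suc k}" "g c = f a"
    using bij_betw_imp_surj_on[OF g] by (metis imageE)
  with below[OF c(1)] less have "a < c" by simp
  then have "psi_val q I h \<mu> k a c ((z \<circ> g) c - (z \<circ> f) a) = 0"
    using c by (simp add: psi_val_def)
  then have "(\<Prod>w\<in>I ` {1..k+1}. psi_val q I h \<mu> k a w ((z \<circ> g) w - (z \<circ> f) a)) = 0"
    using c(1) by (intro prod_zero) auto
  then have "(\<Prod>v\<in>I ` {1..k}. \<Prod>w\<in>I ` {1..k+1}. psi_val q I h \<mu> k v w ((z \<circ> g) w - (z \<circ> f) v)) = 0"
    using a by (intro prod_zero) auto
  then show False
    using nz by (simp only: level_weight_def div_0 simp_thms)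
qed

text \<open>A nonzero sum has a nonzero term, and the bound on the labelling passes from the top
  level of that term down to every lower level.\<close>

lemma (in nome) weight_sum_nonzero_imp_below:
  assumes I: "inj I" and J: "inj J"
    and "weight_sum q I h \<mu> (\<lambda>k l. z (idx J k l)) k (z \<circ> g) \<noteq> 0"
    and "bij_betw g (I ` {1..k}) (J ` {1..k})" "\<And>c. c \<in> I ` {1..k} \<Longrightarrow> g c \<le> c"
    and "j \<le> k"
  shows "\<exists>f. bij_betw f (I ` {1..j}) (J ` {1..j}) \<and> (\<forall>c\<in>I ` {1..j}. f c \<le> c)"
  using assms(3-)
proof (induction k arbitrary: g)
  case 0
  then show ?case by auto
next
  case (Suc k)
  show ?case
  proof (cases "j = Suc k")
    case True
    then show ?thesis using Suc.prems(2,3) by blast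
  next
    case False
    let ?f = "\<lambda>\<sigma>. idx J k \<circ> \<sigma> \<circ> slot I k"
    have roots: "(\<lambda>l. z (idx J k l)) \<circ> \<sigma> \<circ> slot I k = z \<circ> ?f \<sigma>" for \<sigma>
      by (simp add: fun_eq_iff)
    from Suc.prems(1) obtain \<sigma> where \<sigma>: "\<sigma> permutes {1..k}"
        and nz: "level_weight q I h \<mu> k (z \<circ> ?f \<sigma>) (z \<circ> g) \<noteq> 0"
          "weight_sum q I h \<mu> (\<lambda>k l. z (idx J k l)) k (z \<circ> ?f \<sigma>) \<noteq> 0"
      unfolding weight_sum.simps roots by (elim sum.not_neutral_contains_not_neutral) auto
    note bij = level_root_labelling[OF I J \<sigma>]
    show ?thesis
      by (rule Suc.IH[OF nz(2) bij level_weight_nonzero_imp_below[OF nz(1) bij Suc.prems(2,3)]])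
        (use False Suc.prems(4) in simp_all)
  qed
qed

lemma below_identity:
  fixes f :: "nat \<Rightarrow> nat"
  assumes "finite S" "bij_betw f S S" "\<And>a. a \<in> S \<Longrightarrow> f a \<le> a" "a \<in> S"
  shows "f a = a"
proof (rule ccontr)
  assume "f a \<noteq> a"
  then have "f a < a"
    using assms(3,4) le_neq_implies_less by blast
  then have "(\<Sum>x\<in>S. f x) < (\<Sum>x\<in>S. x)"
    using assms by (intro sum_strict_mono_ex1) auto
  then show False
    using sum.reindex_bij_betw[OF assms(2), of "\<lambda>x. x"] by simp
qed

text \<open>The contribution of positions \<open>i < j\<close> to a diagonal entry: on level
  \<open>j - 1\<close>, the numerator of \<open>I i\<close> against the new value \<open>I j\<close>
  times the numerator of \<open>I i\<close> against itself. The latter carries the Kaehler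
  parameters.\<close>

definition diagonal_factor :: "complex \<Rightarrow> (nat \<Rightarrow> nat) \<Rightarrow> (nat \<Rightarrow> complex) \<Rightarrow> complex \<Rightarrow> (nat \<Rightarrow> complex) \<Rightarrow>
    nat \<Rightarrow> nat \<Rightarrow> complex" where
  "diagonal_factor q I z h \<mu> i j =
     (if I j < I i then theta q (h + (z (I j) - z (I i))) * theta q (\<mu> j - \<mu> i)
      else theta q (z (I j) - z (I i)) * theta q (h + (\<mu> j - \<mu> i)))"

text \<open>With equal labelling on both levels, the numerators for two distinct old values
  reproduce the denominators exactly; the new value and the diagonal remain.\<close>

lemma (in nome) level_weight_diagonal:
  assumes I: "bij I"
    and g: "\<And>v w. v \<in> I ` {1..k} \<Longrightarrow> w \<in> I ` {1..k} \<Longrightarrow> v \<noteq> w \<Longrightarrow> \<theta> (z v - z w) \<noteq> 0 \<and> \<theta> (h + (z v - z w)) \<noteq> 0"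
  shows "level_weight q I h \<mu> k z z = (\<Prod>i\<in>{1..k}. diagonal_factor q I z h \<mu> i (Suc k))"
proof -
  let ?\<psi> = "psi_val q I h \<mu> k"
  let ?S = "I ` {1..k}" and ?e = "I (Suc k)"
  let ?D = "\<lambda>v w. \<theta> (h + (z v - z w)) * \<theta> (z w - z v)"
  have e: "?e \<notin> ?S"
    using next_value_notin[OF I, of k] by simp
  have ins: "I ` {1..k+1} = insert ?e ?S"
    by (auto simp: atLeastAtMostSuc_conv)
  have row: "(\<Prod>w\<in>insert ?e ?S. ?\<psi> v w (z w - z v))
    = ?\<psi> v ?e (z ?e - z v) * ?\<psi> v v 0
      * ((\<Prod>w\<in>{w \<in> ?S. w < v}. \<theta> (h + (z w - z v))) * (\<Prod>w\<in>{w \<in> ?S. v < w}. \<theta> (z w - z v)))" if v: "v \<in> ?S" for v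
  proof -
    have split: "?S = insert v ({w \<in> ?S. w < v} \<union> {w \<in> ?S. v < w})"
      using v by auto
    have "(\<Prod>w\<in>?S. ?\<psi> v w (z w - z v))
      = ?\<psi> v v 0 * ((\<Prod>w\<in>{w \<in> ?S. w < v}. ?\<psi> v w (z w - z v))
          * (\<Prod>w\<in>{w \<in> ?S. v < w}. ?\<psi> v w (z w - z v)))"
      by (subst split, subst prod.insert, simp, simp, subst prod.union_disjoint) auto
    moreover have "(\<Prod>w\<in>{w \<in> ?S. w < v}. ?\<psi> v w (z w - z v)) = (\<Prod>w\<in>{w \<in> ?S. w < v}. \<theta> (h + (z w - z v)))"
      by (rule prod.cong) (auto simp: psi_val_def)
    moreover have "(\<Prod>w\<in>{w \<in> ?S. v < w}. ?\<psi> v w (z w - z v)) = (\<Prod>w\<in>{w \<in> ?S. v < w}. \<theta> (z w - z v))"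
      by (rule prod.cong) (auto simp: psi_val_def)
    ultimately show ?thesis
      using e by (simp add: mult_ac)
  qed
  have swap: "(\<Prod>v\<in>?S. \<Prod>w\<in>{w \<in> ?S. w < v}. \<theta> (h + (z w - z v))) = (\<Prod>v\<in>?S. \<Prod>w\<in>{w \<in> ?S. v < w}. \<theta> (h + (z v - z w)))"
    by (rule prod.swap_restrict) auto
  have nz: "(\<Prod>v\<in>?S. \<Prod>w\<in>{w \<in> ?S. v < w}. ?D v w) \<noteq> 0"
  proof -
    have "?D v w \<noteq> 0" if "v \<in> ?S" "w \<in> ?S" "v < w" for v w
      using g[of v w] g[of w v] that by auto
    then show ?thesis by auto
  qed
  have "(\<Prod>v\<in>?S. \<Prod>w\<in>insert ?e ?S. ?\<psi> v w (z w - z v))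
    = (\<Prod>v\<in>?S. ?\<psi> v ?e (z ?e - z v) * ?\<psi> v v 0
       * ((\<Prod>w\<in>{w \<in> ?S. w < v}. \<theta> (h + (z w - z v))) * (\<Prod>w\<in>{w \<in> ?S. v < w}. \<theta> (z w - z v))))"
    by (rule prod.cong[OF refl row])
  also have "\<dots> = (\<Prod>v\<in>?S. ?\<psi> v ?e (z ?e - z v) * ?\<psi> v v 0)
      * (\<Prod>v\<in>?S. \<Prod>w\<in>{w \<in> ?S. v < w}. ?D v w)"
    unfolding prod.distrib swap by (simp only: mult.assoc)
  finally have "level_weight q I h \<mu> k z z = (\<Prod>v\<in>?S. ?\<psi> v ?e (z ?e - z v) * ?\<psi> v v 0)"
    unfolding level_weight_def ins add_diff_eq[symmetric] using nz by simp
  also have "\<dots> = (\<Prod>i\<in>{1..k}. diagonal_factor q I z h \<mu> i (Suc k))"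
  proof (rule prod_reindex_cong)
    show "bij_betw I {1..k} ?S"
      using bij_is_inj[OF I] by (simp add: inj_on_imp_bij_betw inj_on_subset)
    fix i assume "i \<in> {1..k}"
    then have "I (Suc k) \<noteq> I i"
      using e by auto
    then show "?\<psi> (I i) ?e (z ?e - z (I i)) * ?\<psi> (I i) (I i) 0 = diagonal_factor q I z h \<mu> i (Suc k)"
      using bij_is_inj[OF I] by (auto simp: psi_val_def diagonal_factor_def p_ind_def algebra_simps)
  qed
  finally show ?thesis .
qed

text \<open>For \<open>J = I\<close> a nonvanishing term gives a permutation of a finite set that
  never increases a value, hence the identity.\<close>

lemma (in nome) weight_sum_diagonal:
  assumes I: "bij I"
    and g: "\<And>v w. v \<in> I ` {1..k} \<Longrightarrow> w \<in> I ` {1..k} \<Longrightarrow> v \<noteq> w \<Longrightarrow> \<theta> (z v - z w) \<noteq> 0 \<and> \<theta> (h + (z v - z w)) \<noteq> 0"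
  shows "weight_sum q I h \<mu> (\<lambda>k l. z (idx I k l)) k z = (\<Prod>j\<in>{1..k}. \<Prod>i\<in>{1..<j}. diagonal_factor q I z h \<mu> i j)"
  using g
proof (induction k)
  case (Suc k)
  let ?f = "\<lambda>\<sigma>. idx I k \<circ> \<sigma> \<circ> slot I k"
  let ?term = "\<lambda>\<sigma>. level_weight q I h \<mu> k (z \<circ> ?f \<sigma>) z * weight_sum q I h \<mu> (\<lambda>k l. z (idx I k l)) k (z \<circ> ?f \<sigma>)"
  have inj: "inj I" using I by (rule bij_is_inj)
  have roots: "(\<lambda>l. z (idx I k l)) \<circ> \<sigma> \<circ> slot I k = z \<circ> ?f \<sigma>" for \<sigma>
    by (simp add: fun_eq_iff)
  have only_id: "?term \<sigma> = 0" if \<sigma>: "\<sigma> permutes {1..k}" "\<sigma> \<noteq> id" for \<sigma>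
  proof (rule ccontr)
    assume "?term \<sigma> \<noteq> 0"
    then have nz: "level_weight q I h \<mu> k (z \<circ> ?f \<sigma>) (z \<circ> id) \<noteq> 0" by auto
    note bij = level_root_labelling[OF inj inj \<sigma>(1)]
    have "?f \<sigma> v \<le> v" if "v \<in> I ` {1..k}" for v
      by (rule level_weight_nonzero_imp_below[OF nz bij bij_betw_id _ that]) simp
    then have id: "?f \<sigma> v = v" if "v \<in> I ` {1..k}" for v
      using below_identity[OF _ bij _ that] by blast
    have "\<sigma> a = a" if a: "a \<in> {1..k}" for a
    proof -
      have "idx I k (\<sigma> a) = idx I k a"
        using id[OF idx_in[OF inj a]] slot_idx[OF inj a] by simp
      moreover have "\<sigma> a \<in> {1..k}"
        using permutes_in_image[OF \<sigma>(1)] a by blast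
      ultimately show ?thesis
        using slot_idx[OF inj] a by metis
    qed
    then have "\<sigma> = id"
      using permutes_not_in[OF \<sigma>(1)] by (metis eq_id_iff)
    with \<sigma>(2) show False by contradiction
  qed
  have gk: "\<theta> (z v - z w) \<noteq> 0 \<and> \<theta> (h + (z v - z w)) \<noteq> 0"
    if "v \<in> I ` {1..k}" "w \<in> I ` {1..k}" "v \<noteq> w" for v w
    by (rule Suc.prems) (use that in auto)
  have "weight_sum q I h \<mu> (\<lambda>k l. z (idx I k l)) (Suc k) z = (\<Sum>\<sigma> | \<sigma> permutes {1..k}. ?term \<sigma>)"
    unfolding weight_sum.simps roots ..
  also have "\<dots> = (\<Sum>\<sigma>\<in>{id}. ?term \<sigma>)"
    using only_id by (intro sum.mono_neutral_right) (auto simp: finite_permutations permutes_id)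
  also have "\<dots> = level_weight q I h \<mu> k z z * weight_sum q I h \<mu> (\<lambda>k l. z (idx I k l)) k z"
  proof -
    have "(z \<circ> ?f id) v = z v" if "v \<in> I ` {1..k}" for v
      using idx_slot[OF inj that] by simp
    then show ?thesis
      using level_weight_cong[of I k "z \<circ> ?f id" z] weight_sum_cong[of I k "z \<circ> ?f id" z] by simp
  qed
  also have "\<dots> = (\<Prod>j\<in>{1..Suc k}. \<Prod>i\<in>{1..<j}. diagonal_factor q I z h \<mu> i j)"
  proof -
    have "level_weight q I h \<mu> k z z = (\<Prod>i\<in>{1..k}. diagonal_factor q I z h \<mu> i (Suc k))"
      by (rule level_weight_diagonal[OF I]) (rule gk)
    moreover have "weight_sum q I h \<mu> (\<lambda>k l. z (idx I k l)) k z = (\<Prod>j\<in>{1..k}. \<Prod>i\<in>{1..<j}. diagonal_factor q I z h \<mu> i j)"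
      by (rule Suc.IH) (rule gk)
    ultimately show ?thesis
      by (simp add: atLeastLessThanSuc_atLeastAtMost mult.commute)
  qed
  finally show ?case .
qed simp

section \<open>The longest permutation and the extreme row and column\<close>

abbreviation w0 :: "nat \<Rightarrow> nat \<Rightarrow> nat" where
  "w0 \<equiv> longest_perm"

lemma w0_w0: "w0 n (w0 n i) = i"
  by (auto simp: longest_perm_def)

lemma w0_permutes: "w0 n permutes {1..n}"
  by (rule bij_imp_permutes, rule bij_betwI[where g = "w0 n"]) (auto simp: longest_perm_def)

lemma w0_comp_w0: "w0 n \<circ> w0 n = id"
  by (simp add: fun_eq_iff w0_w0)

lemma inv_w0: "inv (w0 n) = w0 n"
  by (rule inv_unique_comp) (rule w0_comp_w0)+

lemma w0_less_iff: "i \<in> {1..n} \<Longrightarrow> j \<in> {1..n} \<Longrightarrow> w0 n i < w0 n j \<longleftrightarrow> j < i"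
  by (auto simp: longest_perm_def)

lemma permutes_le_imp_id:
  fixes J :: "nat \<Rightarrow> nat"
  assumes J: "J permutes {1..n}" and "\<And>k. k \<in> {1..n} \<Longrightarrow> J k \<le> k"
  shows "J = id"
proof (rule ext)
  fix k
  show "J k = id k"
  proof (cases "k \<in> {1..n}")
    case True
    then show ?thesis
      using below_identity[OF finite_atLeastAtMost permutes_imp_bij[OF J] assms(2)] by simp
  qed (simp add: permutes_not_in[OF J])
qed

context nome
begin

lemma restr_entry_nonzero_imp_below:
  assumes I: "I permutes {1..n}" and J: "J permutes {1..n}" and nz: "restr_entry q n I J z h \<mu> \<noteq> 0"
    and "k \<le> n"
  obtains f where "bij_betw f (I ` {1..k}) (J ` {1..k})" "\<And>c. c \<in> I ` {1..k} \<Longrightarrow> f c \<le> c"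
proof -
  have "\<exists>f. bij_betw f (I ` {1..k}) (J ` {1..k}) \<and> (\<forall>c\<in>I ` {1..k}. f c \<le> c)"
  proof (rule weight_sum_nonzero_imp_below[OF permutes_inj[OF I] permutes_inj[OF J]])
    show "weight_sum q I h \<mu> (\<lambda>k l. z (idx J k l)) n (z \<circ> id) \<noteq> 0"
      using nz by (simp add: restr_entry_def)
    show "bij_betw id (I ` {1..n}) (J ` {1..n})"
      unfolding permutes_image[OF I] permutes_image[OF J] by (rule bij_betw_id)
  qed (use \<open>k \<le> n\<close> in simp_all)
  then show ?thesis using that by blast
qed

text \<open>The first \<open>k\<close> values of \<open>J\<close> are the images of
  \<open>{1..k}\<close> under a map that never increases a value, so \<open>J k \<le> k\<close> for
  every \<open>k\<close>.\<close>

lemma restr_entry_id_eq_0: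
  assumes J: "J permutes {1..n}" "J \<noteq> id"
  shows "restr_entry q n id J z h \<mu> = 0"
proof (rule ccontr)
  assume nz: "restr_entry q n id J z h \<mu> \<noteq> 0"
  have "J k \<le> k" if "k \<in> {1..n}" for k
  proof -
    obtain f where f: "bij_betw f (id ` {1..k}) (J ` {1..k})" "\<And>c. c \<in> id ` {1..k} \<Longrightarrow> f c \<le> c"
      using restr_entry_nonzero_imp_below[OF permutes_id J(1) nz, of k] \<open>k \<in> {1..n}\<close> by auto
    have "J k \<in> f ` {1..k}"
      using bij_betw_imp_surj_on[OF f(1)] \<open>k \<in> {1..n}\<close> by simp
    then obtain c where "c \<in> {1..k}" "J k = f c" by blast
    then show ?thesis
      using f(2)[of c] by simp
  qed
  then have "J = id"
    by (rule permutes_le_imp_id[OF J(1)])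
  with J(2) show False by contradiction
qed

text \<open>The first \<open>k\<close> values of \<open>w0 n\<close> are the largest ones. As
  \<open>f\<close> does not increase \<open>I k\<close> and maps it to one of them,
  \<open>I k\<close> is at least \<open>n + 1 - k\<close>.\<close>

lemma restr_entry_w0_eq_0:
  assumes I: "I permutes {1..n}" "I \<noteq> w0 n"
  shows "restr_entry q n I (w0 n) z h \<mu> = 0"
proof (rule ccontr)
  assume nz: "restr_entry q n I (w0 n) z h \<mu> \<noteq> 0"
  have "(w0 n \<circ> I) k \<le> k" if k: "k \<in> {1..n}" for k
  proof -
    obtain f where f: "bij_betw f (I ` {1..k}) (w0 n ` {1..k})" "\<And>c. c \<in> I ` {1..k} \<Longrightarrow> f c \<le> c"
      using restr_entry_nonzero_imp_below[OF I(1) w0_permutes nz, of k] k by auto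
    have Ik: "I k \<in> I ` {1..k}" using k by simp
    then obtain c where c: "c \<in> {1..k}" "f (I k) = w0 n c"
      using bij_betwE[OF f(1)] by blast
    have "w0 n c \<le> I k"
      using f(2)[OF Ik] c by simp
    moreover have "I k \<in> {1..n}"
      using permutes_in_image[OF I(1)] k by blast
    ultimately show ?thesis
      using c k by (auto simp: longest_perm_def split: if_splits)
  qed
  then have "w0 n \<circ> I = id"
    by (rule permutes_le_imp_id[OF permutes_compose[OF I(1) w0_permutes]])
  then have "w0 n \<circ> (w0 n \<circ> I) = w0 n" by simp
  then show False
    using I(2) by (simp add: comp_assoc[symmetric] w0_comp_w0)
qed

lemma restr_entry_diagonal:
  assumes I: "I permutes {1..n}" and g: "doubly_generic q n z h \<mu>"
  shows "restr_entry q n I I z h \<mu> = (\<Prod>j\<in>{1..n}. \<Prod>i\<in>{1..<j}. diagonal_factor q I z h \<mu> i j)"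
  unfolding restr_entry_def
proof (rule weight_sum_diagonal[OF permutes_bij[OF I]], unfold permutes_image[OF I])
  fix v w assume vw: "v \<in> {1..n}" "w \<in> {1..n}" "v \<noteq> w"
  show "\<theta> (z v - z w) \<noteq> 0 \<and> \<theta> (h + (z v - z w)) \<noteq> 0"
    by (intro conjI doubly_genericD(1,2)[OF g vw])
qed

end

section \<open>Products over pairs of positions and the initial entries\<close>

definition ordered_pairs :: "nat \<Rightarrow> (nat \<times> nat) set" where
  "ordered_pairs n = {(i, j). 1 \<le> i \<and> i < j \<and> j \<le> n}"

lemma prod_ordered_pairs: "(\<Prod>j\<in>{1..n}. \<Prod>i\<in>{1..<j}. F i j) = (\<Prod>(i, j)\<in>ordered_pairs n. F i j)"
proof -
  have "(\<Prod>j\<in>{1..n}. \<Prod>i\<in>{1..<j}. F i j) = (\<Prod>(j, i)\<in>Sigma {1..n} (\<lambda>j. {1..<j}). F i j)"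
    by (rule prod.Sigma) auto
  also have "\<dots> = (\<Prod>(i, j)\<in>ordered_pairs n. F i j)"
    by (rule prod.reindex_bij_witness[where i = prod.swap and j = prod.swap])
      (auto simp: ordered_pairs_def)
  finally show ?thesis .
qed

lemma finite_ordered_pairs: "finite (ordered_pairs n)"
  by (rule finite_subset[of _ "{1..n} \<times> {1..n}"]) (auto simp: ordered_pairs_def)

lemma card_ordered_pairs: "card (ordered_pairs n) = n * (n - 1) div 2"
proof -
  have "card (ordered_pairs n) = card (Sigma {1..n} (\<lambda>j. {1..<j}))"
    by (rule bij_betw_same_card[where f = prod.swap], rule bij_betwI[where g = prod.swap])
      (auto simp: ordered_pairs_def)
  also have "\<dots> = (\<Sum>j\<in>{1..n}. j - 1)"
    by simp
  also have "\<dots> = (\<Sum>j\<in>{0..<n}. j)"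
    by (rule sum.reindex_bij_witness[where i = Suc and j = "\<lambda>j. j - 1"]) auto
  also have "\<dots> = n * (n - 1) div 2"
    by (rule gauss_sum_from_Suc_0[of "n - 1", simplified] | simp add: Sum_Ico_nat)+
  finally show ?thesis .
qed

lemma prod_ordered_pairs_w0:
  "(\<Prod>(i, j)\<in>ordered_pairs n. F (w0 n j) (w0 n i)) = (\<Prod>(i, j)\<in>ordered_pairs n. F i j)"
  by (rule prod.reindex_bij_witness[where i = "\<lambda>(i, j). (w0 n j, w0 n i)" and j = "\<lambda>(i, j). (w0 n j, w0 n i)"])
    (auto simp: ordered_pairs_def longest_perm_def)

text \<open>The transposition permutes all ordered pairs except the pair of \<open>m\<close> and
  \<open>Suc m\<close>, which it reverses. Multiplying both sides instead of dividing keeps the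
  identity valid when \<open>F\<close> has zeros.\<close>

lemma prod_ordered_pairs_adj:
  fixes F :: "nat \<Rightarrow> nat \<Rightarrow> complex"
  assumes m: "1 \<le> m" "m < n"
  shows "(\<Prod>(i, j)\<in>ordered_pairs n. F (adj m i) (adj m j)) * F m (Suc m) = (\<Prod>(i, j)\<in>ordered_pairs n. F i j) * F (Suc m) m"
proof -
  let ?s = "adj m" and ?P = "{m, Suc m} \<times> {m, Suc m}"
  have P: "ordered_pairs n \<inter> ?P = {(m, Suc m)}"
    using m by (auto simp: ordered_pairs_def)
  have in_range: "1 \<le> ?s i \<longleftrightarrow> 1 \<le> i" "?s i \<le> n \<longleftrightarrow> i \<le> n" for i
    using m by (auto simp: Transposition.transpose_def)
  have bij: "bij_betw (map_prod ?s ?s) (ordered_pairs n \<inter> - ?P) (ordered_pairs n \<inter> - ?P)"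
  proof (rule bij_betw_map_prod_involutions)
    show "(?s v, ?s w) \<in> ordered_pairs n \<longleftrightarrow> (v, w) \<in> ordered_pairs n" if "(v, w) \<notin> ?P" for v w
    proof -
      have "?s v < ?s w \<longleftrightarrow> v < w"
        using that by (intro adj_less_iff) blast
      then show ?thesis
        unfolding ordered_pairs_def mem_Collect_eq prod.case in_range by (simp only:)
    qed
    show "(?s v, ?s w) \<in> ?P \<longleftrightarrow> (v, w) \<in> ?P" for v w
      unfolding mem_Times_iff fst_conv snd_conv adj_in_pair_iff ..
  qed simp_all
  have "(\<Prod>(i, j)\<in>ordered_pairs n \<inter> - ?P. F i j) = (\<Prod>(i, j)\<in>ordered_pairs n \<inter> - ?P. F (?s i) (?s j))"
    by (rule prod_pairs_cong[OF bij]) simp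
  then show ?thesis
    unfolding prod.Int_Diff[OF finite_ordered_pairs, of _ n ?P] Diff_eq P by (simp add: mult_ac)
qed

context nome
begin

text \<open>All positions \<open>i < j\<close> are inversions of \<open>w0 n\<close>, so only the
  first branch of \<open>diagonal_factor\<close> occurs; reindexing by \<open>w0 n\<close> then
  removes it from the arguments.\<close>

lemma restr_entry_w0_w0:
  assumes g: "doubly_generic q n z h \<mu>"
  shows "restr_entry q n (w0 n) (w0 n) z h \<mu>
    = (\<Prod>(i, j)\<in>ordered_pairs n. \<theta> (h + (z i - z j))) * (\<Prod>(i, j)\<in>ordered_pairs n. \<theta> (\<mu> j - \<mu> i))"
proof -
  have "restr_entry q n (w0 n) (w0 n) z h \<mu> = (\<Prod>(i, j)\<in>ordered_pairs n. diagonal_factor q (w0 n) z h \<mu> i j)"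
    unfolding restr_entry_diagonal[OF w0_permutes g] by (rule prod_ordered_pairs)
  also have "\<dots> = (\<Prod>(i, j)\<in>ordered_pairs n. \<theta> (h + (z (w0 n j) - z (w0 n i))) * \<theta> (\<mu> j - \<mu> i))"
    by (rule prod.cong) (auto simp: ordered_pairs_def diagonal_factor_def w0_less_iff)
  also have "\<dots> = (\<Prod>(i, j)\<in>ordered_pairs n. \<theta> (h + (z (w0 n j) - z (w0 n i)))) * (\<Prod>(i, j)\<in>ordered_pairs n. \<theta> (\<mu> j - \<mu> i))"
    by (simp add: case_prod_unfold prod.distrib)
  finally show ?thesis
    unfolding prod_ordered_pairs_w0[of "\<lambda>i j. \<theta> (h + (z i - z j))"] .
qed

lemma restr_entry_id_id:
  assumes g: "doubly_generic q n z h \<mu>"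
  shows "restr_entry q n id id z h \<mu>
    = (\<Prod>(i, j)\<in>ordered_pairs n. \<theta> (z j - z i)) * (\<Prod>(i, j)\<in>ordered_pairs n. \<theta> (h + (\<mu> j - \<mu> i)))"
proof -
  have "restr_entry q n id id z h \<mu> = (\<Prod>(i, j)\<in>ordered_pairs n. diagonal_factor q id z h \<mu> i j)"
    unfolding restr_entry_diagonal[OF permutes_id g] by (rule prod_ordered_pairs)
  also have "\<dots> = (\<Prod>(i, j)\<in>ordered_pairs n. \<theta> (z j - z i) * \<theta> (h + (\<mu> j - \<mu> i)))"
    by (rule prod.cong) (auto simp: ordered_pairs_def diagonal_factor_def)
  finally show ?thesis
    by (simp add: case_prod_unfold prod.distrib)
qed

text \<open>Under either transposition only the factor of the pair \<open>m\<close>,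
  \<open>Suc m\<close> changes. For \<open>z\<close> its argument changes around \<open>h\<close>,
  for \<open>\<mu>\<close> it only changes sign.\<close>

lemma restr_entry_w0_w0_adj:
  assumes g: "doubly_generic q n z h \<mu>" and m: "1 \<le> m" "m < n"
  shows "restr_entry q n (w0 n) (w0 n) (z \<circ> adj m) h \<mu> * \<theta> (h + (z m - z (Suc m)))
      = restr_entry q n (w0 n) (w0 n) z h \<mu> * \<theta> (h - (z m - z (Suc m)))"
    and "restr_entry q n (w0 n) (w0 n) z h (\<mu> \<circ> adj m) = - restr_entry q n (w0 n) (w0 n) z h \<mu>"
proof -
  note s = adj_permutes[OF m]
  let ?Z = "\<lambda>z. \<Prod>(i, j)\<in>ordered_pairs n. \<theta> (h + (z i - z j))" and ?M = "\<lambda>\<mu>. \<Prod>(i, j)\<in>ordered_pairs n. \<theta> (\<mu> j - \<mu> i)"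
  have gz: "doubly_generic q n (z \<circ> adj m) h \<mu>" and g\<mu>: "doubly_generic q n z h (\<mu> \<circ> adj m)"
    using doubly_generic_permuted[OF g s permutes_id] doubly_generic_permuted[OF g permutes_id s] by simp_all
  have "?Z (z \<circ> adj m) * \<theta> (h + (z m - z (Suc m))) = ?Z z * \<theta> (h + (z (Suc m) - z m))"
    using prod_ordered_pairs_adj[OF m, of "\<lambda>i j. \<theta> (h + (z i - z j))"] by simp
  moreover have "h + (z (Suc m) - z m) = h - (z m - z (Suc m))" by simp
  ultimately show "restr_entry q n (w0 n) (w0 n) (z \<circ> adj m) h \<mu> * \<theta> (h + (z m - z (Suc m)))
      = restr_entry q n (w0 n) (w0 n) z h \<mu> * \<theta> (h - (z m - z (Suc m)))"
    unfolding restr_entry_w0_w0[OF g] restr_entry_w0_w0[OF gz] by (simp add: mult_ac)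
  have "?M (\<mu> \<circ> adj m) * \<theta> (\<mu> (Suc m) - \<mu> m) = ?M \<mu> * \<theta> (\<mu> m - \<mu> (Suc m))"
    using prod_ordered_pairs_adj[OF m, of "\<lambda>i j. \<theta> (\<mu> j - \<mu> i)"] by simp
  also have "\<theta> (\<mu> m - \<mu> (Suc m)) = - \<theta> (\<mu> (Suc m) - \<mu> m)"
    unfolding theta_minus[symmetric] by simp
  finally have eq: "?M (\<mu> \<circ> adj m) * \<theta> (\<mu> (Suc m) - \<mu> m) = ?M \<mu> * - \<theta> (\<mu> (Suc m) - \<mu> m)" .
  have cancel: "x = - y" if "x * c = y * - c" "c \<noteq> 0" for x y c :: complex
    using that by (metis minus_mult_commute mult_right_cancel)
  have "?M (\<mu> \<circ> adj m) = - ?M \<mu>"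
    by (rule cancel[OF eq]) (rule doubly_genericD(3)[OF g], use m in simp_all)
  then show "restr_entry q n (w0 n) (w0 n) z h (\<mu> \<circ> adj m) = - restr_entry q n (w0 n) (w0 n) z h \<mu>"
    unfolding restr_entry_w0_w0[OF g] restr_entry_w0_w0[OF g\<mu>] by simp
qed

end

text \<open>Adjacent transpositions generate the symmetric group. The base is the longest
  permutation, since its column is the one known explicitly; \<open>?Q g\<close> says that left
  multiplication by \<open>g\<close> preserves \<open>P\<close>.\<close>

lemma permutes_adj_induct [consumes 1, case_names w0 adj]:
  fixes J :: "nat \<Rightarrow> nat"
  assumes J: "J permutes {1..n}"
    and w0: "P (w0 n)"
    and adj: "\<And>J m. J permutes {1..n} \<Longrightarrow> 1 \<le> m \<Longrightarrow> m < n \<Longrightarrow> P J \<Longrightarrow> P (adj m \<circ> J)"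
  shows "P J"
proof -
  let ?Q = "\<lambda>g. \<forall>J. J permutes {1..n} \<longrightarrow> P J \<longrightarrow> P (g \<circ> J)"
  have adj_Q: "?Q (adj m)" if "1 \<le> m" "m < n" for m
    using adj that by blast
  have comp_Q: "?Q (f \<circ> g)" if "?Q f" "?Q g" "g permutes {1..n}" for f g
    using that permutes_compose[OF _ \<open>g permutes {1..n}\<close>] by (simp add: comp_assoc)
  have trans_Q: "?Q (Transposition.transpose a (a + Suc d))" if "1 \<le> a" "a + Suc d \<le> n" for a d
    using that
  proof (induction d)
    case 0
    then have "1 \<le> a" "a < n" by simp_all
    then show ?case
      unfolding add_Suc_right add_0_right by (rule adj_Q)
  next
    case (Suc d)
    let ?b = "a + Suc d"
    \<comment> \<open>A longer transposition is a shorter one conjugated by an adjacent one.\<close>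
    have eq: "Transposition.transpose a (a + Suc (Suc d)) = adj ?b \<circ> (Transposition.transpose a ?b \<circ> adj ?b)"
      by (auto simp: fun_eq_iff Transposition.transpose_def)
    have b: "1 \<le> ?b" "?b < n" using Suc.prems by auto
    have p: "adj ?b permutes {1..n}" "Transposition.transpose a ?b permutes {1..n}"
      using Suc.prems by (auto intro!: permutes_swap_id)
    show ?case
      unfolding eq using Suc.prems
      by (intro comp_Q adj_Q[OF b] Suc.IH p permutes_compose) auto
  qed
  have "?Q g" if "g permutes {1..n}" for g
    using that finite_atLeastAtMost[of 1 n]
  proof (induction g rule: permutes_induct)
    case (swap a b p)
    have "?Q (Transposition.transpose a b)"
    proof (cases a b rule: linorder_cases)
      case less
      then show ?thesis
        using trans_Q[of a "b - a - 1"] swap.hyps by simp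
    next
      case greater
      then show ?thesis
        using trans_Q[of b "a - b - 1"] swap.hyps by (simp add: transpose_commute)
    qed (use swap.hyps in simp)
    then show ?case
      by (rule comp_Q[OF _ swap.IH \<open>p permutes {1..n}\<close>])
  qed auto
  \<comment> \<open>Applying the permutation \<open>J \<circ> w0 n\<close> to the base
    \<open>w0 n\<close> gives \<open>J\<close>.\<close>
  from this[OF permutes_compose[OF w0_permutes J]] w0 w0_permutes
  have "P ((J \<circ> w0 n) \<circ> w0 n)" by blast
  then show ?thesis
    by (simp add: comp_assoc w0_comp_w0)
qed

lemma w0_comp_adj:
  assumes "1 \<le> k" "k < n"
  shows "w0 n \<circ> adj k = adj (n - k) \<circ> w0 n"
  using assms by (auto simp: fun_eq_iff longest_perm_def Transposition.transpose_def)

lemma comp_adj_cancel: "f \<circ> adj m \<circ> adj m = f"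
  by (simp add: fun_eq_iff)

lemma adj_comp_cancel: "adj m \<circ> (adj m \<circ> f) = f"
  by (simp add: fun_eq_iff)

lemma inv_comp_adj:
  assumes "bij I"
  shows "inv (I \<circ> adj k) = adj k \<circ> inv I"
  using o_inv_distrib[OF assms, of "adj k"] by simp

section \<open>The Kaehler exchange relation and the mirror identity at generic parameters\<close>

context nome
begin

text \<open>The permutation \<open>w0 n \<circ> adj k\<close> is also
  \<open>adj m \<circ> w0 n\<close> with \<open>m = n - k\<close>. The equivariant relation at
  \<open>z \<circ> adj m\<close> therefore expresses its column through the column of
  \<open>w0 n\<close>, where everything is known.\<close>

lemma kaehler_exchange_w0:
  assumes I: "I permutes {1..n}" and k: "1 \<le> k" "k < n" and g: "doubly_generic q n z h \<mu>"
  defines "d \<equiv> \<mu> (Suc k) - \<mu> k" and "\<nu> \<equiv> z (w0 n (Suc k)) - z (w0 n k)"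
  shows "\<theta> \<nu> * \<theta> (h + d) * restr_entry q n (I \<circ> adj k) (w0 n) z h (\<mu> \<circ> adj k)
    = \<theta> h * \<theta> (\<nu> - d) * restr_entry q n I (w0 n) z h \<mu> + \<theta> d * \<theta> (h + \<nu>) * restr_entry q n I (w0 n \<circ> adj k) z h \<mu>"
proof -
  let ?R = "restr_entry q n"
  define m where "m = n - k"
  have m: "1 \<le> m" "m < n" and mk: "w0 n k = Suc m" "w0 n (Suc k) = m" "w0 n m = Suc k" "w0 n (Suc m) = k"
    using k by (auto simp: m_def longest_perm_def)
  have w0s: "w0 n \<circ> adj k = adj m \<circ> w0 n"
    unfolding m_def by (rule w0_comp_adj[OF k])
  let ?z = "z \<circ> adj m"
  let ?\<rho> = "\<mu> (inv I (Suc m)) - \<mu> (inv I m)"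
  let ?D = "?R (w0 n) (w0 n) z h \<mu>" and ?Ds = "?R (w0 n) (w0 n) ?z h \<mu>"
  let ?A = "?R I (adj m \<circ> w0 n) z h \<mu>"
  have gs: "doubly_generic q n ?z h \<mu>"
    using doubly_generic_permuted[OF g adj_permutes[OF m] permutes_id] by simp
  have \<nu>: "\<nu> = z m - z (Suc m)"
    by (simp add: \<nu>_def mk)
  have mn: "m \<in> {1..n}" "Suc m \<in> {1..n}" "m \<noteq> Suc m" and kn: "k \<in> {1..n}" "Suc k \<in> {1..n}" "Suc k \<noteq> k"
    using m k by auto
  have flip: "?z m - ?z (Suc m) = - \<nu>" "h - \<nu> = h + (z (Suc m) - z m)"
    by (simp_all add: \<nu>)
  have nz: "\<theta> \<nu> \<noteq> 0" "\<theta> (h - \<nu>) \<noteq> 0" "\<theta> d \<noteq> 0"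
    unfolding flip(2) unfolding \<nu> d_def
    by (rule doubly_genericD(1)[OF g mn] doubly_genericD(2)[OF g mn(2,1) mn(3)[symmetric]] doubly_genericD(3)[OF g kn(2,1,3)])+
  have R: "\<theta> ?\<rho> * \<theta> (h - \<nu>) * ?A
    = \<theta> h * \<theta> (?\<rho> + \<nu>) * ?R I (w0 n) ?z h \<mu> - \<theta> \<nu> * \<theta> (h + ?\<rho>) * ?R (adj m \<circ> I) (w0 n) ?z h \<mu>"
    using restr_entry_exchange[OF I w0_permutes m gs] unfolding flip(1) comp_adj_cancel theta_minus by simp
  have D: "?Ds * \<theta> (h + \<nu>) = ?D * \<theta> (h - \<nu>)"
    unfolding \<nu> by (rule restr_entry_w0_w0_adj(1)[OF g m])
  have D': "?R (w0 n) (w0 n) z h (\<mu> \<circ> adj k) = - ?D"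
    by (rule restr_entry_w0_w0_adj(2)[OF g k])
  have sI: "adj m \<circ> I permutes {1..n}" and Is: "I \<circ> adj k permutes {1..n}"
    by (rule permutes_compose[OF I adj_permutes[OF m]] permutes_compose[OF adj_permutes[OF k] I])+
  have sI_iff: "adj m \<circ> I = w0 n \<longleftrightarrow> I = adj m \<circ> w0 n"
    by (metis adj_comp_cancel)
  have Is_iff: "I \<circ> adj k = w0 n \<longleftrightarrow> I = adj m \<circ> w0 n"
    unfolding w0s[symmetric] by (metis comp_adj_cancel)
  have neq: "adj m \<circ> w0 n \<noteq> w0 n"
  proof
    assume "adj m \<circ> w0 n = w0 n"
    from fun_cong[OF this, of k] show False
      by (simp add: mk)
  qed
  \<comment> \<open>In the first two cases exactly one of the terms in the column of
    \<open>w0 n\<close> survives, and \<open>D\<close> moves it from \<open>?z\<close> back to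
    \<open>z\<close>. In the third case the relation reads 0 = 0.\<close>
  consider "I = w0 n" | "I = adj m \<circ> w0 n" | "I \<noteq> w0 n" "I \<noteq> adj m \<circ> w0 n" by blast
  then have "\<theta> \<nu> * \<theta> (h + d) * ?R (I \<circ> adj k) (w0 n) z h (\<mu> \<circ> adj k)
    = \<theta> h * \<theta> (\<nu> - d) * ?R I (w0 n) z h \<mu> + \<theta> d * \<theta> (h + \<nu>) * ?A" (is ?goal)
  proof cases
    case 1
    have \<rho>: "?\<rho> = - d"
      by (simp add: 1 inv_w0 mk d_def)
    have zeros: "?R (adj m \<circ> I) (w0 n) ?z h \<mu> = 0" "?R (I \<circ> adj k) (w0 n) z h (\<mu> \<circ> adj k) = 0"
      using sI_iff Is_iff neq 1 by (metis restr_entry_w0_eq_0[OF sI] restr_entry_w0_eq_0[OF Is])+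
    have "- \<theta> d * \<theta> (h - \<nu>) * ?A = \<theta> h * \<theta> (\<nu> - d) * ?Ds"
      using R unfolding \<rho> zeros theta_minus unfolding 1 by simp
    then have "\<theta> (h - \<nu>) * (\<theta> h * \<theta> (\<nu> - d) * ?D + \<theta> d * \<theta> (h + \<nu>) * ?A) = 0"
      using D by algebra
    then show ?goal
      unfolding zeros unfolding 1 using nz(2) by simp
  next
    case 2
    have "bij (w0 n)" using w0_permutes by (rule permutes_bij)
    then have \<rho>: "?\<rho> = d"
      unfolding 2 by (simp add: inv_adj_comp inv_w0 mk d_def)
    have zero: "?R I (w0 n) Z h \<mu> = 0" for Z
      using neq 2 by (intro restr_entry_w0_eq_0[OF I]) simp
    have w: "adj m \<circ> I = w0 n" "I \<circ> adj k = w0 n"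
      using sI_iff Is_iff 2 by blast+
    have "\<theta> d * \<theta> (h - \<nu>) * ?A = - (\<theta> \<nu> * \<theta> (h + d) * ?Ds)"
      using R unfolding \<rho> zero w by simp
    then have "\<theta> (h - \<nu>) * (\<theta> d * \<theta> (h + \<nu>) * ?A + \<theta> \<nu> * \<theta> (h + d) * ?D) = 0"
      using D by algebra
    then have "\<theta> d * \<theta> (h + \<nu>) * ?A + \<theta> \<nu> * \<theta> (h + d) * ?D = 0"
      using nz(2) by simp
    then show ?goal
      unfolding zero w D' by algebra
  next
    case 3
    have zeros: "?R I (w0 n) Z h \<mu> = 0" "?R (adj m \<circ> I) (w0 n) Z h \<mu> = 0"
      "?R (I \<circ> adj k) (w0 n) Z h (\<mu> \<circ> adj k) = 0" for Z
      using 3 sI_iff Is_iff restr_entry_w0_eq_0[OF I] restr_entry_w0_eq_0[OF sI] restr_entry_w0_eq_0[OF Is] by blast+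
    have inv_in: "inv I v \<in> {1..n}" if "v \<in> {1..n}" for v
      using permutes_in_image[OF permutes_inv[OF I]] that by blast
    have "inv I (Suc m) \<noteq> inv I m"
      using inj_eq[OF permutes_inj[OF permutes_inv[OF I]]] by simp
    then have "\<theta> ?\<rho> \<noteq> 0"
      by (rule doubly_genericD(3)[OF g inv_in[OF mn(2)] inv_in[OF mn(1)]])
    then have "?A = 0"
      using R nz(2) unfolding zeros by simp
    then show ?goal
      unfolding zeros by simp
  qed
  then show ?thesis
    unfolding w0s .
qed

text \<open>The Kaehler relation for \<open>adj m \<circ> J\<close> follows from those for
  \<open>J\<close>, taken with \<open>I\<close> and with \<open>adj m \<circ> I\<close>, because the
  coefficients of the equivariant step are the same for all three entries involved.\<close>

theorem kaehler_exchange: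
  assumes J: "J permutes {1..n}" and I: "I permutes {1..n}" and k: "1 \<le> k" "k < n" and g: "doubly_generic q n z h \<mu>"
  shows "\<theta> (z (J (Suc k)) - z (J k)) * \<theta> (h + (\<mu> (Suc k) - \<mu> k)) * restr_entry q n (I \<circ> adj k) J z h (\<mu> \<circ> adj k)
    = \<theta> h * \<theta> (z (J (Suc k)) - z (J k) - (\<mu> (Suc k) - \<mu> k)) * restr_entry q n I J z h \<mu>
    + \<theta> (\<mu> (Suc k) - \<mu> k) * \<theta> (h + (z (J (Suc k)) - z (J k))) * restr_entry q n I (J \<circ> adj k) z h \<mu>"
  using J I g
proof (induction J arbitrary: I z rule: permutes_adj_induct)
  case w0
  then show ?case by (intro kaehler_exchange_w0[OF _ k])
next
  case (adj J m)
  let ?R = "restr_entry q n"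
  note I = adj.prems(1) and g = adj.prems(2) and J = adj.hyps(1) and m = adj.hyps(2,3)
  let ?z = "z \<circ> adj m"
  let ?\<nu> = "?z (J (Suc k)) - ?z (J k)" and ?d = "\<mu> (Suc k) - \<mu> k"
  let ?\<rho> = "\<mu> (inv I (Suc m)) - \<mu> (inv I m)" and ?\<delta> = "?z m - ?z (Suc m)"
  have s: "adj m permutes {1..n}" "adj k permutes {1..n}"
    by (rule adj_permutes[OF m] adj_permutes[OF k])+
  have gs: "doubly_generic q n ?z h \<mu>" "doubly_generic q n ?z h (\<mu> \<circ> adj k)"
    using doubly_generic_permuted[OF g s(1) permutes_id] doubly_generic_permuted[OF g s] by simp_all
  have perms: "adj m \<circ> I permutes {1..n}" "I \<circ> adj k permutes {1..n}" "J \<circ> adj k permutes {1..n}"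
    by (rule permutes_compose[OF I s(1)] permutes_compose[OF s(2) I] permutes_compose[OF s(2) J])+
  \<comment> \<open>Transposing the positions of \<open>I\<close> and the Kaehler parameters
    together leaves the parameter attached to each value unchanged, so the coefficients of the
    equivariant relation survive the Kaehler move.\<close>
  have \<rho>: "(\<mu> \<circ> adj k) (inv (I \<circ> adj k) (Suc m)) - (\<mu> \<circ> adj k) (inv (I \<circ> adj k) m) = ?\<rho>"
    unfolding inv_comp_adj[OF permutes_bij[OF I]] by simp
  have mn: "m \<in> {1..n}" "Suc m \<in> {1..n}" "m \<noteq> Suc m"
    using m by auto
  have inv_in: "inv I v \<in> {1..n}" if "v \<in> {1..n}" for v
    using permutes_in_image[OF permutes_inv[OF I]] that by blast
  have "inv I (Suc m) \<noteq> inv I m"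
    using inj_eq[OF permutes_inj[OF permutes_inv[OF I]]] by simp
  then have nz: "\<theta> ?\<rho> \<noteq> 0" "\<theta> (h + ?\<delta>) \<noteq> 0"
    using doubly_genericD(3)[OF g inv_in[OF mn(2)] inv_in[OF mn(1)]] doubly_genericD(2)[OF gs(1) mn] by blast+
  define A where "A = ?R I (adj m \<circ> J) z h \<mu>"
  define B where "B = ?R (I \<circ> adj k) (adj m \<circ> J) z h (\<mu> \<circ> adj k)"
  define C where "C = ?R I (adj m \<circ> (J \<circ> adj k)) z h \<mu>"
  define a where "a = ?R I J ?z h \<mu>"
  define a' where "a' = ?R (adj m \<circ> I) J ?z h \<mu>"
  define b where "b = ?R (I \<circ> adj k) J ?z h (\<mu> \<circ> adj k)"
  define b' where "b' = ?R (adj m \<circ> I \<circ> adj k) J ?z h (\<mu> \<circ> adj k)"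
  define c where "c = ?R I (J \<circ> adj k) ?z h \<mu>"
  define c' where "c' = ?R (adj m \<circ> I) (J \<circ> adj k) ?z h \<mu>"
  have RA: "\<theta> ?\<rho> * \<theta> (h + ?\<delta>) * A = \<theta> h * \<theta> (?\<rho> - ?\<delta>) * a + \<theta> ?\<delta> * \<theta> (h + ?\<rho>) * a'"
    using restr_entry_exchange[OF I J m gs(1)] unfolding comp_adj_cancel A_def a_def a'_def .
  have RB: "\<theta> ?\<rho> * \<theta> (h + ?\<delta>) * B = \<theta> h * \<theta> (?\<rho> - ?\<delta>) * b + \<theta> ?\<delta> * \<theta> (h + ?\<rho>) * b'"
    using restr_entry_exchange[OF perms(2) J m gs(2)] unfolding comp_adj_cancel \<rho> B_def b_def b'_def unfolding comp_assoc .
  have RC: "\<theta> ?\<rho> * \<theta> (h + ?\<delta>) * C = \<theta> h * \<theta> (?\<rho> - ?\<delta>) * c + \<theta> ?\<delta> * \<theta> (h + ?\<rho>) * c'"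
    using restr_entry_exchange[OF I perms(3) m gs(1)] unfolding comp_adj_cancel C_def c_def c'_def .
  have IH: "\<theta> ?\<nu> * \<theta> (h + ?d) * b = \<theta> h * \<theta> (?\<nu> - ?d) * a + \<theta> ?d * \<theta> (h + ?\<nu>) * c"
    unfolding a_def b_def c_def by (rule adj.IH[OF I gs(1)])
  have IH': "\<theta> ?\<nu> * \<theta> (h + ?d) * b' = \<theta> h * \<theta> (?\<nu> - ?d) * a' + \<theta> ?d * \<theta> (h + ?\<nu>) * c'"
    unfolding a'_def b'_def c'_def by (rule adj.IH[OF perms(1) gs(1)])
  \<comment> \<open>The claim is multiplied by the pivot of the equivariant relation:
    \<open>B\<close> is expanded into \<open>b\<close> and \<open>b'\<close>, the induction
    hypotheses are applied, and the result is collected into \<open>A\<close> and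
    \<open>C\<close>.\<close>
  have "(\<theta> ?\<rho> * \<theta> (h + ?\<delta>)) * (\<theta> ?\<nu> * \<theta> (h + ?d) * B)
    = \<theta> h * \<theta> (?\<rho> - ?\<delta>) * (\<theta> ?\<nu> * \<theta> (h + ?d) * b) + \<theta> ?\<delta> * \<theta> (h + ?\<rho>) * (\<theta> ?\<nu> * \<theta> (h + ?d) * b')"
    using RB by algebra
  also have "\<dots> = \<theta> h * \<theta> (?\<nu> - ?d) * (\<theta> h * \<theta> (?\<rho> - ?\<delta>) * a + \<theta> ?\<delta> * \<theta> (h + ?\<rho>) * a')
    + \<theta> ?d * \<theta> (h + ?\<nu>) * (\<theta> h * \<theta> (?\<rho> - ?\<delta>) * c + \<theta> ?\<delta> * \<theta> (h + ?\<rho>) * c')"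
    unfolding IH IH' by algebra
  also have "\<dots> = (\<theta> ?\<rho> * \<theta> (h + ?\<delta>)) * (\<theta> h * \<theta> (?\<nu> - ?d) * A + \<theta> ?d * \<theta> (h + ?\<nu>) * C)"
    unfolding RA[symmetric] RC[symmetric] by algebra
  finally have "\<theta> ?\<nu> * \<theta> (h + ?d) * B = \<theta> h * \<theta> (?\<nu> - ?d) * A + \<theta> ?d * \<theta> (h + ?\<nu>) * C"
    using nz by simp
  then show ?case
    unfolding A_def B_def C_def comp_assoc o_apply .
qed

text \<open>Both sides obey one recursion: for the left side it is the equivariant relation, for the
  right side the Kaehler relation, with the same coefficients. In the base case only
  \<open>I = w0 n\<close> gives a nonzero entry, and it is matched with the entry of the identity;
  the sign arises there.\<close>

theorem restr_entry_mirror: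
  assumes J: "J permutes {1..n}" and I: "I permutes {1..n}" and g: "doubly_generic q n z h \<mu>"
  shows "restr_entry q n I J z h \<mu>
    = (-1) ^ (n * (n - 1) div 2) * restr_entry q n (w0 n \<circ> inv J) (w0 n \<circ> inv I) (\<mu> \<circ> w0 n) h (\<lambda>i. - z i)"
  using J I g
proof (induction J arbitrary: I z rule: permutes_adj_induct)
  case w0
  let ?R = "restr_entry q n"
  note I = w0(1) and g = w0(2)
  let ?\<mu> = "\<mu> \<circ> w0 n" and ?z = "\<lambda>i. - z i"
  have gs: "doubly_generic q n ?\<mu> h ?z"
    using doubly_generic_permuted[OF doubly_generic_swapped[OF g] w0_permutes permutes_id] by simp
  have inv_I: "w0 n \<circ> inv I permutes {1..n}"
    by (rule permutes_compose[OF permutes_inv[OF I] w0_permutes])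
  have id: "w0 n \<circ> inv (w0 n) = id"
    by (simp add: inv_w0 w0_comp_w0)
  show ?case
  proof (cases "I = w0 n")
    case True
    let ?Z = "\<Prod>(i, j)\<in>ordered_pairs n. \<theta> (h + (z i - z j))"
    have "(\<Prod>(i, j)\<in>ordered_pairs n. \<theta> (?\<mu> j - ?\<mu> i)) = (\<Prod>(i, j)\<in>ordered_pairs n. \<theta> (\<mu> i - \<mu> j))"
      using prod_ordered_pairs_w0[of "\<lambda>i j. \<theta> (\<mu> i - \<mu> j)" n] by simp
    also have "\<dots> = (\<Prod>(i, j)\<in>ordered_pairs n. - 1 * \<theta> (\<mu> j - \<mu> i))"
    proof (rule prod.cong[OF refl])
      have flip: "\<theta> (\<mu> i - \<mu> j) = - 1 * \<theta> (\<mu> j - \<mu> i)" for i j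
        unfolding mult_minus1 theta_minus[symmetric] minus_diff_eq ..
      fix x :: "nat \<times> nat"
      obtain i j where x: "x = (i, j)" by (rule prod.exhaust)
      show "(case x of (i, j) \<Rightarrow> \<theta> (\<mu> i - \<mu> j)) = (case x of (i, j) \<Rightarrow> - 1 * \<theta> (\<mu> j - \<mu> i))"
        unfolding x prod.case by (rule flip)
    qed
    also have "\<dots> = (-1) ^ (n * (n - 1) div 2) * (\<Prod>(i, j)\<in>ordered_pairs n. \<theta> (\<mu> j - \<mu> i))"
      unfolding case_prod_unfold prod.distrib by (simp add: card_ordered_pairs)
    finally have M: "(\<Prod>(i, j)\<in>ordered_pairs n. \<theta> (?\<mu> j - ?\<mu> i))
      = (-1) ^ (n * (n - 1) div 2) * (\<Prod>(i, j)\<in>ordered_pairs n. \<theta> (\<mu> j - \<mu> i))" .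
    have "- z j - - z i = z i - z j" for i j by simp
    then have Z: "(\<Prod>(i, j)\<in>ordered_pairs n. \<theta> (h + (- z j - - z i))) = ?Z"
      by (simp only:)
    have sign: "(-1) ^ N * ((-1) ^ N * x * y) = y * x" for N and x y :: complex
      by (simp add: mult.assoc[symmetric] power_add[symmetric])
    show ?thesis
      unfolding True id restr_entry_w0_w0[OF g] restr_entry_id_id[OF gs] M Z sign ..
  next
    case False
    have neq: "w0 n \<circ> inv I \<noteq> id"
    proof
      assume "w0 n \<circ> inv I = id"
      then have "w0 n \<circ> (w0 n \<circ> inv I) = w0 n" by simp
      then have "inv I = w0 n"
        by (simp only: comp_assoc[symmetric] w0_comp_w0 id_comp)
      then have "I = w0 n"
        using inv_inv_eq[OF permutes_bij[OF I]] inv_w0 by metis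
      with False show False by contradiction
    qed
    show ?thesis
      unfolding id restr_entry_w0_eq_0[OF I False] restr_entry_id_eq_0[OF inv_I neq] mult_zero_right ..
  qed
next
  case (adj J m)
  let ?R = "restr_entry q n"
  note I = adj.prems(1) and g = adj.prems(2) and J = adj.hyps(1) and m = adj.hyps(2,3)
  let ?z = "z \<circ> adj m" and ?y = "\<mu> \<circ> w0 n"
  let ?K = "w0 n \<circ> inv J" and ?L = "w0 n \<circ> inv I"
  let ?\<rho> = "\<mu> (inv I (Suc m)) - \<mu> (inv I m)" and ?\<delta> = "?z m - ?z (Suc m)"
  let ?sgn = "(-1) ^ (n * (n - 1) div 2) :: complex"
  have s: "adj m permutes {1..n}"
    by (rule adj_permutes[OF m])
  have gs: "doubly_generic q n ?z h \<mu>"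
    using doubly_generic_permuted[OF g s permutes_id] by simp
  have gy: "doubly_generic q n ?y h (\<lambda>i. - ?z i)"
    using doubly_generic_permuted[OF doubly_generic_swapped[OF gs] w0_permutes permutes_id] by simp
  have perms: "adj m \<circ> I permutes {1..n}" "?K permutes {1..n}" "?L permutes {1..n}"
    by (rule permutes_compose[OF I s] permutes_compose[OF permutes_inv[OF I] w0_permutes] permutes_compose[OF permutes_inv[OF J] w0_permutes])+
  have inv_s: "inv (adj m \<circ> J) = inv J \<circ> adj m" "inv (adj m \<circ> I) = inv I \<circ> adj m"
    using inv_adj_comp[OF permutes_bij[OF J], of m] inv_adj_comp[OF permutes_bij[OF I], of m] by (auto simp: fun_eq_iff)
  have mn: "m \<in> {1..n}" "Suc m \<in> {1..n}" "m \<noteq> Suc m"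
    using m by auto
  have inv_in: "inv I v \<in> {1..n}" if "v \<in> {1..n}" for v
    using permutes_in_image[OF permutes_inv[OF I]] that by blast
  have "inv I (Suc m) \<noteq> inv I m"
    using inj_eq[OF permutes_inj[OF permutes_inv[OF I]]] by simp
  then have nz: "\<theta> ?\<rho> \<noteq> 0" "\<theta> (h + ?\<delta>) \<noteq> 0"
    using doubly_genericD(3)[OF g inv_in[OF mn(2)] inv_in[OF mn(1)]] doubly_genericD(2)[OF gs mn] by blast+
  have RA: "\<theta> ?\<rho> * \<theta> (h + ?\<delta>) * ?R I (adj m \<circ> J) z h \<mu>
    = \<theta> h * \<theta> (?\<rho> - ?\<delta>) * ?R I J ?z h \<mu> + \<theta> ?\<delta> * \<theta> (h + ?\<rho>) * ?R (adj m \<circ> I) J ?z h \<mu>"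
    using restr_entry_exchange[OF I J m gs] unfolding comp_adj_cancel .
  \<comment> \<open>The two copies of \<open>w0 n\<close>, in the labels and in the variables,
    cancel. Hence the coefficient differences on the mirror side are the original
    \<open>?\<rho>\<close>; the negation of \<open>z\<close> produces \<open>?\<delta>\<close> in
    the same way.\<close>
  have y: "?y (?L v) = \<mu> (inv I v)" for v
    by (simp add: w0_w0)
  have \<delta>: "- ?z (Suc m) - - ?z m = ?\<delta>" by simp
  have z: "(\<lambda>i. - ?z i) \<circ> adj m = (\<lambda>i. - z i)"
    by (simp add: fun_eq_iff)
  have RB: "\<theta> ?\<rho> * \<theta> (h + ?\<delta>) * ?R (?K \<circ> adj m) ?L ?y h (\<lambda>i. - z i)
    = \<theta> h * \<theta> (?\<rho> - ?\<delta>) * ?R ?K ?L ?y h (\<lambda>i. - ?z i)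
    + \<theta> ?\<delta> * \<theta> (h + ?\<rho>) * ?R ?K (?L \<circ> adj m) ?y h (\<lambda>i. - ?z i)"
    using kaehler_exchange[OF perms(3,2) m gy] unfolding y \<delta> z .
  have inv_s': "w0 n \<circ> inv (adj m \<circ> J) = ?K \<circ> adj m" "w0 n \<circ> inv (adj m \<circ> I) = ?L \<circ> adj m"
    by (simp_all only: inv_s comp_assoc)
  have scale: "a * (e * x) + b * (e * y) = c * (e * w)" if "c * w = a * x + b * y" for a b c e w x y :: complex
    using that by algebra
  have "(\<theta> ?\<rho> * \<theta> (h + ?\<delta>)) * ?R I (adj m \<circ> J) z h \<mu>
    = (\<theta> ?\<rho> * \<theta> (h + ?\<delta>)) * (?sgn * ?R (?K \<circ> adj m) ?L ?y h (\<lambda>i. - z i))"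
    unfolding RA adj.IH[OF I gs] adj.IH[OF perms(1) gs] inv_s' by (rule scale[OF RB])
  moreover have "\<theta> ?\<rho> * \<theta> (h + ?\<delta>) \<noteq> 0"
    using nz by (simp only: mult_eq_0_iff simp_thms)
  ultimately show ?case
    unfolding inv_s' using mult_left_cancel by blast
qed

end

section \<open>Continuity and torus fixed points\<close>

text \<open>If \<open>f\<close> were far from \<open>L\<close> at some point of \<open>S\<close>
  near \<open>p\<close>, continuity would make it far at nearby points of the dense set as well.
  Only continuity on \<open>S\<close> is involved, so \<open>p\<close> may lie outside.\<close>

lemma tendsto_within_dense_iff:
  fixes f :: "'a::t1_space \<Rightarrow> 'b::metric_space"
  assumes "D \<subseteq> S" and cont: "continuous_on S f"
    and dense: "\<And>x U. x \<in> S \<Longrightarrow> open U \<Longrightarrow> x \<in> U \<Longrightarrow> U \<inter> D \<noteq> {}"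
  shows "(f \<longlongrightarrow> L) (at p within S) \<longleftrightarrow> (f \<longlongrightarrow> L) (at p within D)"
proof
  assume "(f \<longlongrightarrow> L) (at p within S)"
  then show "(f \<longlongrightarrow> L) (at p within D)"
    using \<open>D \<subseteq> S\<close> by (rule tendsto_within_subset)
next
  assume lim: "(f \<longlongrightarrow> L) (at p within D)"
  show "(f \<longlongrightarrow> L) (at p within S)"
    unfolding tendsto_iff
  proof (intro allI impI)
    fix e :: real assume "0 < e"
    then have "\<forall>\<^sub>F x in at p within D. dist (f x) L < e / 2"
      using tendstoD[OF lim, of "e / 2"] by simp
    then obtain U where U: "open U" "p \<in> U" "\<And>x. x \<in> U \<Longrightarrow> x \<noteq> p \<Longrightarrow> x \<in> D \<Longrightarrow> dist (f x) L < e / 2"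
      unfolding eventually_at_topological by blast
    have "dist (f x) L < e" if x: "x \<in> U" "x \<noteq> p" "x \<in> S" for x
    proof (rule ccontr)
      assume "\<not> dist (f x) L < e"
      then have far: "f x \<in> {y. dist y L > e / 2}"
        using \<open>0 < e\<close> by simp
      have "open {y. dist y L > e / 2}"
        by (intro open_Collect_less continuous_intros)
      then obtain T where T: "open T" "T \<inter> S = f -` {y. dist y L > e / 2} \<inter> S"
        using cont unfolding continuous_on_open_invariant by blast
      \<comment> \<open>The point \<open>p\<close> is removed so that the point found by density is
        admissible in the punctured limit; this is where singletons must be closed.\<close>
      have "x \<in> T \<inter> (U - {p})"
        using far T(2) x by blast
      moreover have "open (T \<inter> (U - {p}))"
        using T(1) U(1) by (intro open_Int open_Diff) auto
      ultimately obtain y where y: "y \<in> T \<inter> (U - {p})" "y \<in> D"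
        using dense[OF x(3)] by blast
      then have "dist (f y) L > e / 2"
        using T(2) \<open>D \<subseteq> S\<close> by blast
      moreover have "dist (f y) L < e / 2"
        using U(3)[of y] y by blast
      ultimately show False by simp
    qed
    then show "\<forall>\<^sub>F x in at p within S. dist (f x) L < e"
      unfolding eventually_at_topological using U(1,2) by blast
  qed
qed

lemma eventually_at_within_involution:
  fixes g :: "'a::topological_space \<Rightarrow> 'a"
  assumes inv: "\<And>x. g (g x) = x" and cont: "continuous_on UNIV g" and D: "\<And>x. g x \<in> D \<longleftrightarrow> x \<in> D"
    and ev: "eventually P (at (g p) within D)"
  shows "eventually (\<lambda>x. P (g x)) (at p within D)"
proof -
  obtain U where U: "open U" "g p \<in> U" "\<And>x. x \<in> U \<Longrightarrow> x \<noteq> g p \<Longrightarrow> x \<in> D \<Longrightarrow> P x"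
    using ev unfolding eventually_at_topological by blast
  have "open (g -` U)"
    using U(1) cont by (rule open_vimage)
  moreover have "g x \<noteq> g p" if "x \<noteq> p" for x
    using that inv by metis
  ultimately show ?thesis
    unfolding eventually_at_topological using U(2,3) D by (intro exI[of _ "g -` U"]) auto
qed

lemma tendsto_at_within_involution:
  fixes g :: "'a::topological_space \<Rightarrow> 'a" and f :: "'a \<Rightarrow> 'b::topological_space"
  assumes inv: "\<And>x. g (g x) = x" and cont: "continuous_on UNIV g" and D: "\<And>x. g x \<in> D \<longleftrightarrow> x \<in> D"
  shows "(f \<longlongrightarrow> L) (at (g p) within D) \<longleftrightarrow> ((\<lambda>x. f (g x)) \<longlongrightarrow> L) (at p within D)"
proof -
  have "eventually P (at (g p) within D) \<longleftrightarrow> eventually (\<lambda>x. P (g x)) (at p within D)" for P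
    using eventually_at_within_involution[OF inv cont D, of P p]
      eventually_at_within_involution[OF inv cont D, of "\<lambda>x. P (g x)" "g p"] inv by auto
  then show ?thesis
    by (simp add: tendsto_def)
qed

section \<open>Continuity of restricted sections and density of doubly generic parameters\<close>

context nome
begin

lemma level_weight_continuous:
  fixes H :: "'a::topological_space \<Rightarrow> complex"
  assumes "continuous_on A H" "\<And>i. continuous_on A (\<lambda>p. M p i)"
    and X: "\<And>v. v \<in> I ` {1..k} \<Longrightarrow> continuous_on A (\<lambda>p. X p v)"
    and Y: "\<And>v. v \<in> I ` {1..k+1} \<Longrightarrow> continuous_on A (\<lambda>p. Y p v)"
    and nz: "\<And>p v w. p \<in> A \<Longrightarrow> v \<in> I ` {1..k} \<Longrightarrow> w \<in> I ` {1..k} \<Longrightarrow> v < w \<Longrightarrow>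
      \<theta> (H p + X p v - X p w) \<noteq> 0 \<and> \<theta> (X p w - X p v) \<noteq> 0"
  shows "continuous_on A (\<lambda>p. level_weight q I (H p) (M p) k (X p) (Y p))"
  unfolding level_weight_def
proof (rule continuous_on_divide)
  have "continuous_on A (\<lambda>p. psi_val q I (H p) (M p) k v w (Y p w - X p v))"
    if "v \<in> I ` {1..k}" "w \<in> I ` {1..k+1}" for v w
    unfolding psi_val_def using assms(1,2) X[OF that(1)] Y[OF that(2)]
    by (cases v w rule: linorder_cases) (auto intro!: continuous_intros theta_continuous)
  then show "continuous_on A (\<lambda>p. \<Prod>v\<in>I ` {1..k}. \<Prod>w\<in>I ` {1..k+1}. psi_val q I (H p) (M p) k v w (Y p w - X p v))"
    by (intro continuous_on_prod)
  show "continuous_on A (\<lambda>p. \<Prod>v\<in>I ` {1..k}. \<Prod>w\<in>{w \<in> I ` {1..k}. v < w}. \<theta> (H p + X p v - X p w) * \<theta> (X p w - X p v))"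
    using assms(1) X by (intro continuous_on_prod continuous_on_mult theta_continuous continuous_intros) auto
  show "\<forall>p\<in>A. (\<Prod>v\<in>I ` {1..k}. \<Prod>w\<in>{w \<in> I ` {1..k}. v < w}. \<theta> (H p + X p v - X p w) * \<theta> (X p w - X p v)) \<noteq> 0"
    using nz by auto
qed

text \<open>The symmetrization brings the roots of a level into every order, so the denominators
  have to be controlled for all ordered pairs of distinct indices.\<close>

lemma weight_sum_continuous:
  fixes H :: "'a::topological_space \<Rightarrow> complex"
  assumes I: "inj I" and H: "continuous_on A H" and M: "\<And>i. continuous_on A (\<lambda>p. M p i)"
    and T: "\<And>j l. continuous_on A (\<lambda>p. T p j l)"
    and nz: "\<And>p j a b. p \<in> A \<Longrightarrow> j < k \<Longrightarrow> a \<in> {1..j} \<Longrightarrow> b \<in> {1..j} \<Longrightarrow> a \<noteq> b \<Longrightarrow>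
      \<theta> (H p + T p j a - T p j b) \<noteq> 0 \<and> \<theta> (T p j a - T p j b) \<noteq> 0"
    and Y: "\<And>v. continuous_on A (\<lambda>p. Y p v)"
  shows "continuous_on A (\<lambda>p. weight_sum q I (H p) (M p) (T p) k (Y p))"
  using nz Y
proof (induction k arbitrary: Y)
  case (Suc k)
  have "continuous_on A (\<lambda>p. level_weight q I (H p) (M p) k (T p k \<circ> \<sigma> \<circ> slot I k) (Y p))" if \<sigma>: "\<sigma> permutes {1..k}" for \<sigma>
  proof (rule level_weight_continuous[OF H M])
    fix p v w assume p: "p \<in> A" and vw: "v \<in> I ` {1..k}" "w \<in> I ` {1..k}" "v < w"
    have "\<sigma> (slot I k v) \<in> {1..k}" "\<sigma> (slot I k w) \<in> {1..k}"
      using slot_in[OF I] vw(1,2) permutes_in_image[OF \<sigma>] by blast+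
    moreover have "slot I k v \<noteq> slot I k w"
      using idx_slot[OF I vw(1)] idx_slot[OF I vw(2)] vw(3) by auto
    then have "\<sigma> (slot I k v) \<noteq> \<sigma> (slot I k w)"
      using inj_eq[OF permutes_inj[OF \<sigma>]] by simp
    ultimately show "\<theta> (H p + (T p k \<circ> \<sigma> \<circ> slot I k) v - (T p k \<circ> \<sigma> \<circ> slot I k) w) \<noteq> 0 \<and>
        \<theta> ((T p k \<circ> \<sigma> \<circ> slot I k) w - (T p k \<circ> \<sigma> \<circ> slot I k) v) \<noteq> 0"
      using Suc.prems(1)[OF p lessI, of "\<sigma> (slot I k v)" "\<sigma> (slot I k w)"]
        Suc.prems(1)[OF p lessI, of "\<sigma> (slot I k w)" "\<sigma> (slot I k v)"] by simp
  qed (use T Suc.prems(2) in simp_all)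
  moreover have "continuous_on A (\<lambda>p. weight_sum q I (H p) (M p) (T p) k (T p k \<circ> \<sigma> \<circ> slot I k))" for \<sigma>
    by (rule Suc.IH) (use Suc.prems(1) T in auto)
  ultimately show ?case
    unfolding weight_sum.simps by (intro continuous_on_sum continuous_on_mult) simp_all
qed simp

text \<open>Each condition cuts a nonempty open set down to a nonempty open set, so finitely many
  conditions can be imposed one after the other on a single variable.\<close>

lemma finite_theta_nonzero_dense:
  assumes "finite B" "open W" "W \<noteq> {}" "\<And>c b. (c, b) \<in> B \<Longrightarrow> c \<noteq> 0"
  shows "\<exists>w\<in>W. \<forall>(c, b)\<in>B. \<theta> (c * w + b) \<noteq> 0"
  using assms
proof (induction B arbitrary: W rule: finite_induct)
  case (insert x B)
  obtain c b where x: "x = (c, b)" by (rule prod.exhaust)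
  have c: "c \<noteq> 0"
    using insert.prems(3)[of c b] x by simp
  let ?W = "{w \<in> W. \<theta> (c * w + b) \<noteq> 0}"
  have "open {w. \<theta> (c * w + b) \<noteq> 0}"
    by (intro open_Collect_neq theta_continuous continuous_intros)
  then have op: "open ?W"
    using insert.prems(1) by (simp add: Collect_conj_eq open_Int)
  have ne: "?W \<noteq> {}"
    using theta_nonzero_dense[OF insert.prems(2,1) c, of b] by blast
  have "\<exists>w\<in>?W. \<forall>(c, b)\<in>B. \<theta> (c * w + b) \<noteq> 0"
    by (rule insert.IH[OF op ne]) (use insert.prems(3) in blast)
  then show ?case
    using x by auto
qed auto

text \<open>The generic parameters constrain \<open>z\<close> but not \<open>\<mu>\<close>, so the
  swap of the two does not preserve them. It does preserve this subset, on which limits for both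
  varieties can be compared.\<close>

definition doubly_generic_params :: "nat \<Rightarrow> params set" where
  "doubly_generic_params n = {(z, h, \<mu>). z \<in> Cn n \<and> \<mu> \<in> Cn n \<and> doubly_generic q n z h \<mu>}"

lemma doubly_generic_params_subset: "doubly_generic_params n \<subseteq> generic_params q n"
  using doubly_genericD(1,2)
  unfolding doubly_generic_params_def generic_params_def log_params_def
  by (fastforce simp: add_diff_eq)

text \<open>The conditions on \<open>z\<close> and \<open>h\<close> alone hold already, so only
  \<open>\<mu>\<close> is moved, along one complex line.\<close>

lemma doubly_generic_params_dense:
  assumes x: "x \<in> generic_params q n" and U: "open U" "x \<in> U"
  shows "U \<inter> doubly_generic_params n \<noteq> {}"
proof -
  obtain z h \<mu> where xeq: "x = (z, h, \<mu>)" by (metis prod_cases3)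
  have z: "z \<in> Cn n" "\<mu> \<in> Cn n"
    and g: "\<And>i j. i \<in> {1..n} \<Longrightarrow> j \<in> {1..n} \<Longrightarrow> i \<noteq> j \<Longrightarrow> \<theta> (z i - z j) \<noteq> 0 \<and> \<theta> (h + z i - z j) \<noteq> 0"
    using x by (auto simp: xeq generic_params_def log_params_def)
  \<comment> \<open>A direction with pairwise distinct entries: along it each difference of Kaehler
    parameters is an affine function of \<open>w\<close> with nonzero slope.\<close>
  define v :: "nat \<Rightarrow> complex" where "v i = (if i \<in> {1..n} then of_nat i else 0)" for i
  define \<gamma> where "\<gamma> w = (z, h, \<lambda>i. \<mu> i + w * v i)" for w
  have "continuous_on UNIV \<gamma>"
    unfolding \<gamma>_def by (intro continuous_intros continuous_on_coordinatewise_then_product)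
  then have W: "open (\<gamma> -` U)"
    using U(1) by (intro open_vimage)
  have "\<gamma> 0 = x"
    by (simp add: \<gamma>_def xeq)
  then have ne: "\<gamma> -` U \<noteq> {}"
    using U(2) by blast
  define Q where "Q = {(i, j). i \<in> {1..n} \<and> j \<in> {1..n} \<and> i \<noteq> j}"
  \<comment> \<open>Slopes and offsets of all conditions to be achieved. The extra offset
    \<open>b\<close> is 0, \<open>h\<close> or a difference of equivariant parameters, for the three
    kinds of conditions on \<open>\<mu>\<close>.\<close>
  define B where "B = (\<lambda>((i, j), b). (v i - v j, \<mu> i - \<mu> j + b)) ` (Q \<times> ({0, h} \<union> (\<lambda>(k, l). z k - z l) ` Q))"
  have finQ: "finite Q"
    by (rule finite_subset[of _ "{1..n} \<times> {1..n}"]) (auto simp: Q_def)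
  have "c \<noteq> 0" if "(c, b) \<in> B" for c b
    using that by (auto simp: B_def Q_def v_def)
  moreover have "finite B"
    unfolding B_def using finQ by simp
  ultimately have "\<exists>w\<in>\<gamma> -` U. \<forall>(c, b)\<in>B. \<theta> (c * w + b) \<noteq> 0"
    by (intro finite_theta_nonzero_dense[OF _ W ne])
  then obtain w where w: "w \<in> \<gamma> -` U" "\<And>c b. (c, b) \<in> B \<Longrightarrow> \<theta> (c * w + b) \<noteq> 0"
    by blast
  let ?\<mu> = "\<lambda>i. \<mu> i + w * v i"
  have nz: "\<theta> (b + (?\<mu> i - ?\<mu> j)) \<noteq> 0" if "(i, j) \<in> Q" "b \<in> {0, h} \<union> (\<lambda>(k, l). z k - z l) ` Q" for i j b
  proof -
    have "(v i - v j, \<mu> i - \<mu> j + b) \<in> B"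
      unfolding B_def using that by (intro image_eqI[of _ _ "((i, j), b)"]) auto
    from w(2)[OF this] show ?thesis
      by (simp add: algebra_simps)
  qed
  have "doubly_generic q n z h ?\<mu>"
    unfolding doubly_generic_def
  proof (intro ballI impI conjI)
    fix i j assume ij: "i \<in> {1..n}" "j \<in> {1..n}" "i \<noteq> j"
    then have Q: "(i, j) \<in> Q" by (simp add: Q_def)
    show "\<theta> (z i - z j) \<noteq> 0" "\<theta> (h + (z i - z j)) \<noteq> 0"
      using g[OF ij] by (simp_all add: add_diff_eq)
    show "\<theta> (?\<mu> i - ?\<mu> j) \<noteq> 0" "\<theta> (h + (?\<mu> i - ?\<mu> j)) \<noteq> 0"
      using nz[OF Q, of 0] nz[OF Q, of h] by simp_all
    fix k l assume "k \<in> {1..n}" "l \<in> {1..n}" "k \<noteq> l"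
    then have "z k - z l \<in> {0, h} \<union> (\<lambda>(k, l). z k - z l) ` Q"
      by (force simp: Q_def)
    from nz[OF Q this] show "\<theta> (?\<mu> i - ?\<mu> j + (z k - z l)) \<noteq> 0"
      by (simp only: add.commute[of "z k - z l"] simp_thms)
  qed
  moreover have "?\<mu> \<in> Cn n"
    using z(2) by (auto simp: Cn_def v_def)
  ultimately have "\<gamma> w \<in> doubly_generic_params n"
    using z(1) by (simp add: \<gamma>_def doubly_generic_params_def)
  then show ?thesis
    using w(1) by blast
qed

lemma doubly_generic_exchanged:
  assumes "doubly_generic q n z h \<mu>"
  shows "doubly_generic q n \<mu> h z"
proof -
  show ?thesis
    unfolding doubly_generic_def
  proof (intro ballI impI conjI)
    fix i j assume ij: "i \<in> {1..n}" "j \<in> {1..n}" "i \<noteq> j"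
    show "\<theta> (\<mu> i - \<mu> j) \<noteq> 0" "\<theta> (h + (\<mu> i - \<mu> j)) \<noteq> 0" "\<theta> (z i - z j) \<noteq> 0" "\<theta> (h + (z i - z j)) \<noteq> 0"
      by (rule doubly_genericD[OF assms ij])+
    show "\<theta> (z i - z j + (\<mu> k - \<mu> l)) \<noteq> 0" if "k \<in> {1..n}" "l \<in> {1..n}" "k \<noteq> l" for k l
      unfolding add.commute[of "z i - z j"] by (rule doubly_genericD(5)[OF assms that ij])
  qed
qed

lemma restricted_section_continuous:
  assumes I: "I permutes {1..n}" and J: "J permutes {1..n}" and n: "n \<ge> 1"
  shows "continuous_on (generic_params q n) (\<lambda>(z, h, \<mu>). Stab q n I (\<lambda>k l. z (idx J k l)) z h \<mu>)" (is ?stab)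
    and "continuous_on (generic_params q n) (\<lambda>(z, h, \<mu>). Stab' q n I (\<lambda>k l. z (idx J k l)) z h \<mu>)" (is ?stab')
proof -
  have inj: "inj J" using J by (rule permutes_inj)
  have sub: "J ` {1..k} \<subseteq> {1..n}" if "k \<le> n" for k
    using permutes_image[OF J] that by (metis atLeastatMost_subset_iff image_mono le_refl)
  have nz: "\<theta> (fst (snd p) + fst p (idx J j a) - fst p (idx J j b)) \<noteq> 0 \<and> \<theta> (fst p (idx J j a) - fst p (idx J j b)) \<noteq> 0"
    if "p \<in> generic_params q n" "j < n" "a \<in> {1..j}" "b \<in> {1..j}" "a \<noteq> b" for p j a b
  proof -
    have "idx J j a \<in> {1..n}" "idx J j b \<in> {1..n}"
      using idx_in[OF inj that(3)] idx_in[OF inj that(4)] sub[of j] that(2) by (meson less_imp_le subsetD)+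
    moreover have "idx J j a \<noteq> idx J j b"
      using that(5) slot_idx[OF inj that(3)] slot_idx[OF inj that(4)] by metis
    ultimately show ?thesis
      using that(1) unfolding generic_params_def by (simp add: split_beta)
  qed
  have coord: "continuous_on A (\<lambda>p::params. fst p i)" "continuous_on A (\<lambda>p::params. snd (snd p) i)" for A i
    by (rule continuous_on_product_then_coordinatewise, intro continuous_intros)+
  have "continuous_on (generic_params q n) (\<lambda>p. weight_sum q I (fst (snd p)) (snd (snd p)) (\<lambda>k l. fst p (idx J k l)) n (fst p))"
    by (rule weight_sum_continuous[OF permutes_inj[OF I]]) (use nz coord in \<open>auto intro!: continuous_intros\<close>)
  then show ?stab
    unfolding Stab_def weight_W_eq_weight_sum[OF I n] by (simp only: case_prod_unfold)
  have wI: "w0 n \<circ> I permutes {1..n}"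
    by (rule permutes_compose[OF I w0_permutes])
  have "continuous_on (generic_params q n) (\<lambda>p. weight_sum q (w0 n \<circ> I) (fst (snd p)) (\<lambda>i. - snd (snd p) i)
      (\<lambda>k l. fst p (idx J k l)) n (fst p \<circ> w0 n))"
    by (rule weight_sum_continuous[OF permutes_inj[OF wI]]) (use nz coord in \<open>auto intro!: continuous_intros\<close>)
  then show ?stab'
    unfolding Stab'_def weight_W_chamber_def inv_w0 weight_W_eq_weight_sum[OF wI n]
    by (simp only: case_prod_unfold) (intro continuous_on_mult continuous_on_const)
qed

text \<open>For the opposite chamber, \<open>Stab'\<close> uses the label
  \<open>w0 n \<circ> inv J\<close>, the variables \<open>\<mu> \<circ> w0 n\<close> and the Kaehler
  parameters \<open>- z\<close>. After its roots are relabelled by \<open>w0 n\<close> this is the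
  right side of \<open>restr_entry_mirror\<close>, including the sign.\<close>

lemma Stab_eq_Stab':
  assumes I: "I permutes {1..n}" and J: "J permutes {1..n}" and n: "n \<ge> 1" and g: "doubly_generic q n z h \<mu>"
  shows "Stab q n I (\<lambda>k l. z (idx J k l)) z h \<mu> = Stab' q n (inv J) (\<lambda>k l. \<mu> (idx (inv I) k l)) \<mu> h z"
proof -
  have perms: "w0 n \<circ> inv J permutes {1..n}" "inv I permutes {1..n}"
    by (rule permutes_compose[OF permutes_inv[OF J] w0_permutes] permutes_inv[OF I])+
  have "restr_entry q n (w0 n \<circ> inv J) (w0 n \<circ> inv I) (\<mu> \<circ> w0 n) h (\<lambda>i. - z i)
    = weight_sum q (w0 n \<circ> inv J) h (\<lambda>i. - z i) (\<lambda>k l. \<mu> (idx (inv I) k l)) n (\<mu> \<circ> w0 n)"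
    using weight_sum_relabelled_roots[OF permutes_inj[OF perms(1)] permutes_inj[OF perms(2)] permutes_bij[OF w0_permutes],
        of q h "\<lambda>i. - z i" \<mu> n n "\<mu> \<circ> w0 n"]
    by (simp add: restr_entry_def inv_w0)
  then show ?thesis
    using restr_entry_mirror[OF J I g]
    unfolding Stab_def Stab'_def weight_W_chamber_def inv_w0 weight_W_eq_weight_sum[OF I n]
      weight_W_eq_weight_sum[OF perms(1) n] restr_entry_def by simp
qed

text \<open>The two limits run along different sets, one defined by conditions on \<open>z\<close>,
  the other on \<open>\<mu>\<close>. Each is replaced by the limit along the doubly generic
  parameters, where the sections agree after the swap.\<close>

lemma restrict_component_mirror:
  assumes I: "I permutes {1..n}" and J: "J permutes {1..n}" and n: "n \<ge> 1"
  shows "restrict_component q n (Stab q n I) J (z, h, \<mu>) = restrict_component q n (Stab' q n (inv J)) (inv I) (\<mu>, h, z)"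
proof -
  let ?S = "generic_params q n" and ?D = "doubly_generic_params n"
  let ?F = "\<lambda>(z, h, \<mu>). Stab q n I (\<lambda>k l. z (idx J k l)) z h \<mu>"
  let ?G = "\<lambda>(z, h, \<mu>). Stab' q n (inv J) (\<lambda>k l. z (idx (inv I) k l)) z h \<mu>"
  let ?e = "\<lambda>(z, h, \<mu>). (\<mu>, h, z) :: params"
  note dense = tendsto_within_dense_iff[OF doubly_generic_params_subset _ doubly_generic_params_dense]
  have eq: "(?F \<longlongrightarrow> L) (at (z, h, \<mu>) within ?S) \<longleftrightarrow> (?G \<longlongrightarrow> L) (at (\<mu>, h, z) within ?S)" for L
  proof -
    have "(?F \<longlongrightarrow> L) (at (z, h, \<mu>) within ?S) \<longleftrightarrow> (?F \<longlongrightarrow> L) (at (z, h, \<mu>) within ?D)"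
      by (rule dense[OF restricted_section_continuous(1)[OF I J n]])
    also have "\<dots> \<longleftrightarrow> ((\<lambda>p. ?G (?e p)) \<longlongrightarrow> L) (at (z, h, \<mu>) within ?D)"
    proof (rule tendsto_cong)
      have "?F p = ?G (?e p)" if "p \<in> ?D" for p
        using that Stab_eq_Stab'[OF I J n] by (auto simp: doubly_generic_params_def)
      then show "\<forall>\<^sub>F p in at (z, h, \<mu>) within ?D. ?F p = ?G (?e p)"
        by (simp add: eventually_at_filter)
    qed
    also have "\<dots> \<longleftrightarrow> (?G \<longlongrightarrow> L) (at (?e (z, h, \<mu>)) within ?D)"
    proof (rule tendsto_at_within_involution[symmetric])
      show "continuous_on UNIV ?e"
        unfolding case_prod_unfold by (intro continuous_intros)
      show "?e p \<in> ?D \<longleftrightarrow> p \<in> ?D" for p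
        using doubly_generic_exchanged by (auto simp: doubly_generic_params_def)
    qed auto
    also have "\<dots> \<longleftrightarrow> (?G \<longlongrightarrow> L) (at (\<mu>, h, z) within ?S)"
      unfolding prod.case
      by (rule dense[OF restricted_section_continuous(2)[OF permutes_inv[OF J] permutes_inv[OF I] n], symmetric])
    finally show ?thesis .
  qed
  \<comment> \<open>\<open>Lim\<close> is a definite description, so it depends only on which
    \<open>L\<close> are limits, and \<open>eq\<close> settles this for every
    \<open>L\<close>.\<close>
  show ?thesis
    unfolding restrict_component_def t2_space_class.Lim_def eq by (rule refl)
qed

end

section \<open>Coordinate subspaces and the torus-fixed points\<close>

definition coord_subspace :: "nat set \<Rightarrow> (nat \<Rightarrow> complex) set" where
  "coord_subspace A = {v. \<forall>i. i \<notin> A \<longrightarrow> v i = 0}"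

lemma subspace_coord_subspace: "cfun.subspace (coord_subspace A)"
  by (rule cfun.subspaceI) (auto simp: coord_subspace_def cscale_def)

lemma span_basis_vec:
  assumes "finite A"
  shows "cfun.span (basis_vec ` A) = coord_subspace A"
proof
  show "cfun.span (basis_vec ` A) \<subseteq> coord_subspace A"
    by (rule cfun.span_minimal[OF _ subspace_coord_subspace]) (auto simp: coord_subspace_def basis_vec_def)
  show "coord_subspace A \<subseteq> cfun.span (basis_vec ` A)"
  proof
    fix v assume v: "v \<in> coord_subspace A"
    have "v = (\<Sum>a\<in>A. cscale (v a) (basis_vec a))"
    proof (rule ext)
      fix i
      have "(\<Sum>a\<in>A. cscale (v a) (basis_vec a)) i = (\<Sum>a\<in>A. if a = i then v a else 0)"
        by (induction A rule: infinite_finite_induct) (auto simp: cscale_def basis_vec_def)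
      then show "v i = (\<Sum>a\<in>A. cscale (v a) (basis_vec a)) i"
        using v assms by (simp add: coord_subspace_def)
    qed
    also have "\<dots> \<in> cfun.span (basis_vec ` A)"
      by (intro cfun.span_sum cfun.span_scale cfun.span_base) auto
    finally show "v \<in> cfun.span (basis_vec ` A)" .
  qed
qed

lemma basis_vec_in_coord_subspace: "basis_vec i \<in> coord_subspace A \<longleftrightarrow> i \<in> A"
  by (auto simp: coord_subspace_def basis_vec_def)

lemma coord_subspace_inject: "coord_subspace A = coord_subspace B \<longleftrightarrow> A = B"
  using basis_vec_in_coord_subspace by blast

lemma coord_subspace_mono: "A \<subseteq> B \<Longrightarrow> coord_subspace A \<subseteq> coord_subspace B"
  by (auto simp: coord_subspace_def)

lemma independent_basis_vec: "finite A \<Longrightarrow> cfun.independent (basis_vec ` A)"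
proof (induction A rule: finite_induct)
  case (insert a A)
  then show ?case
    using basis_vec_in_coord_subspace[of a A] span_basis_vec[of A] cfun.independent_insertI by (metis image_insert)
qed (simp add: cfun.independent_empty)

lemma dim_coord_subspace:
  assumes "finite A"
  shows "cfun.dim (coord_subspace A) = card A"
proof -
  have "inj_on basis_vec A"
    by (rule inj_onI) (metis basis_vec_in_coord_subspace singletonI singletonD)
  then have "card (basis_vec ` A) = card A"
    by (rule card_image)
  then show ?thesis
    unfolding span_basis_vec[OF assms, symmetric]
    using cfun.dim_span_eq_card_independent[OF independent_basis_vec[OF assms]] by simp
qed

lemma Cn_eq_coord_subspace: "Cn n = coord_subspace {1..n}"
  by (simp add: Cn_def coord_subspace_def)

lemma coord_flag_point_eq:
  "coord_flag_point n I = ((\<lambda>k. coord_subspace (I ` {1..min k n})), (\<lambda>i j. 0))"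
  unfolding coord_flag_point_def by (simp add: span_basis_vec)

text \<open>The flag determines the sets of the first \<open>k\<close> values, and
  \<open>I k\<close> is the element gained from \<open>k - 1\<close> to \<open>k\<close>.\<close>

lemma coord_flag_point_inject:
  assumes I: "I permutes {1..n}" and J: "J permutes {1..n}" and eq: "coord_flag_point n I = coord_flag_point n J"
  shows "I = J"
proof (rule ext)
  fix k
  show "I k = J k"
  proof (cases "k \<in> {1..n}")
    case True
    have img: "I ` {1..j} = J ` {1..j}" if "j \<le> n" for j
      using fun_cong[OF arg_cong[OF eq, of fst], of j] that
      by (simp add: coord_flag_point_eq coord_subspace_inject min_def)
    have split: "{1..k} = insert k {1..k - 1}"
      using True by auto
    have "insert (I k) (I ` {1..k - 1}) = insert (J k) (J ` {1..k - 1})"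
      using img[of k] True unfolding split by simp
    moreover have "I ` {1..k - 1} = J ` {1..k - 1}"
      using True by (intro img) auto
    moreover have "I k \<notin> I ` {1..k - 1}"
      using permutes_inj[OF I] True by (auto simp: inj_eq)
    ultimately show ?thesis by auto
  next
    case False
    then show ?thesis
      using permutes_not_in[OF I] permutes_not_in[OF J] by simp
  qed
qed

lemma perm_of_coord_flag_point:
  assumes "I permutes {1..n}"
  shows "perm_of_point n (coord_flag_point n I) = I"
  unfolding perm_of_point_def using assms coord_flag_point_inject by (intro the_equality) auto

lemma coord_flag_point_in_cotangent_flags:
  assumes I: "I permutes {1..n}"
  shows "coord_flag_point n I \<in> cotangent_flags n"
proof -
  let ?V = "\<lambda>k. coord_subspace (I ` {1..min k n})"
  have dim: "cfun.dim (?V k) = k" if "k \<le> n" for k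
    using that permutes_inj[OF I] by (simp add: dim_coord_subspace card_image inj_on_subset)
  have mono: "coord_subspace (I ` {1..k}) \<subseteq> coord_subspace (I ` {1..Suc k})" for k
    by (intro coord_subspace_mono image_mono) auto
  have top: "?V k = Cn n" if "k \<ge> n" for k
    using that permutes_image[OF I] by (simp add: Cn_eq_coord_subspace min_def)
  have zero: "(\<lambda>i. 0) \<in> coord_subspace A" for A
    by (simp add: coord_subspace_def)
  show ?thesis
    unfolding cotangent_flags_def complete_flags_def coord_flag_point_eq
    using dim top by (auto simp: subspace_coord_subspace mat_app_def zero intro: subsetD[OF mono[simplified]])
qed

lemma flag_action_coord_flag_point:
  assumes g: "g \<in> equivariant_torus n"
  shows "flag_action g (coord_flag_point n I) = coord_flag_point n I"
proof -
  obtain z c where zc: "g = (z, c)" by (rule prod.exhaust)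
  have z: "z i \<noteq> 0" for i
    using g by (simp add: zc equivariant_torus_def)
  have "(\<lambda>v i. v i / z i) ` coord_subspace A = coord_subspace A" for A
  proof (intro equalityI subsetI)
    fix v assume "v \<in> coord_subspace A"
    then show "v \<in> (\<lambda>v i. v i / z i) ` coord_subspace A"
      using z by (intro image_eqI[of _ _ "\<lambda>i. v i * z i"]) (auto simp: coord_subspace_def)
  qed (auto simp: coord_subspace_def)
  then show ?thesis
    by (simp add: zc coord_flag_point_eq)
qed

text \<open>Scaling the fibre kills the covector, and invariance under the diagonal torus makes
  every \<open>V k\<close> a coordinate subspace. Dimensions force its index set to grow by one
  element per step, and these elements form the permutation.\<close>

lemma torus_fixed_flag_is_coordinate_flag:
  assumes x: "x \<in> cotangent_flags n" and fixed: "\<And>g. g \<in> equivariant_torus n \<Longrightarrow> flag_action g x = x"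
  shows "\<exists>I. I permutes {1..n} \<and> x = coord_flag_point n I"
proof -
  obtain V \<phi> where xV: "x = (V, \<phi>)" by (rule prod.exhaust)
  have sub: "cfun.subspace (V k)" and dim: "k \<le> n \<Longrightarrow> cfun.dim (V k) = k"
    and step: "k < n \<Longrightarrow> V k \<subseteq> V (Suc k)" and top: "k \<ge> n \<Longrightarrow> V k = Cn n" for k
    using x by (auto simp: xV cotangent_flags_def complete_flags_def)
  have "\<phi> i j = 0" for i j
  proof -
    \<comment> \<open>The element that only scales the fibres, here by one half.\<close>
    have "((\<lambda>_. 1), 2) \<in> equivariant_torus n"
      by (simp add: equivariant_torus_def)
    from arg_cong[OF fixed[OF this], of snd] have "\<phi> i j * 1 / (2 * 1) = \<phi> i j"
      unfolding xV by (simp only: flag_action.simps snd_conv) metis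
    then show ?thesis by simp
  qed
  then have \<phi>: "\<phi> = (\<lambda>i j. 0)" by blast
  have mono: "V j \<subseteq> V k" if "j \<le> k" for j k
    using that
  proof (induction k rule: dec_induct)
    case (step k)
    then show ?case
      using \<open>\<And>k. k < n \<Longrightarrow> V k \<subseteq> V (Suc k)\<close>[of k] top[of k] top[of "Suc k"] by (cases "k < n") auto
  qed simp
  have V_Cn: "V k \<subseteq> Cn n" for k
    using mono[of k "max k n"] top[of "max k n"] by simp
  define A where "A k = {i \<in> {1..n}. basis_vec i \<in> V k}" for k
  have V: "V k = coord_subspace (A k)" for k
  proof
    show "V k \<subseteq> coord_subspace (A k)"
    proof
      fix v assume v: "v \<in> V k"
      have "i \<in> A k" if "v i \<noteq> 0" for i
      proof -
        have i: "i \<in> {1..n}"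
          using V_Cn[of k] v that by (auto simp: Cn_def)
        \<comment> \<open>This element halves the coordinate \<open>i\<close>. The difference of
          \<open>v\<close> and its image is therefore \<open>v i / 2\<close> times a basis vector,
          which explains the factor \<open>2 / v i\<close> below.\<close>
        let ?z = "\<lambda>j. if j = i then 2 else 1 :: complex"
        have "(?z, 1) \<in> equivariant_torus n"
          using i by (auto simp: equivariant_torus_def)
        from fun_cong[OF arg_cong[OF fixed[OF this], of fst], of k] have "(\<lambda>v j. v j / ?z j) ` V k = V k"
          by (simp add: xV)
        then have "(\<lambda>j. v j / ?z j) \<in> V k"
          using v by blast
        then have "cscale (2 / v i) (v - (\<lambda>j. v j / ?z j)) \<in> V k"
          using v sub cfun.subspace_diff cfun.subspace_scale by blast
        moreover have "cscale (2 / v i) (v - (\<lambda>j. v j / ?z j)) = basis_vec i"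
          using that by (auto simp: fun_eq_iff cscale_def basis_vec_def)
        ultimately show ?thesis
          using i by (simp add: A_def)
      qed
      then show "v \<in> coord_subspace (A k)"
        by (auto simp: coord_subspace_def)
    qed
    have "cfun.span (basis_vec ` A k) \<subseteq> V k"
      by (rule cfun.span_minimal[OF _ sub]) (auto simp: A_def)
    then show "coord_subspace (A k) \<subseteq> V k"
      using span_basis_vec[of "A k"] by (simp add: A_def)
  qed
  have finA: "finite (A k)" for k by (simp add: A_def)
  have card: "card (A k) = k" if "k \<le> n" for k
    using dim[OF that] dim_coord_subspace[OF finA] V by simp
  have A_mono: "A j \<subseteq> A k" if "j \<le> k" for j k
    using mono[OF that] by (auto simp: A_def)
  define I where "I k = (if k \<in> {1..n} then THE i. A k - A (k - 1) = {i} else k)" for k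
  have I: "A k = insert (I k) (A (k - 1))" if "k \<in> {1..n}" for k
  proof -
    have "card (A k) = k" "card (A (k - 1)) = k - 1"
      using that by (auto intro!: card)
    then have "card (A k - A (k - 1)) = 1"
      using A_mono[of "k - 1" k] that by (simp add: card_Diff_subset finA)
    then obtain i where i: "A k - A (k - 1) = {i}"
      by (auto simp: card_1_singleton_iff)
    then have "I k = i"
      using that by (auto simp: I_def)
    then show ?thesis
      using i A_mono[of "k - 1" k] by auto
  qed
  have img: "I ` {1..k} = A k" if "k \<le> n" for k
    using that
  proof (induction k)
    case 0
    then show ?case using card[of 0] finA[of 0] by simp
  next
    case (Suc k)
    have "{1..Suc k} = insert (Suc k) {1..k}" by auto
    then show ?case
      using Suc I[of "Suc k"] by simp
  qed
  have An: "A n = {1..n}"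
    using top[of n] V[of n] by (simp add: Cn_eq_coord_subspace coord_subspace_inject)
  have "I permutes {1..n}"
  proof (rule bij_imp_permutes)
    have "I ` {1..n} = {1..n}"
      using img[of n] An by simp
    then show "bij_betw I {1..n} {1..n}"
      using finite_surj_inj[of "{1..n}" I] by (simp add: bij_betw_def)
    show "I k = k" if "k \<notin> {1..n}" for k
      using that unfolding I_def by (simp only: if_False)
  qed
  moreover have "V k = coord_subspace (I ` {1..min k n})" for k
    using img[of "min k n"] V[of k] top[of k] An Cn_eq_coord_subspace[of n] by (cases "k \<le> n") (auto simp: min_def)
  then have "x = coord_flag_point n I"
    unfolding xV coord_flag_point_eq \<phi> by auto
  ultimately show ?thesis by blast
qed

lemma fixed_points_flag:
  assumes "points X = cotangent_flags n" "action X = flag_action" "eq_rank X = n"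
  shows "fixed_points X = coord_flag_point n ` {I. I permutes {1..n}}"
proof (intro equalityI subsetI)
  fix x assume "x \<in> fixed_points X"
  then have "\<exists>I. I permutes {1..n} \<and> x = coord_flag_point n I"
    unfolding fixed_points_def assms by (intro torus_fixed_flag_is_coordinate_flag) blast+
  then show "x \<in> coord_flag_point n ` {I. I permutes {1..n}}" by blast
next
  fix x assume "x \<in> coord_flag_point n ` {I. I permutes {1..n}}"
  then obtain I where "I permutes {1..n}" "x = coord_flag_point n I" by blast
  then show "x \<in> fixed_points X"
    unfolding fixed_points_def assms
    using coord_flag_point_in_cotangent_flags flag_action_coord_flag_point by simp
qed

lemma torus_iso_id: "torus_iso n n (\<lambda>u i. if i \<in> {1..n} then u i else 0)"
  unfolding torus_iso_def
  by (rule exI[of _ "\<lambda>i j. if i = j then 1 else 0"], rule exI[of _ "\<lambda>i j. if i = j then 1 else 0"], rule exI[of _ 1])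
    (auto simp: if_distrib[where f = of_int] if_distrib[where f = "\<lambda>c. c * _"] fun_eq_iff cong: if_cong)

theorem corollary4p4:
  fixes q :: complex and n :: nat
  assumes "q \<noteq> 0" and "norm q < 1" and "n \<ge> 1"
  shows "is_3d_mirror_of (flag_X' q n) (flag_X q n)"
proof -
  interpret nome q
    using assms by unfold_locales
  let ?P = "{I. I permutes {1..n}}" and ?pt = "coord_flag_point n"
  \<comment> \<open>Both isomorphisms of parameters are the identity, written with the truncation to
    \<open>{1..n}\<close> that \<open>torus_iso\<close> prescribes; on \<open>Cn n\<close> the
    truncation has no effect.\<close>
  let ?\<kappa> = "\<lambda>(u :: nat \<Rightarrow> complex) i. if i \<in> {1..n} then u i else 0"
  \<comment> \<open>On fixed points the mirror bijection is inversion of permutations, an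
    involution, so it serves as its own inverse.\<close>
  define \<beta> where "\<beta> x = ?pt (inv (perm_of_point n x))" for x
  have fixed: "fixed_points (flag_X q n) = ?pt ` ?P" "fixed_points (flag_X' q n) = ?pt ` ?P"
    by (rule fixed_points_flag; simp add: flag_X_def flag_X'_def)+
  have \<beta>: "\<beta> (?pt I) = ?pt (inv I)" if "I permutes {1..n}" for I
    unfolding \<beta>_def perm_of_coord_flag_point[OF that] ..
  have "bij_betw \<beta> (?pt ` ?P) (?pt ` ?P)"
    by (rule bij_betwI[where g = \<beta>]) (auto simp: \<beta> permutes_inv permutes_inv_inv)
  moreover have "finite (?pt ` ?P)"
    by (simp add: finite_permutations)
  moreover have "torus_iso n n ?\<kappa>"
    by (rule torus_iso_id)
  moreover have "restr_matrix (flag_X q n) x y (z, h, \<mu>) = restr_matrix (flag_X' q n) (\<beta> y) (\<beta> x) (?\<kappa> \<mu>, 1 * h, ?\<kappa> z)"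
    if x: "x \<in> ?pt ` ?P" and y: "y \<in> ?pt ` ?P" and p: "(z, h, \<mu>) \<in> log_params n n" for x y z h \<mu>
  proof -
    obtain I J where IJ: "I permutes {1..n}" "J permutes {1..n}" "x = ?pt I" "y = ?pt J"
      using x y by blast
    have "?\<kappa> \<mu> = \<mu>" "?\<kappa> z = z"
      using p by (auto simp: log_params_def Cn_def fun_eq_iff)
    then show ?thesis
      using restrict_component_mirror[OF IJ(1,2) assms(3)] IJ
      by (simp add: flag_X_def flag_X'_def \<beta> perm_of_coord_flag_point permutes_inv)
  qed
  moreover have "eq_rank (flag_X q n) = n" "kah_rank (flag_X q n) = n" "eq_rank (flag_X' q n) = n" "kah_rank (flag_X' q n) = n"
    by (simp_all add: flag_X_def flag_X'_def)
  ultimately show ?thesis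
    unfolding is_3d_mirror_of_def fixed
    by (intro conjI exI[of _ \<beta>] exI[of _ ?\<kappa>] exI[of _ 1]) (simp_all only: split_paired_Ball_Sigma, blast+)
qed

end
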